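(* Let $\Lambda$ be a unimodular $48$-dimensional lattice of minimum $6$ containing a saturated sublattice $K_8\cong\sqrt3E_8$. Then: (1) Every rank-$9$ cross-section of $\Lambda$ containing $K_8$ has determinant at least $21870$. (2) In each of the lattices $P_{48p}$, $P_{48q}$ and $P_{48n}$ the value $21870$ is attained, for a suitable saturated $K_8\cong\sqrt3E_8$, by a saturated section $K_9\supset K_8$ (with Gram matrix $\mathbf{K}_9$ given in the context), whose complement is a $39$-dimensional lattice packing of center density $2^{-20}3^{16}5^{-1/2}=18.35\ldots$. (3) Every rank-$10$ cross-section containing that $K_9$ has determinant at least $54675$, and this is attained by a saturated section $K_{10}\supset K_9$ (with Gram matrix $\mathbf{K}_{10}$ given in the context) whose complement is a $38$-dimensional lattice packing of center density $2^{-19}3^{31/2}5^{-1}=9.48\ldots$. (4) Every rank-$11$ cross-section containing $K_{10}$ has determinant at least $121500$, so its complement gives a $37$-dimensional bare cross-section packing of center density at most $(3/2)^{37/2}/\sqrt{121500}=5.19\ldots$, which is below $2^{5/2}=5.65\ldots$ (the center density of the best packing known in dimension $37$).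
   Context: Lattices are unimodular if integral of determinant $1$ (determinant of a Gram matrix); the minimum is the smallest squared norm of a nonzero vector. $\sqrt3E_8$ is the $E_8$ root lattice with its bilinear form multiplied by $3$. A sublattice $K\subseteq\Lambda$ is saturated if $\Lambda/K$ is torsion-free; a cross-section (section) of rank $k$ of $\Lambda$ is a sublattice $K=\Lambda\cap U$ of rank $k$ with $U$ a $k$-dimensional subspace (equivalently, a saturated sublattice of rank $k$). Its complement is $L=\Lambda\cap U^{\perp}$, which has rank $48-k$, and the associated (bare cross-section) packing is the packing of $U^\perp$ by balls of radius $\sqrt6/2$ centered at $L$. Center density is density divided by the volume of the unit ball; for this packing it equals $(3/2)^{(48-k)/2}/\sqrt{\det K}$. The lattices. For a self-dual ternary code $C\subset\mathbb{F}_3^{48}$ of minimum distance $15$, let $\Lambda(C)=\{x/\sqrt3: x\in\mathbb{Z}^{48},\ x\bmod 3\in C\}$, an odd unimodular lattice, and let $\Lambda_0$ be its sublattice of vectors of even squared norm. Of the two even unimodular lattices containing $\Lambda_0$, take the one of minimum $6$. For $C$ the Pless symmetry code this is $P_{48p}$; for $C$ the extended quadratic residue code of length $48$ over $\mathbb{F}_3$ this is $P_{48q}$. The Pless symmetry code is generated by the rows of $[I_{24}\mid S]$ over $\mathbb{F}_3$, where $S$ is indexed by $\{\infty\}\cup\mathbb{F}_{23}$ with $S_{\infty\infty}=0$, $S_{\infty j}=1$, $S_{i\infty}=\chi(-1)$, $S_{ij}=\chi(j-i)$, $\chi$ being the quadratic character of $\mathbb{F}_{23}$ ($\chi(0)=0$).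 $P_{48n}$ is Nebe's extremal even unimodular lattice of rank $48$ (minimum $6$), entry CQ48a of the Nebe–Sloane Catalogue of Lattices, whose automorphism group is $(\mathrm{SL}_2(13)\,\mathsf{Y}\,\mathrm{SL}_2(5)).2^2$ (central product). The Gram matrices of $K_9$ and $K_{10}$. $K_{10}$ is the lattice with a basis having Gram matrix $$\mathbf{K}_{10}=\begin{bmatrix}6&-3&-3&-3&-3&-3&-3&3&-2&1\\-3&6&3&3&3&3&3&0&1&-1\\-3&3&6&0&3&0&0&-3&3&1\\-3&3&0&6&3&3&3&0&-1&0\\-3&3&3&3&6&3&3&-3&1&-1\\-3&3&0&3&3&6&3&0&0&-2\\-3&3&0&3&3&3&6&0&1&-2\\3&0&-3&0&-3&0&0&6&-1&1\\-2&1&3&-1&1&0&1&-1&6&2\\1&-1&1&0&-1&-2&-2&1&2&6\end{bmatrix}$$ of determinant $54675$. $K_9$ is spanned by its first nine basis vectors, with Gram matrix $\mathbf{K}_9$ the leading $9\times9$ block, of determinant $21870$. The first eight basis vectors span $K_8\cong\sqrt3E_8$. *)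

theory Defs
  imports
    "HOL-Analysis.Analysis"
    "HOL-Number_Theory.Number_Theory"
    "HOL-Algebra.Elementary_Groups"
    "HOL-Algebra.Algebraic_Closure_Type"
    "Jordan_Normal_Form.Determinant"
    "Berlekamp_Zassenhaus.Finite_Field"
begin

definition int_span :: "'a::euclidean_space list \<Rightarrow> 'a set" where
  "int_span bs = {(\<Sum>i<length bs. of_int (c i) *\<^sub>R bs ! i) | c :: nat \<Rightarrow> int. True}"

definition lattice_basis :: "'a::euclidean_space set \<Rightarrow> 'a list \<Rightarrow> bool" where
  "lattice_basis L bs \<longleftrightarrow> distinct bs \<and> independent (set bs) \<and> L = int_span bs"

text \<open>The rank of a lattice \<open>L\<close> is \<open>dim L\<close>, the dimension of its real span.\<close>

definition is_lattice :: "'a::euclidean_space set \<Rightarrow> bool" where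
  "is_lattice L \<longleftrightarrow> (\<exists>bs. lattice_basis L bs)"

definition gram :: "'a::euclidean_space list \<Rightarrow> real mat" where
  "gram bs = mat (length bs) (length bs) (\<lambda>(i, j). inner (bs ! i) (bs ! j))"

text \<open>The Gram matrices of two bases are related by a unimodular base change, so the choice of
  the basis is irrelevant.\<close>

definition lattice_det :: "'a::euclidean_space set \<Rightarrow> real" where
  "lattice_det L = Determinant.det (gram (SOME bs. lattice_basis L bs))"

definition has_gram_matrix :: "'a::euclidean_space set \<Rightarrow> real mat \<Rightarrow> bool" where
  "has_gram_matrix L G \<longleftrightarrow> (\<exists>bs. lattice_basis L bs \<and> gram bs = G)"

definition has_minimum :: "'a::euclidean_space set \<Rightarrow> real \<Rightarrow> bool" where
  "has_minimum L m \<longleftrightarrow> (\<exists>v\<in>L - {0}. inner v v = m) \<and> (\<forall>v\<in>L - {0}. m \<le> inner v v)"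

definition unimodular :: "'a::euclidean_space set \<Rightarrow> bool" where
  "unimodular L \<longleftrightarrow> is_lattice L \<and> (\<forall>x\<in>L. \<forall>y\<in>L. inner x y \<in> \<int>) \<and> lattice_det L = 1"

definition even_part :: "'a::euclidean_space set \<Rightarrow> 'a set" where
  "even_part L = {v \<in> L. \<exists>k::int. inner v v = 2 * of_int k}"

definition even_unimodular :: "'a::euclidean_space set \<Rightarrow> bool" where
  "even_unimodular L \<longleftrightarrow> unimodular L \<and> even_part L = L"

definition lattice_isometric ::
    "'a::euclidean_space set \<Rightarrow> 'b::euclidean_space set \<Rightarrow> bool" where
  "lattice_isometric L M \<longleftrightarrow>
     (\<exists>f. bij_betw f L M \<and>
        (\<forall>x\<in>L. \<forall>y\<in>L. f (x + y) = f x + f y \<and> inner (f x) (f y) = inner x y))"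

definition saturated :: "'a::euclidean_space set \<Rightarrow> 'a set \<Rightarrow> bool" where
  "saturated K L \<longleftrightarrow> is_lattice K \<and> K \<subseteq> L \<and>
     (\<forall>v\<in>L. \<forall>m::int. m \<noteq> 0 \<longrightarrow> of_int m *\<^sub>R v \<in> K \<longrightarrow> v \<in> K)"

definition cross_section :: "nat \<Rightarrow> 'a::euclidean_space set \<Rightarrow> 'a set \<Rightarrow> bool" where
  "cross_section k L K \<longleftrightarrow>
     is_lattice K \<and> dim K = k \<and> (\<exists>U. subspace U \<and> dim U = k \<and> K = L \<inter> U)"

text \<open>For a cross-section \<open>K = L \<inter> U\<close> with \<open>dim K = dim U\<close> one has \<open>U = span K\<close>.\<close>

definition lattice_complement :: "'a::euclidean_space set \<Rightarrow> 'a set \<Rightarrow> 'a set" where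
  "lattice_complement L K = L \<inter> (span K)\<^sup>\<bottom>"

definition lattice_packing :: "'a::euclidean_space set \<Rightarrow> real \<Rightarrow> 'a set \<Rightarrow> bool" where
  "lattice_packing W r L \<longleftrightarrow> is_lattice L \<and> L \<subseteq> W \<and> dim L = dim W \<and>
     (\<forall>x\<in>L. \<forall>y\<in>L. x \<noteq> y \<longrightarrow> ball x r \<inter> ball y r \<inter> W = {})"

text \<open>Volume of one ball divided by the volume \<open>sqrt (lattice_det L)\<close> of a fundamental domain,
  both taken in the span of \<open>L\<close>.\<close>

definition packing_density :: "real \<Rightarrow> 'a::euclidean_space set \<Rightarrow> real" where
  "packing_density r L = unit_ball_vol (real (dim L)) * r ^ dim L / sqrt (lattice_det L)"

definition center_density :: "real \<Rightarrow> 'a::euclidean_space set \<Rightarrow> real" where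
  "center_density r L = packing_density r L / unit_ball_vol (real (dim L))"

definition is_bare_packing :: "nat \<Rightarrow> 'a::euclidean_space set \<Rightarrow> 'a set \<Rightarrow> bool" where
  "is_bare_packing n L K \<longleftrightarrow> dim (lattice_complement L K) = n \<and>
     lattice_packing ((span K)\<^sup>\<bottom>) (sqrt 6 / 2) (lattice_complement L K)"

definition bare_center_density :: "'a::euclidean_space set \<Rightarrow> 'a set \<Rightarrow> real" where
  "bare_center_density L K = center_density (sqrt 6 / 2) (lattice_complement L K)"

definition E8 :: "(real^8) set" where
  "E8 = {x. ((\<forall>i. x $ i \<in> \<int>) \<or> (\<forall>i. x $ i - 1/2 \<in> \<int>)) \<and> (\<exists>k::int. (\<Sum>i\<in>UNIV. x $ i) = 2 * of_int k)}"

definition sqrt3_E8 :: "(real^8) set" where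
  "sqrt3_E8 = (\<lambda>x. sqrt 3 *\<^sub>R x) ` E8"

definition K10_gram :: "real mat" where
  "K10_gram = mat_of_rows_list 10
    [[ 6,-3,-3,-3,-3,-3,-3, 3,-2, 1],
     [-3, 6, 3, 3, 3, 3, 3, 0, 1,-1],
     [-3, 3, 6, 0, 3, 0, 0,-3, 3, 1],
     [-3, 3, 0, 6, 3, 3, 3, 0,-1, 0],
     [-3, 3, 3, 3, 6, 3, 3,-3, 1,-1],
     [-3, 3, 0, 3, 3, 6, 3, 0, 0,-2],
     [-3, 3, 0, 3, 3, 3, 6, 0, 1,-2],
     [ 3, 0,-3, 0,-3, 0, 0, 6,-1, 1],
     [-2, 1, 3,-1, 1, 0, 1,-1, 6, 2],
     [ 1,-1, 1, 0,-1,-2,-2, 1, 2, 6]]"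

definition K9_gram :: "real mat" where
  "K9_gram = mat 9 9 (\<lambda>(i, j). K10_gram $$ (i, j))"

typedef three = "{0, 1, 2 :: nat}" by blast

lemma CARD_three: "CARD(three) = 3"
  by (simp add: type_definition.card[OF type_definition_three])

instance three :: prime_card
  by standard (simp add: CARD_three)

type_synonym F3 = "three mod_ring"

text \<open>A code is a subset of \<open>F3^48\<close>. Its coordinates are addressed as \<open>of_nat i\<close> with \<open>i < 48\<close>,
  \<open>of_nat :: nat \<Rightarrow> 48\<close> being injective on that range.

  In the Pless code row and column \<open>0\<close> of \<open>S\<close> stand for \<open>\<infinity>\<close>, and row and column \<open>k + 1\<close> for the
  element \<open>k\<close> of $\mathbb{F}_{23}$, so that differences of labels are differences of indices.\<close>

definition pless_S :: "nat \<Rightarrow> nat \<Rightarrow> int" where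
  "pless_S i j =
     (if i = 0 \<and> j = 0 then 0
      else if i = 0 then 1
      else if j = 0 then Legendre (-1) 23
      else Legendre (int j - int i) 23)"

definition pless_rows :: "(F3^48) set" where
  "pless_rows = {r. \<exists>i<24. \<forall>j<24.
      r $ of_nat j = (if j = i then 1 else 0) \<and> r $ of_nat (24 + j) = of_int (pless_S i j)}"

definition pless_code :: "(F3^48) set" where
  "pless_code = vec.span pless_rows"

text \<open>The quadratic residue code of length 47 is the cyclic code whose words, read as polynomials,
  vanish at \<open>\<alpha>^r\<close> for all nonzero squares \<open>r\<close> modulo 47, where \<open>\<alpha>\<close> is a primitive 47th root of
  unity. It is extended by an overall parity check at the last coordinate. Different choices of
  \<open>\<alpha>\<close> lead to at most two codes, which are equivalent.\<close>

definition extended_qr_code :: "F3 alg_closure \<Rightarrow> (F3^48) set" where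
  "extended_qr_code \<alpha> =
     {c. (\<forall>r\<in>{1..<47}. Legendre (int r) 47 = 1 \<longrightarrow>
            (\<Sum>i<47. to_ac (c $ of_nat i) * (\<alpha> ^ r) ^ i) = 0) \<and>
         (\<Sum>i<48. c $ of_nat i) = 0}"

definition is_extended_qr_code :: "(F3^48) set \<Rightarrow> bool" where
  "is_extended_qr_code C \<longleftrightarrow> (\<exists>\<alpha>. \<alpha> ^ 47 = 1 \<and> \<alpha> \<noteq> 1 \<and> C = extended_qr_code \<alpha>)"

definition code_lattice :: "(F3^48) set \<Rightarrow> (real^48) set" where
  "code_lattice C = {(\<chi> i. of_int (x $ i) / sqrt 3) | x :: int^48. (\<chi> i. of_int (x $ i)) \<in> C}"

definition extremal_neighbour :: "(F3^48) set \<Rightarrow> (real^48) set \<Rightarrow> bool" where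
  "extremal_neighbour C L \<longleftrightarrow>
     even_unimodular L \<and> even_part (code_lattice C) \<subseteq> L \<and> has_minimum L 6"

definition is_P48p :: "(real^48) set \<Rightarrow> bool" where
  "is_P48p L \<longleftrightarrow> extremal_neighbour pless_code L"

definition is_P48q :: "(real^48) set \<Rightarrow> bool" where
  "is_P48q L \<longleftrightarrow> (\<exists>C. is_extended_qr_code C \<and> extremal_neighbour C L)"

text \<open>The tuple \<open>(a, b, c, d)\<close> is the matrix with rows \<open>(a, b)\<close> and \<open>(c, d)\<close> over the integers
  modulo \<open>p\<close>.\<close>

definition SL2 :: "int \<Rightarrow> (int \<times> int \<times> int \<times> int) monoid" where
  "SL2 p = \<lparr>
     carrier = {(a, b, c, d). {a, b, c, d} \<subseteq> {0..<p} \<and> (a * d - b * c) mod p = 1},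
     mult = (\<lambda>(a, b, c, d) (a', b', c', d').
       ((a * a' + b * c') mod p, (a * b' + b * d') mod p,
        (c * a' + d * c') mod p, (c * b' + d * d') mod p)),
     one = (1, 0, 0, 1)\<rparr>"

text \<open>The central product $\mathrm{SL}_2(13)\,\mathsf{Y}\,\mathrm{SL}_2(5)$: the central elements
  $-1$ of the two factors are identified.\<close>

definition SL2_13_Y_SL2_5 :: "((int \<times> int \<times> int \<times> int) \<times> (int \<times> int \<times> int \<times> int)) set monoid" where
  "SL2_13_Y_SL2_5 =
     (SL2 13 \<times>\<times> SL2 5) Mod {((1, 0, 0, 1), (1, 0, 0, 1)), ((12, 0, 0, 12), (4, 0, 0, 4))}"

definition lattice_aut :: "'a::euclidean_space set \<Rightarrow> ('a \<Rightarrow> 'a) monoid" where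
  "lattice_aut L = \<lparr>carrier = {f. orthogonal_transformation f \<and> f ` L = L}, mult = (\<circ>), one = id\<rparr>"

definition has_P48n_aut_group :: "(real^48) set \<Rightarrow> bool" where
  "has_P48n_aut_group L \<longleftrightarrow>
     (\<exists>N. N \<lhd> lattice_aut L \<and>
        (lattice_aut L)\<lparr>carrier := N\<rparr> \<cong> SL2_13_Y_SL2_5 \<and>
        lattice_aut L Mod N \<cong> integer_mod_group 2 \<times>\<times> integer_mod_group 2)"

text \<open>Coordinates for $P_{48n}$. An element of order 65 in
  $\mathrm{SL}_2(13)\,\mathsf{Y}\,\mathrm{SL}_2(5)$ acts on the lattice with all primitive 65th
  roots of unity as eigenvalues, which makes $P_{48n}$ an ideal lattice over
  $\mathbb{Z}[\zeta_{65}]$; by Nebe (On automorphisms of extremal even unimodular lattices) it is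
  the only extremal lattice of rank 48 that is an ideal lattice over a cyclotomic field. The ideal
  is principal, so there is a basis $v, \zeta v, \dots, \zeta^{47} v$ with $v$ a minimal vector,
  and \<open>P48n_trace ! d\<close> is the inner product of $\zeta^i v$ and $\zeta^{i+d} v$. It only depends on
  \<open>d\<close> modulo 65 and up to sign.\<close>

definition P48n_trace :: "real list" where
  "P48n_trace =
     [6, -1, -2, -1, 1, 1, 0, 0, -1, 1, -1, 1, 0, -1, 0, 0, 1, -1, 0, 0, -1, 0, 1, 1, -1, 0,
      -2, 1, 2, 0, -2, 0, 1]"

definition P48n_gram :: "real mat" where
  "P48n_gram = mat 48 48 (\<lambda>(i, j).
     let d = (if i \<le> j then j - i else i - j) in P48n_trace ! (if d \<le> 32 then d else 65 - d))"

definition is_P48n :: "(real^48) set \<Rightarrow> bool" where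
  "is_P48n L \<longleftrightarrow> even_unimodular L \<and> has_minimum L 6 \<and> has_P48n_aut_group L \<and>
     has_gram_matrix L P48n_gram"

end

theory Submission
  imports Defs
begin

text \<open>
  In the dual of \<open>K\<^sub>8\<close>, every vector is congruent modulo \<open>K\<^sub>8\<close> to one of squared norm at most \<open>8/3\<close>: this is
  the statement that \<open>E\<^sub>8\<close> has covering radius 1, together with the evenness of its norms. Since
  \<open>\<Lambda>\<close> is integral, a vector of \<open>\<Lambda>\<close> outside \<open>K\<^sub>8\<close> can be translated by \<open>K\<^sub>8\<close> such that its component along
  \<open>K\<^sub>8\<close> has squared norm at most \<open>8/3\<close>. As its norm is at least 6, its component orthogonal to \<open>K\<^sub>8\<close>
  has squared norm at least \<open>10/3\<close>, which gives the first bound. For the next two bounds the component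
  orthogonal to \<open>K\<^sub>8\<close> is further reduced modulo the projection of \<open>K\<^sub>9\<close>, which has covering radius squared
  \<open>(10/3)/4 = 5/6\<close>, or of \<open>K\<^sub>1\<^sub>0\<close>, which is a hexagonal lattice of minimum \<open>10/3\<close> by its determinant and has
  covering radius squared \<open>10/9\<close>. The same bounds show that sublattices with the given Gram matrices
  are saturated, so that for the second part it suffices to exhibit vectors with Gram
  matrix \<open>K10_gram\<close> in each of the three lattices. The complement of a section of a unimodular lattice has
  the same determinant as the section.
\<close>

section \<open>Bases and integral spans\<close>

text \<open>The scale explains the constants. The Gram matrix of K8 is 3 times a unimodular one, so
  the dual of K8 is K8 divided by 3, and reducing a dual vector modulo K8 amounts to reducing a
  vector of E8 modulo 3 E8. Covering radius 1 gives norm at most 9 there; evenness improves this to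
  8, and scaling back multiplies by 3/9. Without evenness the projected minimum would be 3 in place
  of 10/3, and the bound would stay below the determinant that is attained. Bases are lists, since
  appending a vector multiplies the Gram determinant by its squared distance from the span; the
  bounds for sections are obtained one vector at a time. The code lattices bring an obstacle: the
  even neighbour is given by its properties, and the root of unity behind the quadratic residue code
  is arbitrary. Vectors must be placed in every lattice with these properties; the minimum 6 decides
  between two glue classes, and Frobenius conjugation with a reversal of coordinates covers all
  roots.\<close>

definition rcomb :: "(nat \<Rightarrow> real) \<Rightarrow> 'a::euclidean_space list \<Rightarrow> 'a" where
  "rcomb c bs = (\<Sum>i<length bs. c i *\<^sub>R bs ! i)"

definition indep_list :: "'a::euclidean_space list \<Rightarrow> bool" where
  "indep_list bs \<longleftrightarrow> distinct bs \<and> independent (set bs)"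

lemma lattice_basis_alt: "lattice_basis L bs \<longleftrightarrow> indep_list bs \<and> L = int_span bs"
  by (auto simp: lattice_basis_def indep_list_def)

lemma mem_int_span: "x \<in> int_span bs \<longleftrightarrow> (\<exists>c::nat \<Rightarrow> int. x = rcomb (\<lambda>i. of_int (c i)) bs)"
  by (auto simp: int_span_def rcomb_def)

lemma rcomb_cong: "(\<And>i. i < length bs \<Longrightarrow> c i = d i) \<Longrightarrow> rcomb c bs = rcomb d bs"
  by (simp add: rcomb_def)

lemma rcomb_Nil [simp]: "rcomb c [] = 0"
  by (simp add: rcomb_def)

lemma rcomb_snoc: "rcomb c (bs @ [v]) = rcomb c bs + c (length bs) *\<^sub>R v"
  by (simp add: rcomb_def nth_append)

lemma rcomb_append:
  "rcomb c (as @ bs) = rcomb c as + rcomb (\<lambda>i. c (length as + i)) bs"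
proof (induction bs rule: rev_induct)
  case (snoc v bs)
  then show ?case
    by (simp only: append_assoc[symmetric] rcomb_snoc) (simp add: add.assoc)
qed simp

lemma rcomb_single [simp]: "rcomb c [v] = c 0 *\<^sub>R v"
  by (simp add: rcomb_def)

lemma rcomb_add: "rcomb c bs + rcomb d bs = rcomb (\<lambda>i. c i + d i) bs"
  by (simp add: rcomb_def scaleR_add_left sum.distrib)

lemma rcomb_diff: "rcomb c bs - rcomb d bs = rcomb (\<lambda>i. c i - d i) bs"
  by (simp add: rcomb_def scaleR_diff_left sum_subtractf)

lemma rcomb_scale: "r *\<^sub>R rcomb c bs = rcomb (\<lambda>i. r * c i) bs"
  by (simp add: rcomb_def scaleR_sum_right)

lemma inner_rcomb: "inner (rcomb c bs) x = (\<Sum>i<length bs. c i * inner (bs ! i) x)"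
  by (simp add: rcomb_def inner_sum_left)

lemma inner_rcomb_rcomb:
  "inner (rcomb c bs) (rcomb d bs') =
    (\<Sum>i<length bs. \<Sum>j<length bs'. c i * d j * inner (bs ! i) (bs' ! j))"
  unfolding rcomb_def inner_sum_left inner_sum_right by (subst sum.swap) (simp add: mult_ac)

lemma int_span_scale: "x \<in> int_span bs \<Longrightarrow> of_int m *\<^sub>R x \<in> int_span bs"
  by (auto simp: mem_int_span rcomb_scale simp flip: of_int_mult)

lemma int_span_add: "x \<in> int_span bs \<Longrightarrow> y \<in> int_span bs \<Longrightarrow> x + y \<in> int_span bs"
  by (auto simp: mem_int_span rcomb_add simp flip: of_int_add)

lemma int_span_diff: "x \<in> int_span bs \<Longrightarrow> y \<in> int_span bs \<Longrightarrow> x - y \<in> int_span bs"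
  by (auto simp: mem_int_span rcomb_diff simp flip: of_int_diff)

lemma int_span_0: "0 \<in> int_span bs"
  unfolding mem_int_span by (intro exI[of _ "\<lambda>_. 0"]) (simp add: rcomb_def)

lemma int_span_nth: "i < length bs \<Longrightarrow> bs ! i \<in> int_span bs"
  unfolding mem_int_span
  by (intro exI[of _ "\<lambda>j. if j = i then 1 else 0"])
    (simp add: rcomb_def if_distrib[of of_int] if_distrib[of "\<lambda>x. x *\<^sub>R _"] sum.delta cong: if_cong)

lemma int_span_sum: "(\<And>i. i \<in> A \<Longrightarrow> f i \<in> int_span bs) \<Longrightarrow> sum f A \<in> int_span bs"
  by (induction A rule: infinite_finite_induct) (auto intro: int_span_0 int_span_add)

lemma int_span_append:
  "x \<in> int_span (as @ bs) \<longleftrightarrow> (\<exists>y\<in>int_span as. \<exists>z\<in>int_span bs. x = y + z)"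
proof
  assume "\<exists>y\<in>int_span as. \<exists>z\<in>int_span bs. x = y + z"
  then obtain c d :: "nat \<Rightarrow> int" where x: "x = rcomb (\<lambda>i. of_int (c i)) as + rcomb (\<lambda>i. of_int (d i)) bs"
    by (auto simp: mem_int_span)
  have "x = rcomb (\<lambda>i. of_int (if i < length as then c i else d (i - length as))) (as @ bs)"
    unfolding x rcomb_append by (intro arg_cong2[of _ _ _ _ "(+)"] rcomb_cong) auto
  then show "x \<in> int_span (as @ bs)"
    unfolding mem_int_span by (rule exI[where x = "\<lambda>i. if i < length as then c i else d (i - length as)"])
next
  assume "x \<in> int_span (as @ bs)"
  then obtain c :: "nat \<Rightarrow> int" where "x = rcomb (\<lambda>i. of_int (c i)) (as @ bs)"
    by (auto simp: mem_int_span)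
  then have "x = rcomb (\<lambda>i. of_int (c i)) as + rcomb (\<lambda>i. of_int (c (length as + i))) bs"
    by (simp add: rcomb_append)
  moreover have "rcomb (\<lambda>i. of_int (c i)) as \<in> int_span as"
    "rcomb (\<lambda>i. of_int (c (length as + i))) bs \<in> int_span bs"
    unfolding mem_int_span by (rule exI, rule refl)+
  ultimately show "\<exists>y\<in>int_span as. \<exists>z\<in>int_span bs. x = y + z" by blast
qed

lemma int_span_single: "x \<in> int_span [v] \<longleftrightarrow> (\<exists>m::int. x = of_int m *\<^sub>R v)"
  by (auto simp: mem_int_span)

lemma int_span_snoc: "x \<in> int_span (bs @ [v]) \<longleftrightarrow> (\<exists>y\<in>int_span bs. \<exists>m::int. x = y + of_int m *\<^sub>R v)"
proof -
  have "int_span [v] = range (\<lambda>m::int. of_int m *\<^sub>R v)"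
    unfolding set_eq_iff int_span_single by blast
  then show ?thesis by (simp add: int_span_append)
qed

lemma int_span_subset_span: "int_span bs \<subseteq> span (set bs)"
  by (auto simp: int_span_def intro!: span_sum span_scale intro: span_base)

lemma span_int_span: "span (int_span bs) = span (set bs)"
proof (rule antisym)
  show "span (int_span bs) \<subseteq> span (set bs)"
    using int_span_subset_span span_minimal subspace_span by blast
  have "set bs \<subseteq> int_span bs"
    by (metis in_set_conv_nth int_span_nth subsetI)
  then show "span (set bs) \<subseteq> span (int_span bs)"
    by (rule span_mono)
qed

lemma indep_list_sum:
  assumes "indep_list bs"
  shows "(\<Sum>i<length bs. f (bs ! i)) = (\<Sum>b\<in>set bs. f b)"
  using assms sum.reindex_bij_betw[OF bij_betw_nth[of bs "{..<length bs}" "set bs"], of f]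
  by (auto simp: indep_list_def)

lemma mem_span_rcomb:
  assumes "indep_list bs" "x \<in> span (set bs)"
  shows "\<exists>c. x = rcomb c bs"
proof -
  obtain u where u: "x = (\<Sum>b\<in>set bs. u b *\<^sub>R b)"
    using assms(2) by (auto simp: span_finite)
  have "x = rcomb (\<lambda>i. u (bs ! i)) bs"
    unfolding u rcomb_def using indep_list_sum[OF assms(1), of "\<lambda>b. u b *\<^sub>R b"] by simp
  then show ?thesis by blast
qed

lemma rcomb_eq_0:
  assumes "indep_list bs" "rcomb c bs = 0" "i < length bs"
  shows "c i = 0"
proof -
  \<comment> \<open>Independence of a set attaches coefficients to vectors, not to positions; as the
    entries are distinct, the position of a vector is unique and the coefficients can be moved
    over.\<close>
  define u where "u b = c (THE i. i < length bs \<and> bs ! i = b)" for b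
  have u: "u (bs ! i) = c i" if "i < length bs" for i
  proof -
    have "(THE j. j < length bs \<and> bs ! j = bs ! i) = i"
      using that assms(1) by (intro the_equality) (auto simp: indep_list_def nth_eq_iff_index_eq)
    then show ?thesis by (simp add: u_def)
  qed
  have "(\<Sum>b\<in>set bs. u b *\<^sub>R b) = rcomb c bs"
    unfolding rcomb_def using indep_list_sum[OF assms(1), of "\<lambda>b. u b *\<^sub>R b"] by (simp add: u)
  with assms(2) have "(\<Sum>b\<in>set bs. u b *\<^sub>R b) = 0" by simp
  then have "u (bs ! i) = 0"
    using assms(1,3) independentD[of "set bs" "set bs" u "bs ! i"] by (simp add: indep_list_def)
  with u assms(3) show ?thesis by simp
qed

lemma rcomb_inj:
  assumes "indep_list bs" "rcomb c bs = rcomb d bs" "i < length bs"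
  shows "c i = d i"
proof -
  have "rcomb (\<lambda>i. c i - d i) bs = 0"
    unfolding rcomb_diff[symmetric] assms(2) by simp
  from rcomb_eq_0[OF assms(1) this assms(3)] show ?thesis by simp
qed

lemma dim_indep_list: "indep_list bs \<Longrightarrow> dim (set bs) = length bs"
  by (simp add: indep_list_def dim_eq_card_independent distinct_card)

lemma dim_int_span: "indep_list bs \<Longrightarrow> dim (int_span bs) = length bs"
  by (metis dim_indep_list dim_span span_int_span)

lemma indep_list_snoc:
  "indep_list (bs @ [v]) \<longleftrightarrow> indep_list bs \<and> v \<notin> span (set bs)"
  using span_base[of v "set bs"] independent_insert[of v "set bs"]
  by (cases "v \<in> set bs") (auto simp: indep_list_def)

lemma inner_span_0:
  assumes "\<And>i. i < length bs \<Longrightarrow> inner x (bs ! i) = 0" "y \<in> span (set bs)"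
  shows "inner x y = 0"
  using assms(2)
proof (induction rule: span_induct_alt)
  case (step c b y)
  then obtain i where "i < length bs" "b = bs ! i"
    by (auto simp: in_set_conv_nth)
  with step assms(1) show ?case by (simp add: inner_add_right)
qed simp

section \<open>Orthogonal projections and Gram determinants\<close>

text \<open>The component of \<open>x\<close> orthogonal to \<open>span S\<close>. This residual,
  rather than the projection onto the span, is the basic operation because its squared norm is the
  factor by which a Gram determinant grows when \<open>x\<close> is appended.\<close>

definition perp :: "'a::euclidean_space set \<Rightarrow> 'a \<Rightarrow> 'a" where
  "perp S x = (THE z. x - z \<in> span S \<and> (\<forall>w\<in>span S. inner z w = 0))"

lemma perp_eqI:
  assumes "x - z \<in> span S" "\<And>w. w \<in> span S \<Longrightarrow> inner z w = 0"
  shows "perp S x = z"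
  unfolding perp_def
proof (rule the_equality)
  fix z' assume z': "x - z' \<in> span S \<and> (\<forall>w\<in>span S. inner z' w = 0)"
  have "z - z' \<in> span S"
    using span_diff[of "x - z'" S "x - z"] z' assms(1) by simp
  then have "inner (z - z') (z - z') = 0"
    using z' assms(2) by (simp add: inner_diff_left)
  then show "z' = z" by simp
qed (use assms in blast)

lemma
  shows diff_perp_in_span: "x - perp S x \<in> span S"
    and inner_perp: "w \<in> span S \<Longrightarrow> inner (perp S x) w = 0"
proof -
  obtain y z where "y \<in> span S" "\<And>w. w \<in> span S \<Longrightarrow> real_inner_class.orthogonal z w" "x = y + z"
    using orthogonal_subspace_decomp_exists by blast
  then have "x - z \<in> span S" "\<And>w. w \<in> span S \<Longrightarrow> inner z w = 0"
    by (auto simp: real_inner_class.orthogonal_def)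
  moreover from perp_eqI[OF this] have "perp S x = z" by simp
  ultimately show "x - perp S x \<in> span S" "w \<in> span S \<Longrightarrow> inner (perp S x) w = 0"
    by auto
qed

lemma perp_add: "perp S (x + y) = perp S x + perp S y"
  using span_add[OF diff_perp_in_span[of x S] diff_perp_in_span[of y S]]
  by (intro perp_eqI) (auto simp: inner_add_left inner_perp algebra_simps)

lemma perp_scale: "perp S (c *\<^sub>R x) = c *\<^sub>R perp S x"
  using span_scale[OF diff_perp_in_span[of x S], of c]
  by (intro perp_eqI) (auto simp: inner_perp scaleR_diff_right)

lemma perp_span: "x \<in> span S \<Longrightarrow> perp S x = 0"
  by (intro perp_eqI) auto

lemma perp_eq_0_iff: "perp S x = 0 \<longleftrightarrow> x \<in> span S"
  using diff_perp_in_span[of x S] perp_span[of x S] by auto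

lemma perp_diff: "perp S (x - y) = perp S x - perp S y"
  using perp_add[of S x "- 1 *\<^sub>R y"] perp_scale[of S "-1" y] by simp

lemma norm_decomp: "inner x x = inner (x - perp S x) (x - perp S x) + inner (perp S x) (perp S x)"
proof -
  have "inner (perp S x) (x - perp S x) = 0"
    by (intro inner_perp diff_perp_in_span)
  then show ?thesis by (simp add: inner_diff_left inner_diff_right inner_commute)
qed

lemma gram_carrier [simp]: "gram bs \<in> carrier_mat (length bs) (length bs)"
  by (simp add: gram_def)

lemma gram_transform:
  assumes "length ws = length bs"
    and "\<And>i. i < length bs \<Longrightarrow> ws ! i = rcomb (p i) bs"
  defines "P \<equiv> Matrix.mat (length bs) (length bs) (\<lambda>(i, j). p i j)"
  shows "gram ws = P * gram bs * P\<^sup>T"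
proof (rule eq_matI)
  fix i j assume "i < dim_row (P * gram bs * P\<^sup>T)" "j < dim_col (P * gram bs * P\<^sup>T)"
  then have ij: "i < length bs" "j < length bs" by (auto simp: P_def)
  have "(P * gram bs * P\<^sup>T) $$ (i, j) = (\<Sum>k<length bs. (\<Sum>l<length bs. p i l * inner (bs ! l) (bs ! k)) * p j k)"
    using ij by (simp add: P_def gram_def scalar_prod_def lessThan_atLeast0 mult.commute)
  also have "\<dots> = inner (rcomb (p i) bs) (rcomb (p j) bs)"
    unfolding inner_rcomb_rcomb by (subst sum.swap) (simp add: sum_distrib_left sum_distrib_right mult_ac)
  also have "\<dots> = gram ws $$ (i, j)"
    using ij assms(1,2) by (simp add: gram_def)
  finally show "gram ws $$ (i, j) = (P * gram bs * P\<^sup>T) $$ (i, j)" by simp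
qed (use assms(1) in \<open>auto simp: P_def gram_def\<close>)

lemma det_gram_transform:
  assumes "length ws = length bs"
    and "\<And>i. i < length bs \<Longrightarrow> ws ! i = rcomb (p i) bs"
  shows "Determinant.det (gram ws) =
    (Determinant.det (Matrix.mat (length bs) (length bs) (\<lambda>(i, j). p i j)))\<^sup>2 * Determinant.det (gram bs)"
proof -
  let ?P = "Matrix.mat (length bs) (length bs) (\<lambda>(i, j). p i j)"
  have P: "?P \<in> carrier_mat (length bs) (length bs)" by simp
  have "gram ws = ?P * gram bs * ?P\<^sup>T"
    by (rule gram_transform[OF assms])
  moreover have "Determinant.det (P * G * P\<^sup>T) = (Determinant.det P)\<^sup>2 * Determinant.det G"
    if "P \<in> carrier_mat n n" "G \<in> carrier_mat n n" for P G :: "real mat" and n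
    using that Determinant.det_mult[of "P * G" n "P\<^sup>T"] Determinant.det_mult[of P n G]
    by (simp add: Determinant.det_transpose power2_eq_square)
  ultimately show ?thesis
    using P gram_carrier by metis
qed

lemma det_gram_append_orthogonal:
  assumes "\<And>a b. a \<in> set as \<Longrightarrow> b \<in> set bs \<Longrightarrow> inner a b = 0"
  shows "Determinant.det (gram (as @ bs)) = Determinant.det (gram as) * Determinant.det (gram bs)"
proof -
  have "gram (as @ bs) = four_block_mat (gram as) (0\<^sub>m (length as) (length bs)) (0\<^sub>m (length bs) (length as)) (gram bs)"
    by (rule eq_matI) (auto simp: gram_def nth_append assms inner_commute[of "bs ! _" "as ! _"])
  then show ?thesis
    by (simp add: Determinant.det_four_block_mat_lower_left_zero[where n = "length as" and m = "length bs"])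
qed

lemma det_gram_single: "Determinant.det (gram [v]) = inner v v"
  by (simp add: gram_def Determinant.det_single)

text \<open>Volume is base times height: exchanging the last vector for its component orthogonal to
  the others is a base change by a lower unitriangular matrix, after which the Gram matrix is block
  diagonal.\<close>

lemma det_gram_snoc:
  assumes "indep_list bs"
  shows "Determinant.det (gram (bs @ [v])) =
    Determinant.det (gram bs) * inner (perp (set bs) v) (perp (set bs) v)"
proof -
  let ?o = "perp (set bs) v" and ?n = "length bs"
  obtain c where c: "v - ?o = rcomb c bs"
    using mem_span_rcomb[OF assms diff_perp_in_span] by blast
  \<comment> \<open>Unit rows for \<open>bs\<close>; the last row holds the coefficients of
    \<open>v - ?o\<close>, followed by a 1 for \<open>?o\<close>.\<close>
  define p where "p i j = (if i < ?n then (if j = i then 1 else 0) else if j = ?n then 1 else c j)" for i j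
  let ?P = "Matrix.mat (length (bs @ [?o])) (length (bs @ [?o])) (\<lambda>(i, j). p i j)"
  have "(bs @ [v]) ! i = rcomb (p i) (bs @ [?o])" if "i < length (bs @ [?o])" for i
  proof (cases "i < ?n")
    case True
    then show ?thesis
      by (auto simp: rcomb_snoc p_def rcomb_def nth_append if_distrib[of "\<lambda>x. x *\<^sub>R _"] cong: if_cong)
  next
    case False
    then have "i = ?n" using that by simp
    moreover have "rcomb (p ?n) bs = rcomb c bs" by (rule rcomb_cong) (simp add: p_def)
    ultimately show ?thesis
      using c by (simp add: rcomb_snoc p_def nth_append algebra_simps)
  qed
  then have "Determinant.det (gram (bs @ [v])) = (Determinant.det ?P)\<^sup>2 * Determinant.det (gram (bs @ [?o]))"
    by (intro det_gram_transform) auto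
  moreover have "Determinant.det ?P = prod_list (diag_mat ?P)"
    by (rule Determinant.det_lower_triangular[where n = "Suc ?n"]) (auto simp: p_def)
  moreover have "diag_mat ?P = map (\<lambda>_. 1) [0..<Suc ?n]"
    unfolding diag_mat_def by (auto simp: p_def)
  moreover have "prod_list (map (\<lambda>_. 1 :: real) xs) = 1" for xs :: "nat list"
    by (induction xs) auto
  moreover have "Determinant.det (gram (bs @ [?o])) = Determinant.det (gram bs) * inner ?o ?o"
    unfolding det_gram_single[symmetric]
    by (intro det_gram_append_orthogonal) (auto simp: inner_commute[of _ ?o] intro!: inner_perp span_base)
  ultimately show ?thesis by simp
qed

lemma det_gram_pos: "indep_list bs \<Longrightarrow> 0 < Determinant.det (gram bs)"
proof (induction bs rule: rev_induct)
  case Nil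
  then show ?case by (simp add: gram_def)
next
  case (snoc v bs)
  then show ?case
    by (simp add: det_gram_snoc indep_list_snoc perp_eq_0_iff)
qed

lemma gram_of_int:
  assumes "\<And>i j. i < length bs \<Longrightarrow> j < length bs \<Longrightarrow> inner (bs ! i) (bs ! j) \<in> \<int>"
  obtains G :: "int mat" where "G \<in> carrier_mat (length bs) (length bs)" "gram bs = map_mat of_int G"
proof
  let ?G = "Matrix.mat (length bs) (length bs) (\<lambda>(i, j). \<lfloor>inner (bs ! i) (bs ! j)\<rfloor>)"
  show "?G \<in> carrier_mat (length bs) (length bs)" by simp
  show "gram bs = map_mat of_int ?G"
    using assms by (intro eq_matI) (auto simp: gram_def of_int_floor_cancel)
qed

lemma det_gram_Ints:
  assumes "\<And>i j. i < length bs \<Longrightarrow> j < length bs \<Longrightarrow> inner (bs ! i) (bs ! j) \<in> \<int>"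
  shows "Determinant.det (gram bs) \<in> \<int>"
proof -
  obtain G :: "int mat" where "gram bs = map_mat of_int G"
    using gram_of_int[OF assms] by metis
  then have "Determinant.det (gram bs) = of_int (Determinant.det G)"
    by (simp add: of_int_hom.hom_det)
  then show ?thesis by simp
qed

section \<open>Primitive sublattices of integral lattices\<close>

text \<open>Base changes in both directions have integer matrices, so the determinants differ by
  factors r^2 and s^2 with integers r and s; positivity of Gram determinants permits the
  cancellation to r^2 s^2 = 1.\<close>

lemma lattice_basis_det_eq:
  assumes "indep_list bs" "indep_list bs'" "int_span bs = int_span bs'"
  shows "length bs = length bs'" "Determinant.det (gram bs) = Determinant.det (gram bs')"
proof -
  show len: "length bs = length bs'"
    using dim_int_span[OF assms(1)] dim_int_span[OF assms(2)] assms(3) by simp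
  have *: "\<exists>r :: int. Determinant.det (gram ws) = (of_int r)\<^sup>2 * Determinant.det (gram us)"
    if "length ws = length us" "int_span ws \<subseteq> int_span us" for ws us :: "'a list"
  proof -
    have "\<exists>p :: nat \<Rightarrow> int. i < length us \<longrightarrow> ws ! i = rcomb (\<lambda>j. of_int (p j)) us" for i
    proof (cases "i < length us")
      case True
      then have "ws ! i \<in> int_span us"
        using int_span_nth[of i ws] that by auto
      then show ?thesis
        unfolding mem_int_span by (elim exE) (rule exI, rule impI)
    qed simp
    then have "\<exists>p :: nat \<Rightarrow> nat \<Rightarrow> int. \<forall>i. i < length us \<longrightarrow> ws ! i = rcomb (\<lambda>j. of_int (p i j)) us"
      by (intro choice) blast
    then obtain p :: "nat \<Rightarrow> nat \<Rightarrow> int" where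
      p: "\<And>i. i < length us \<Longrightarrow> ws ! i = rcomb (\<lambda>j. of_int (p i j)) us"
      by blast
    have "Matrix.mat (length us) (length us) (\<lambda>(i, j). of_int (p i j) :: real) =
        map_mat of_int (Matrix.mat (length us) (length us) (\<lambda>(i, j). p i j))"
      by (intro eq_matI) auto
    then have "Determinant.det (Matrix.mat (length us) (length us) (\<lambda>(i, j). of_int (p i j) :: real)) =
        of_int (Determinant.det (Matrix.mat (length us) (length us) (\<lambda>(i, j). p i j)))"
      by (simp only: of_int_hom.hom_det)
    moreover have "Determinant.det (gram ws) = (Determinant.det (Matrix.mat (length us) (length us)
        (\<lambda>(i, j). of_int (p i j) :: real)))\<^sup>2 * Determinant.det (gram us)"
      using p by (intro det_gram_transform that(1)) simp
    ultimately show ?thesis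
      by (intro exI[of _ "Determinant.det (Matrix.mat (length us) (length us) (\<lambda>(i, j). p i j))"]) (simp only:)
  qed
  obtain r :: int where r: "Determinant.det (gram bs) = (of_int r)\<^sup>2 * Determinant.det (gram bs')"
    using *[of bs bs'] len assms(3) by blast
  obtain s :: int where s: "Determinant.det (gram bs') = (of_int s)\<^sup>2 * Determinant.det (gram bs)"
    using *[of bs' bs] len assms(3) by (metis order_refl)
  have pos: "0 < Determinant.det (gram bs)" "0 < Determinant.det (gram bs')"
    using det_gram_pos assms by auto
  have "(of_int (r\<^sup>2 * s\<^sup>2) :: real) * Determinant.det (gram bs) = Determinant.det (gram bs)"
    by (subst (2) r, subst s) simp
  then have "(of_int (r\<^sup>2 * s\<^sup>2) :: real) = 1"
    using pos by simp
  then have "r\<^sup>2 * s\<^sup>2 = 1"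
    by linarith
  then have "r\<^sup>2 = 1"
    using zmult_eq_1_iff[of "r\<^sup>2" "s\<^sup>2"] zero_le_power2[of r] by linarith
  then have "(of_int r :: real)\<^sup>2 = 1"
    by (simp flip: of_int_power)
  then show "Determinant.det (gram bs) = Determinant.det (gram bs')"
    using r by simp
qed

lemma lattice_det_eq:
  assumes "lattice_basis L bs"
  shows "lattice_det L = Determinant.det (gram bs)"
proof -
  have "lattice_basis L (SOME bs. lattice_basis L bs)"
    using assms by (rule someI)
  then show ?thesis
    using assms lattice_basis_det_eq(2) unfolding lattice_det_def lattice_basis_alt by metis
qed

text \<open>A primitive list is a basis of a saturated sublattice.\<close>

definition primitive :: "'a::euclidean_space set \<Rightarrow> 'a list \<Rightarrow> bool" where
  "primitive L bs \<longleftrightarrow> indep_list bs \<and> int_span bs = L \<inter> span (set bs)"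

text \<open>Integrality makes an additive subgroup discrete, so bases can be built from these axioms
  alone; \<open>E8\<close> becomes an instance before any basis of it is known.\<close>

locale integral_group =
  fixes L :: "'a::euclidean_space set"
  assumes zero_mem: "0 \<in> L"
    and diff_mem: "x \<in> L \<Longrightarrow> y \<in> L \<Longrightarrow> x - y \<in> L"
    and integral: "x \<in> L \<Longrightarrow> y \<in> L \<Longrightarrow> inner x y \<in> \<int>"
begin

lemma minus_mem: "x \<in> L \<Longrightarrow> - x \<in> L"
  using diff_mem[OF zero_mem] by fastforce

lemma add_mem: "x \<in> L \<Longrightarrow> y \<in> L \<Longrightarrow> x + y \<in> L"
  using diff_mem[OF _ minus_mem, of x y] by simp

lemma scale_mem:
  assumes "x \<in> L"
  shows "of_int m *\<^sub>R x \<in> L"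
proof -
  have nat: "of_nat n *\<^sub>R x \<in> L" for n
    by (induction n) (simp_all add: zero_mem assms add_mem scaleR_add_left)
  show ?thesis
  proof (cases "m \<ge> 0")
    case True
    then show ?thesis using nat[of "nat m"] by simp
  next
    case False
    then show ?thesis using minus_mem[OF nat[of "nat (- m)"]] by simp
  qed
qed

lemma sum_mem: "(\<And>i. i \<in> A \<Longrightarrow> f i \<in> L) \<Longrightarrow> sum f A \<in> L"
  by (induction A rule: infinite_finite_induct) (auto intro: zero_mem add_mem)

lemma int_span_subset:
  assumes "set bs \<subseteq> L"
  shows "int_span bs \<subseteq> L"
proof
  fix x assume "x \<in> int_span bs"
  then obtain c :: "nat \<Rightarrow> int" where "x = (\<Sum>i<length bs. of_int (c i) *\<^sub>R bs ! i)"
    by (auto simp: int_span_def)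
  then show "x \<in> L"
    using assms by (auto intro!: sum_mem scale_mem)
qed

text \<open>Squared distances within \<open>L\<close> are integers, so distinct points are at
  distance at least 1, and a bounded uniformly discrete set is finite.\<close>

lemma finite_bounded: "finite {x \<in> L. norm x \<le> R}"
proof -
  have "uniform_discrete {x \<in> L. norm x \<le> R}"
    unfolding uniform_discrete_def
  proof (intro exI[of _ 1] conjI ballI impI)
    fix x y assume "x \<in> {x \<in> L. norm x \<le> R}" "y \<in> {x \<in> L. norm x \<le> R}" and d: "dist x y < 1"
    then have "x - y \<in> L" by (auto intro: diff_mem)
    then obtain k :: int where k: "inner (x - y) (x - y) = of_int k"
      using integral by (metis Ints_cases)
    have "inner (x - y) (x - y) < 1"
      using d by (simp add: dist_norm dot_square_norm power_less_one_iff)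
    with k have "k < 1" by simp
    moreover have "0 \<le> k" using k inner_ge_zero[of "x - y"] by simp
    ultimately have "k = 0" by simp
    with k show "x = y" by simp
  qed simp
  moreover have "bounded {x \<in> L. norm x \<le> R}"
    unfolding bounded_iff by blast
  ultimately show ?thesis
    using uniform_discrete_finite_iff by blast
qed

text \<open>Among the lattice vectors in the span of \<open>bs\<close> and \<open>v\<close>,
  \<open>w\<close> is one whose coefficient \<open>k\<close> of \<open>v\<close> modulo
  \<open>span (set bs)\<close> is the least positive one. Division with remainder by
  \<open>k\<close> shows that no lattice vector of this span is missed.\<close>

lemma primitive_extend:
  assumes "primitive L bs" "v \<in> L" "v \<notin> span (set bs)"
  obtains w where "w \<in> L" "primitive L (bs @ [w])" "span (insert w (set bs)) = span (insert v (set bs))"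
proof -
  have bs: "indep_list bs" "int_span bs = L \<inter> span (set bs)"
    using assms(1) by (auto simp: primitive_def)
  have bsL: "bs ! i \<in> L" if "i < length bs" for i
    using int_span_nth[OF that] bs(2) by blast
  define R where "R = norm v + (\<Sum>i<length bs. norm (bs ! i))"
  \<comment> \<open>The candidates for the least coefficient, cut off at 1, which \<open>v\<close>
    itself attains.\<close>
  define K where "K = {k. 0 < k \<and> k \<le> 1 \<and> (\<exists>x\<in>L. x - k *\<^sub>R v \<in> span (set bs))}"
  have unique: "k = l" if "x - k *\<^sub>R v \<in> span (set bs)" "x - l *\<^sub>R v \<in> span (set bs)" for x k l
  proof (rule ccontr)
    assume "k \<noteq> l"
    have "(x - l *\<^sub>R v) - (x - k *\<^sub>R v) = (k - l) *\<^sub>R v"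
      by (simp add: algebra_simps)
    then have "(k - l) *\<^sub>R v \<in> span (set bs)"
      using span_diff[OF that(2,1)] by simp
    then have "inverse (k - l) *\<^sub>R (k - l) *\<^sub>R v \<in> span (set bs)"
      by (rule span_scale)
    with \<open>k \<noteq> l\<close> assms(3) show False by simp
  qed
  \<comment> \<open>Removing the integral parts of the \<open>bs\<close>-coordinates leaves a
    representative of norm at most \<open>R\<close> with the same coefficient \<open>k\<close>, so
    finitely many vectors account for all of \<open>K\<close>.\<close>
  have reduce: "\<exists>x\<in>L. norm x \<le> R \<and> x - k *\<^sub>R v \<in> span (set bs)"
    if "0 < k" "k \<le> 1" "x \<in> L" and x: "x - k *\<^sub>R v \<in> span (set bs)" for k x
  proof -
    obtain c where c: "x - k *\<^sub>R v = rcomb c bs"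
      using mem_span_rcomb[OF bs(1) x] by blast
    define y where "y = rcomb (\<lambda>i. of_int \<lfloor>c i\<rfloor>) bs"
    have y: "y \<in> int_span bs" unfolding y_def mem_int_span by (rule exI, rule refl)
    have eq: "x - y = k *\<^sub>R v + rcomb (\<lambda>i. frac (c i)) bs"
      using c by (simp add: y_def frac_def rcomb_diff[symmetric] algebra_simps)
    have "norm (rcomb (\<lambda>i. frac (c i)) bs) \<le> (\<Sum>i<length bs. norm (frac (c i) *\<^sub>R bs ! i))"
      unfolding rcomb_def by (rule norm_sum)
    also have "\<dots> \<le> (\<Sum>i<length bs. norm (bs ! i))"
      by (intro sum_mono) (simp add: mult_left_le_one_le less_imp_le[OF frac_lt_1])
    finally have "norm (x - y) \<le> R"
      unfolding eq R_def
      using that(1,2) by (intro norm_triangle_mono) (auto simp: mult_left_le_one_le)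
    moreover have "x - y \<in> L" using y bs(2) that(3) diff_mem by blast
    moreover have "x - y - k *\<^sub>R v \<in> span (set bs)"
      using span_diff[OF x, of y] y bs(2) by (simp add: algebra_simps)
    ultimately show ?thesis by blast
  qed
  have "K \<subseteq> (\<lambda>x. THE k. x - k *\<^sub>R v \<in> span (set bs)) ` {x \<in> L. norm x \<le> R}"
  proof
    fix k assume "k \<in> K"
    then obtain x where x: "x \<in> L" "norm x \<le> R" "x - k *\<^sub>R v \<in> span (set bs)"
      using reduce by (auto simp: K_def)
    then have "(THE k. x - k *\<^sub>R v \<in> span (set bs)) = k"
      using unique by blast
    with x show "k \<in> (\<lambda>x. THE k. x - k *\<^sub>R v \<in> span (set bs)) ` {x \<in> L. norm x \<le> R}"
      by force
  qed
  then have fin: "finite K"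
    using finite_bounded finite_surj by blast
  have "1 \<in> K" using assms(2) by (auto simp: K_def span_zero intro!: bexI[of _ v])
  then have k0: "Min K \<in> K" using fin Min_in by blast
  define k where "k = Min K"
  obtain w where w: "0 < k" "k \<le> 1" "w \<in> L" "w - k *\<^sub>R v \<in> span (set bs)"
    using k0 by (auto simp: K_def k_def)
  have w_in: "w \<in> span (insert v (set bs))"
    using w(4) span_breakdown_eq by blast
  have v_eq: "v - inverse k *\<^sub>R w \<in> span (set bs)"
    using span_scale[OF w(4), of "- inverse k"] w(1) by (simp add: algebra_simps)
  then have v_in: "v \<in> span (insert w (set bs))"
    using span_breakdown_eq by blast
  have span_eq: "span (insert w (set bs)) = span (insert v (set bs))"
    using w_in v_in by (intro antisym span_minimal) (auto intro: span_base subspace_span)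
  have w_notin: "w \<notin> span (set bs)"
  proof
    assume "w \<in> span (set bs)"
    then have "w - 0 *\<^sub>R v \<in> span (set bs)" by simp
    from unique[OF this w(4)] w(1) show False by simp
  qed
  have "x \<in> int_span (bs @ [w])" if x: "x \<in> L" "x \<in> span (insert w (set bs))" for x
  proof -
    obtain t where t: "x - t *\<^sub>R v \<in> span (set bs)"
      using x(2) span_eq span_breakdown_eq by blast
    \<comment> \<open>The remainder \<open>t'\<close> of \<open>t\<close> on division by
      \<open>k\<close> would, if positive, be an element of \<open>K\<close> smaller than
      \<open>k\<close>.\<close>
    define m where "m = \<lfloor>t / k\<rfloor>"
    define t' where "t' = t - of_int m * k"
    have t': "0 \<le> t'" "t' < k"
      using w(1) floor_divide_lower[of k t] floor_divide_upper[of k t]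
      by (auto simp: t'_def m_def algebra_simps)
    have xm: "x - of_int m *\<^sub>R w \<in> L"
      using x(1) w(3) by (intro diff_mem scale_mem)
    have in_span: "(x - of_int m *\<^sub>R w) - t' *\<^sub>R v \<in> span (set bs)"
      using span_diff[OF t span_scale[OF w(4), of "of_int m"]] by (simp add: t'_def algebra_simps)
    have "t' \<notin> K \<or> k \<le> t'"
      using fin by (auto simp: k_def)
    with t' have "t' = 0"
      using xm in_span w(2) by (force simp: K_def)
    with in_span have "x - of_int m *\<^sub>R w \<in> int_span bs"
      using xm bs(2) by simp
    then show ?thesis
      unfolding int_span_snoc by (intro bexI[of _ "x - of_int m *\<^sub>R w"] exI[of _ m]) auto
  qed
  moreover have "int_span (bs @ [w]) \<subseteq> L \<inter> span (insert w (set bs))"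
  proof -
    have "set (bs @ [w]) \<subseteq> L"
      using bsL w(3) by (auto simp: in_set_conv_nth)
    then show ?thesis
      using int_span_subset int_span_subset_span[of "bs @ [w]"] by auto
  qed
  ultimately have "primitive L (bs @ [w])"
    using bs(1) w_notin by (auto simp: primitive_def indep_list_snoc)
  with w(3) span_eq that show ?thesis by blast
qed

text \<open>Each use of \<open>primitive_extend\<close> raises the rank, which the dimension of the
  space bounds. With \<open>U\<close> the whole space this completes a basis of a section to one of
  \<open>L\<close>; with \<open>U\<close> the span of a larger section it gives a basis of that
  section beginning with \<open>bs\<close>.\<close>

lemma primitive_complete:
  assumes "primitive L bs" "set bs \<subseteq> U" "subspace U"
  obtains cs where "primitive L (bs @ cs)" "int_span (bs @ cs) = L \<inter> U" "set cs \<subseteq> U"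
proof -
  have "\<exists>cs. primitive L (bs @ cs) \<and> int_span (bs @ cs) = L \<inter> U \<and> set cs \<subseteq> U"
    if "primitive L bs" "set bs \<subseteq> U" for bs
    using that
  proof (induction "DIM('a) - length bs" arbitrary: bs rule: less_induct)
    case less
    show ?case
    proof (cases "L \<inter> U \<subseteq> span (set bs)")
      case True
      have "span (set bs) \<subseteq> U" using less.prems assms(3) by (intro span_minimal)
      with True have "int_span bs = L \<inter> U"
        using less.prems by (auto simp: primitive_def)
      with less.prems show ?thesis by (intro exI[of _ "[]"]) auto
    next
      case False
      then obtain v where v: "v \<in> L" "v \<in> U" "v \<notin> span (set bs)" by blast
      obtain w where w: "w \<in> L" "primitive L (bs @ [w])"
        "span (insert w (set bs)) = span (insert v (set bs))"
        using primitive_extend[OF less.prems(1) v(1,3)] .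
      have "span (insert v (set bs)) \<subseteq> U"
        using less.prems v(2) assms(3) by (intro span_minimal) auto
      then have wU: "w \<in> U"
        using w(3) span_base[of w "insert w (set bs)"] by auto
      have "indep_list (bs @ [w])" using w(2) by (simp add: primitive_def)
      then have "length (bs @ [w]) \<le> DIM('a)"
        using dim_indep_list dim_subset_UNIV by metis
      then have "DIM('a) - length (bs @ [w]) < DIM('a) - length bs" by simp
      from less.hyps[OF this w(2)] wU less.prems(2) obtain cs where
        "primitive L ((bs @ [w]) @ cs)" "int_span ((bs @ [w]) @ cs) = L \<inter> U" "set cs \<subseteq> U"
        by auto
      then show ?thesis using wU by (intro exI[of _ "w # cs"]) auto
    qed
  qed
  with assms that show ?thesis by blast
qed

end

lemma is_lattice_closed:
  assumes "is_lattice L"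
  shows "0 \<in> L" "x \<in> L \<Longrightarrow> y \<in> L \<Longrightarrow> x - y \<in> L"
  using assms int_span_0 int_span_diff unfolding is_lattice_def lattice_basis_def by blast+

lemma unimodular_integral_group: "unimodular L \<Longrightarrow> integral_group L"
  using is_lattice_closed[of L] by unfold_locales (auto simp: unimodular_def)

lemma cross_section_basis:
  assumes "cross_section k L K"
  obtains bs where "primitive L bs" "K = int_span bs" "length bs = k" "span (set bs) = span K"
proof -
  obtain bs U where bs: "indep_list bs" "K = int_span bs" and dK: "dim K = k"
    and U: "subspace U" "dim U = k" "K = L \<inter> U"
    using assms by (auto simp: cross_section_def is_lattice_def lattice_basis_alt)
  have span: "span (set bs) = span K" using bs(2) span_int_span by metis
  \<comment> \<open>Equal dimensions force \<open>U\<close> to be the span of \<open>K\<close>, so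
    the section is cut out by its own span.\<close>
  have "span K = span U"
    using U dK by (intro dim_eq_span) auto
  then have "span K = U" using U(1) by (metis span_eq_iff)
  then have "primitive L bs" using bs U(3) span by (auto simp: primitive_def)
  moreover have "length bs = k" using bs dK dim_int_span by metis
  ultimately show ?thesis using that bs span by blast
qed

lemma primitive_cross_section:
  assumes "primitive L bs"
  shows "cross_section (length bs) L (int_span bs)"
  unfolding cross_section_def
proof (intro conjI exI)
  show "is_lattice (int_span bs)"
    using assms by (auto simp: is_lattice_def lattice_basis_alt primitive_def)
  show "dim (int_span bs) = length bs" "dim (span (set bs)) = length bs"
    using dim_int_span[of bs] dim_indep_list[of bs] conjunct1[OF assms[unfolded primitive_def]] by simp_all
  show "int_span bs = L \<inter> span (set bs)" using assms by (simp add: primitive_def)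
qed auto

lemma primitive_saturated:
  assumes "primitive L bs"
  shows "saturated (int_span bs) L"
  unfolding saturated_def
proof (intro conjI ballI allI impI)
  show "is_lattice (int_span bs)"
    using assms by (auto simp: is_lattice_def lattice_basis_alt primitive_def)
  show "int_span bs \<subseteq> L" using assms by (simp add: primitive_def)
  fix v and m :: int assume v: "v \<in> L" "m \<noteq> 0" "of_int m *\<^sub>R v \<in> int_span bs"
  then have "of_int m *\<^sub>R v \<in> span (set bs)" using int_span_subset_span by blast
  then have "inverse (of_int m) *\<^sub>R of_int m *\<^sub>R v \<in> span (set bs)" by (rule span_scale)
  with v show "v \<in> int_span bs" using assms by (simp add: primitive_def)
qed

section \<open>Complements in unimodular lattices\<close>

lemma indep_listI:
  assumes "\<And>c i. rcomb c bs = 0 \<Longrightarrow> i < length bs \<Longrightarrow> c i = 0"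
  shows "indep_list bs"
proof -
  have dist: "distinct bs"
    unfolding distinct_conv_nth
  proof (intro allI impI notI)
    fix i j assume ij: "i < length bs" "j < length bs" "i \<noteq> j" "bs ! i = bs ! j"
    let ?c = "\<lambda>l. (if l = i then 1 else 0) - (if l = j then 1 else 0) :: real"
    have "rcomb ?c bs = 0"
      unfolding rcomb_diff[symmetric] using ij
      by (simp add: rcomb_def if_distrib[of "\<lambda>x. x *\<^sub>R _"] cong: if_cong)
    from assms[OF this ij(1)] ij(3) show False by simp
  qed
  have "independent (set bs)"
    unfolding dependent_finite[OF finite_set]
  proof (intro notI, elim exE conjE bexE)
    fix u v assume uv: "v \<in> set bs" "u v \<noteq> 0" "(\<Sum>v\<in>set bs. u v *\<^sub>R v) = 0"
    have "rcomb (\<lambda>i. u (bs ! i)) bs = 0"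
      unfolding rcomb_def uv(3)[symmetric]
      using sum.reindex_bij_betw[OF bij_betw_nth[OF dist refl refl], of "\<lambda>b. u b *\<^sub>R b"] by simp
    then show False using assms uv(1,2) by (auto simp: in_set_conv_nth)
  qed
  with dist show ?thesis by (simp add: indep_list_def)
qed

text \<open>The Gram matrix is integral of determinant 1, so its inverse is its adjugate and the
  dual basis has integer coordinates. The expansion of an arbitrary \<open>x\<close> rests on the
  full rank of \<open>L\<close>.\<close>

lemma unimodular_dual_basis:
  fixes L :: "'a::euclidean_space set"
  assumes "unimodular L" "dim L = DIM('a)" "lattice_basis L as"
  obtains d :: "nat \<Rightarrow> 'a" and H :: "int mat" where
    "\<And>i. d i = rcomb (\<lambda>j. of_int (H $$ (i, j))) as"
    "\<And>i l. i < length as \<Longrightarrow> l < length as \<Longrightarrow> inner (d i) (as ! l) = (if i = l then 1 else 0)"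
    "\<And>x. x = (\<Sum>i<length as. inner x (as ! i) *\<^sub>R d i)"
proof -
  interpret integral_group L by (rule unimodular_integral_group[OF assms(1)])
  have as: "indep_list as" "int_span as = L"
    using assms(3) by (auto simp: lattice_basis_alt)
  have det_as: "Determinant.det (gram as) = 1"
    using lattice_det_eq[OF assms(3)] assms(1) by (simp add: unimodular_def)
  define n where "n = length as"
  have len: "n = DIM('a)" using dim_int_span[OF as(1)] as(2) assms(2) by (simp add: n_def)
  have span_as: "span (set as) = UNIV"
  proof -
    have "dim (set as) = DIM('a)" using dim_indep_list[OF as(1)] len n_def by simp
    then show ?thesis by (simp add: dim_eq_full)
  qed
  have as_L: "as ! i \<in> L" if "i < n" for i
    using int_span_nth[of i as] that as(2) n_def by simp
  obtain G :: "int mat" where G: "G \<in> carrier_mat n n" "gram as = map_mat of_int G"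
    using integral as_L by (rule_tac gram_of_int[of as]) (auto simp: n_def)
  have "of_int (Determinant.det G) = (1 :: real)"
    using det_as G(2) by (simp add: of_int_hom.hom_det)
  then have detG: "Determinant.det G = 1" by simp
  define H where "H = adj_mat G"
  have H: "H \<in> carrier_mat n n" "H * G = 1\<^sub>m n"
    using adj_mat[OF G(1)] detG G(1) by (auto simp: H_def)
  define d where "d i = rcomb (\<lambda>j. of_int (H $$ (i, j))) as" for i
  have dual: "inner (d i) (as ! l) = (if i = l then 1 else 0)" if "i < n" "l < n" for i l
  proof -
    have g: "inner (as ! j) (as ! l) = of_int (G $$ (j, l))" if "j < n" for j
    proof -
      have "gram as $$ (j, l) = of_int (G $$ (j, l))" using G that \<open>l < n\<close> by simp
      then show ?thesis using that \<open>l < n\<close> by (simp add: gram_def n_def)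
    qed
    have "inner (d i) (as ! l) = of_int (\<Sum>j<n. H $$ (i, j) * G $$ (j, l))"
      unfolding d_def inner_rcomb n_def[symmetric] using g by simp
    also have "(\<Sum>j<n. H $$ (i, j) * G $$ (j, l)) = (H * G) $$ (i, l)"
      using that G(1) H(1) by (simp add: scalar_prod_def lessThan_atLeast0)
    finally show ?thesis using that H(2) by simp
  qed
  have expand: "x = (\<Sum>i<n. inner x (as ! i) *\<^sub>R d i)" for x
  proof -
    define z where "z = x - (\<Sum>i<n. inner x (as ! i) *\<^sub>R d i)"
    have "inner z (as ! l) = 0" if "l < length as" for l
    proof -
      have "(\<Sum>i<n. inner x (as ! i) * inner (d i) (as ! l)) = (\<Sum>i<n. if i = l then inner x (as ! i) else 0)"
        using that by (intro sum.cong) (auto simp: dual n_def)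
      then show ?thesis
        using that by (simp add: z_def inner_diff_left inner_sum_left n_def)
    qed
    from inner_span_0[OF this, of z] have "inner z z = 0" using span_as by simp
    then show ?thesis by (simp add: z_def)
  qed
  show ?thesis
    by (rule that[of d H]) (use dual expand in \<open>simp_all only: d_def n_def\<close>)
qed

text \<open>The coefficients of \<open>x\<close> in the dual basis are its inner products with
  lattice vectors. Self-duality later forces a vector into \<open>L\<close> in the proof by
  contradiction of \<open>odd_coords_exist\<close>.\<close>

lemma unimodular_self_dual:
  fixes L :: "'a::euclidean_space set"
  assumes "unimodular L" "dim L = DIM('a)" "\<And>y. y \<in> L \<Longrightarrow> inner x y \<in> \<int>"
  shows "x \<in> L"
proof -
  interpret integral_group L by (rule unimodular_integral_group[OF assms(1)])
  obtain as where as: "lattice_basis L as" using assms(1) by (auto simp: unimodular_def is_lattice_def)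
  obtain d :: "nat \<Rightarrow> 'a" and H :: "int mat" where d:
    "\<And>i. d i = rcomb (\<lambda>j. of_int (H $$ (i, j))) as"
    "\<And>x. x = (\<Sum>i<length as. inner x (as ! i) *\<^sub>R d i)"
    using unimodular_dual_basis[OF assms(1,2) as] by metis
  have L: "L = int_span as" using as by (simp add: lattice_basis_alt)
  have "inner x (as ! i) *\<^sub>R d i \<in> L" if "i < length as" for i
  proof -
    have "inner x (as ! i) \<in> \<int>" using that int_span_nth L by (intro assms(3)) simp
    then obtain m where "inner x (as ! i) = of_int m" by (rule Ints_cases)
    moreover have "d i \<in> L" unfolding L mem_int_span d(1) by (rule exI, rule refl)
    ultimately show ?thesis using scale_mem by simp
  qed
  then have "(\<Sum>i<length as. inner x (as ! i) *\<^sub>R d i) \<in> L" by (intro sum_mem) simp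
  then show ?thesis using d(2)[of x] by simp
qed

text \<open>Extending a basis of \<open>K\<close> to one of \<open>L\<close>, the complement of \<open>K\<close> is spanned by the second part of
  the dual basis. The matrix expressing the first part of the basis and the second part of the dual
  basis in terms of the basis has determinant \<open>det (gram ds)\<close>, and their joint Gram matrix is block
  diagonal, so that \<open>det K * det K\<^sup>\<bottom> = (det K\<^sup>\<bottom>)\<^sup>2\<close>.\<close>

lemma unimodular_complement:
  fixes L :: "'a::euclidean_space set"
  assumes "unimodular L" "dim L = DIM('a)" "primitive L bs"
  obtains ds where "lattice_basis (lattice_complement L (int_span bs)) ds"
    "length ds = DIM('a) - length bs" "Determinant.det (gram ds) = Determinant.det (gram bs)"
proof -
  interpret integral_group L by (rule unimodular_integral_group[OF assms(1)])
  obtain cs where cs: "primitive L (bs @ cs)" "int_span (bs @ cs) = L \<inter> UNIV"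
    using primitive_complete[OF assms(3), of UNIV] by auto
  define as where "as = bs @ cs"
  have as: "lattice_basis L as"
    using cs by (auto simp: as_def primitive_def lattice_basis_alt)
  have as_span: "L = int_span as" using as by (simp add: lattice_basis_alt)
  have det_as: "Determinant.det (gram as) = 1"
    using lattice_det_eq[OF as] assms(1) by (simp add: unimodular_def)
  define n k where "n = length as" and "k = length bs"
  have len: "n = DIM('a)" using dim_int_span[of as] as assms(2) by (simp add: n_def lattice_basis_alt)
  have kn: "k \<le> n" "length cs = n - k" by (auto simp: n_def k_def as_def)
  have as_nth: "as ! i = bs ! i" if "i < k" for i
    using that by (simp add: as_def k_def nth_append)
  have as_L: "as ! i \<in> L" if "i < n" for i
    using int_span_nth[of i as] that as_span n_def by simp
  obtain d :: "nat \<Rightarrow> 'a" and H :: "int mat" where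
    d_def: "\<And>i. d i = rcomb (\<lambda>j. of_int (H $$ (i, j))) as" and
    dual: "\<And>i l. i < n \<Longrightarrow> l < n \<Longrightarrow> inner (d i) (as ! l) = (if i = l then 1 else 0)" and
    expand: "\<And>x. x = (\<Sum>i<n. inner x (as ! i) *\<^sub>R d i)"
    unfolding n_def using unimodular_dual_basis[OF assms(1,2) as] by blast
  have d_L: "d i \<in> L" for i
    unfolding as_span mem_int_span d_def by (rule exI, rule refl)
  have dd: "inner (d i) (d j) = of_int (H $$ (i, j))" if "i < n" "j < n" for i j
  proof -
    have "inner (d i) (d j) = (\<Sum>l<n. of_int (H $$ (i, l)) * inner (as ! l) (d j))"
      unfolding d_def[of i] inner_rcomb n_def ..
    also have "\<dots> = (\<Sum>l<n. if l = j then of_int (H $$ (i, l)) else 0)"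
      using that by (intro sum.cong) (auto simp: inner_commute[of _ "d j"] dual)
    finally show ?thesis using that by simp
  qed
  define ds where "ds = map (\<lambda>i. d (k + i)) [0..<n - k]"
  have len_ds: "length ds = n - k" and ds_nth: "\<And>i. i < n - k \<Longrightarrow> ds ! i = d (k + i)"
    by (auto simp: ds_def)
  have rcomb_ds: "rcomb c ds = (\<Sum>i<n - k. c i *\<^sub>R d (k + i))" for c
    by (simp add: rcomb_def len_ds ds_nth)
  have "indep_list ds"
  proof (rule indep_listI)
    fix c i assume c: "rcomb c ds = 0" and i: "i < length ds"
    have "inner (rcomb c ds) (as ! (k + i)) = (\<Sum>j<n - k. if j = i then c j else 0)"
      unfolding rcomb_ds inner_sum_left using i
      by (intro sum.cong) (auto simp: dual len_ds)
    then show "c i = 0" using c i by (simp add: len_ds)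
  qed
  moreover have "int_span ds = lattice_complement L (int_span bs)"
  proof (rule equalityI; rule subsetI)
    fix x assume "x \<in> int_span ds"
    then obtain c :: "nat \<Rightarrow> int" where x: "x = rcomb (\<lambda>i. of_int (c i)) ds"
      by (auto simp: mem_int_span)
    have "x \<in> L" unfolding x rcomb_ds by (intro sum_mem scale_mem d_L)
    moreover have "inner x (bs ! l) = 0" if "l < length bs" for l
    proof -
      have "inner (d (k + i)) (bs ! l) = 0" if "i < n - k" for i
        using dual[of "k + i" l] as_nth[of l] \<open>l < length bs\<close> that kn by (simp add: k_def)
      then show ?thesis by (simp add: x rcomb_ds inner_sum_left)
    qed
    then have "inner x y = 0" if "y \<in> span (set bs)" for y
      using inner_span_0 that by blast
    then have "x \<in> (span (set bs))\<^sup>\<bottom>"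
      by (auto simp: orthogonal_comp_def real_inner_class.orthogonal_def inner_commute)
    ultimately show "x \<in> lattice_complement L (int_span bs)"
      by (simp add: lattice_complement_def span_int_span)
  next
    fix x assume "x \<in> lattice_complement L (int_span bs)"
    then have x: "x \<in> L" "\<And>y. y \<in> span (set bs) \<Longrightarrow> inner x y = 0"
      by (auto simp: lattice_complement_def span_int_span orthogonal_comp_def
          real_inner_class.orthogonal_def inner_commute)
    define c where "c i = \<lfloor>inner x (as ! (k + i))\<rfloor>" for i
    have c: "of_int (c i) = inner x (as ! (k + i))" if "i < n - k" for i
      using integral[OF x(1) as_L[of "k + i"]] that by (simp add: c_def of_int_floor_cancel)
    have zero: "inner x (as ! i) = 0" if "i < k" for i
      using x(2)[of "bs ! i"] as_nth[OF that] that by (simp add: span_base k_def)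
    have split: "{..<n} = {..<k} \<union> (\<lambda>i. k + i) ` {..<n - k}"
    proof -
      have "(\<lambda>i. k + i) ` {..<n - k} = {k..<n}"
        using image_add_atLeastLessThan[of k 0 "n - k"] kn by (simp add: lessThan_atLeast0)
      then show ?thesis using kn by auto
    qed
    have "x = (\<Sum>i<n. inner x (as ! i) *\<^sub>R d i)" by (rule expand)
    also have "\<dots> = (\<Sum>i\<in>(\<lambda>i. k + i) ` {..<n - k}. inner x (as ! i) *\<^sub>R d i)"
      unfolding split by (rule sum.mono_neutral_right) (auto simp: zero)
    also have "\<dots> = (\<Sum>i<n - k. of_int (c i) *\<^sub>R d (k + i))"
      by (subst sum.reindex) (auto simp: c)
    finally have "x = rcomb (\<lambda>i. of_int (c i)) ds" unfolding rcomb_ds .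
    then show "x \<in> int_span ds" unfolding mem_int_span by (rule exI[where x = c])
  qed
  moreover have "Determinant.det (gram ds) = Determinant.det (gram bs)"
  proof -
    define p where "p i j = (if i < k then (if j = i then 1 else 0) else of_int (H $$ (i, j)) :: real)" for i j
    let ?P = "Matrix.mat (length as) (length as) (\<lambda>(i, j). p i j)"
    let ?C = "Matrix.mat (n - k) k (\<lambda>(i, j). of_int (H $$ (k + i, j))) :: real mat"
    have "(bs @ ds) ! i = rcomb (p i) as" if "i < length as" for i
    proof (cases "i < k")
      case True
      then show ?thesis
        using that as_nth[of i]
        by (simp add: p_def rcomb_def k_def nth_append if_distrib[of "\<lambda>x. x *\<^sub>R _"] cong: if_cong)
    next
      case False
      then have "(bs @ ds) ! i = d i"
        using that ds_nth[of "i - k"] by (auto simp: nth_append k_def n_def)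
      also have "\<dots> = rcomb (p i) as"
        unfolding d_def using False by (intro rcomb_cong) (simp add: p_def)
      finally show ?thesis .
    qed
    then have "Determinant.det (gram (bs @ ds)) = (Determinant.det ?P)\<^sup>2 * Determinant.det (gram as)"
      using kn len_ds by (intro det_gram_transform) (auto simp: k_def n_def)
    moreover have "?P = four_block_mat (1\<^sub>m k) (0\<^sub>m k (n - k)) ?C (gram ds)"
      using kn len_ds
      by (intro eq_matI) (auto simp: p_def gram_def ds_nth dd n_def)
    then have "Determinant.det ?P = Determinant.det (gram ds)"
      using gram_carrier[of ds] len_ds
      by (simp add: Determinant.det_four_block_mat_upper_right_zero[where n = k and m = "n - k"])
    moreover have "Determinant.det (gram (bs @ ds)) = Determinant.det (gram bs) * Determinant.det (gram ds)"
    proof (rule det_gram_append_orthogonal)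
      fix a b assume "a \<in> set bs" "b \<in> set ds"
      then obtain i j where "i < k" "a = as ! i" "j < n - k" "b = d (k + j)"
        by (auto simp: ds_def in_set_conv_nth k_def as_def nth_append)
      then show "inner a b = 0"
        using dual[of "k + j" i] kn by (simp add: inner_commute)
    qed
    ultimately show ?thesis
      using det_as det_gram_pos[OF \<open>indep_list ds\<close>] by (simp add: power2_eq_square)
  qed
  ultimately show ?thesis
    using that[of ds] len len_ds by (simp add: lattice_basis_alt k_def)
qed

lemma dim_orthogonal_comp:
  fixes S :: "'a::euclidean_space set"
  shows "dim ((span S)\<^sup>\<bottom>) = DIM('a) - dim S"
  using dim_subspace_orthogonal_to_vectors[of "span S" UNIV]
  by (simp add: orthogonal_comp_def)

text \<open>The complement lies in \<open>L\<close>, so half the minimal distance of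
  \<open>L\<close> is a packing radius for it. The density formula combines this with the equality
  of the determinants of a section and its complement.\<close>

lemma bare_packing:
  fixes L :: "'a::euclidean_space set"
  assumes "unimodular L" "dim L = DIM('a)" "primitive L bs" "has_minimum L 6"
  shows "is_bare_packing (DIM('a) - length bs) L (int_span bs)"
    and "bare_center_density L (int_span bs) =
      (3/2) powr (real (DIM('a) - length bs) / 2) / sqrt (Determinant.det (gram bs))"
proof -
  let ?n = "DIM('a) - length bs" and ?C = "lattice_complement L (int_span bs)"
  interpret integral_group L by (rule unimodular_integral_group[OF assms(1)])
  obtain ds where ds: "lattice_basis ?C ds" "length ds = ?n"
    "Determinant.det (gram ds) = Determinant.det (gram bs)"
    using unimodular_complement[OF assms(1,2,3)] .
  have indep: "indep_list bs" using assms(3) by (simp add: primitive_def)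
  have dimC: "dim ?C = ?n"
    using dim_int_span[of ds] ds by (auto simp: lattice_basis_alt)
  have "ball x (sqrt 6 / 2) \<inter> ball y (sqrt 6 / 2) = {}" if "x \<in> ?C" "y \<in> ?C" "x \<noteq> y" for x y
  proof (rule disjoint_ballI)
    have "x - y \<in> L - {0}" using that diff_mem by (auto simp: lattice_complement_def)
    then have "6 \<le> inner (x - y) (x - y)" using assms(4) by (auto simp: has_minimum_def)
    then show "sqrt 6 / 2 + sqrt 6 / 2 \<le> dist x y"
      by (simp add: dist_norm norm_eq_sqrt_inner)
  qed
  moreover have "dim ((span (int_span bs))\<^sup>\<bottom>) = ?n"
    by (simp add: dim_orthogonal_comp dim_int_span[OF indep])
  ultimately show "is_bare_packing ?n L (int_span bs)"
    using ds dimC unfolding is_bare_packing_def lattice_packing_def is_lattice_def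
    by (auto simp: lattice_complement_def)
  have "(sqrt 6 / 2) ^ ?n = (3/2) powr (real ?n / 2)"
  proof -
    have "sqrt 6 / 2 = (3/2 :: real) powr (1/2)"
      using real_sqrt_unique[of "sqrt 6 / 2" "3/2"] by (simp add: powr_half_sqrt power_divide)
    then show ?thesis by (simp add: powr_power)
  qed
  moreover have "unit_ball_vol (real ?n) \<noteq> 0" using unit_ball_vol_pos[of "real ?n"] by (metis of_nat_0_le_iff less_irrefl)
  ultimately show "bare_center_density L (int_span bs) =
      (3/2) powr (real ?n / 2) / sqrt (Determinant.det (gram bs))"
    unfolding bare_center_density_def center_density_def packing_density_def dimC
    using lattice_det_eq[OF ds(1)] ds(3) by simp
qed

section \<open>The covering radius of E8\<close>

text \<open>Prepares \<open>E8_cell_bound\<close>: \<open>p\<close> is the largest of eight numbers,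
  \<open>t\<close> and \<open>s\<close> are the largest and the smallest of the other seven. The
  left side is a convex quadratic in \<open>s\<close>, so the ends \<open>s = 0\<close> and
  \<open>s = t\<close> decide.\<close>

lemma E8_cell_poly:
  fixes p s t :: real
  assumes "0 \<le> s" "s \<le> t" "t \<le> p" "p + t \<le> 3"
  shows "p\<^sup>2 + (t + s) * (6 + s - p) - 6 * t * s + s\<^sup>2 \<le> 9"
proof -
  define f where "f s = p\<^sup>2 + (t + s) * (6 + s - p) - 6 * t * s + s\<^sup>2" for s
  have *: "0 \<le> (p - t) * (3 - t - p)"
    using assms by (intro mult_nonneg_nonneg) auto
  have "p * (3 - t) \<le> (3 - t) * (3 - t)"
    using assms by (intro mult_right_mono) auto
  moreover have "0 \<le> t * (3 - 2 * t)" using assms by (intro mult_nonneg_nonneg) auto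
  ultimately have f0: "f 0 \<le> 9"
    using * by (simp add: f_def algebra_simps power2_eq_square)
  have "f t = 9 - (3 - p - t) * (3 + p - 3 * t)"
    by (simp add: f_def algebra_simps power2_eq_square)
  moreover have "0 \<le> (3 - p - t) * (3 + p - 3 * t)"
    using assms by (intro mult_nonneg_nonneg) auto
  ultimately have ft: "f t \<le> 9" by simp
  \<comment> \<open>The last term is \<open>t\<close> times the gap between the chord over the
    interval from 0 to \<open>t\<close> and the graph of \<open>f\<close>, whose leading coefficient
    is 2.\<close>
  have conv: "t * f s = (t - s) * f 0 + s * f t - 2 * t * s * (t - s)"
    by (simp add: f_def algebra_simps power2_eq_square)
  have "f s \<le> 9"
  proof (cases "t = 0")
    case True
    then show ?thesis using assms f0 by simp
  next
    case False
    have "(t - s) * f 0 \<le> (t - s) * 9" "s * f t \<le> s * 9" "0 \<le> 2 * t * s * (t - s)"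
      using assms by (intro mult_left_mono f0 ft mult_nonneg_nonneg; simp)+
    then have "t * f s \<le> t * 9" unfolding conv by (simp add: algebra_simps)
    then show ?thesis using False assms by simp
  qed
  then show ?thesis by (simp add: f_def)
qed

text \<open>The Voronoi cell of the lattice spanned by the roots is cut out by the inequalities
  \<open>inner x r \<le> inner r r / 2\<close>; its circumradius is \<open>1\<close>, here scaled by \<open>3\<close>.\<close>

lemma E8_cell_bound:
  fixes a :: "8 \<Rightarrow> real"
  assumes nonneg: "\<And>i. 0 \<le> a i"
    and pair: "\<And>i j. i \<noteq> j \<Longrightarrow> a i + a j \<le> 3"
    and flip: "\<And>k. (\<Sum>i\<in>UNIV. a i) - 2 * a k \<le> 6"
  shows "(\<Sum>i\<in>UNIV. (a i)\<^sup>2) \<le> 9"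
proof -
  have fin: "finite (UNIV - {j} :: 8 set)" "UNIV - {j} \<noteq> ({} :: 8 set)" for j :: 8
  proof -
    have "card (UNIV - {j} :: 8 set) = 7" by (simp add: card_Diff_singleton)
    then show "UNIV - {j} \<noteq> ({} :: 8 set)" by (metis card.empty zero_neq_numeral)
  qed simp
  have "Max (range a) \<in> range a" by (rule Max_in) auto
  then obtain m where "Max (range a) = a m" by (rule imageE)
  then have m: "a i \<le> a m" for i using Max_ge[of "range a" "a i"] by simp
  have "Min (a ` (UNIV - {m})) \<in> a ` (UNIV - {m})" using fin by (intro Min_in) auto
  then obtain k where k: "Min (a ` (UNIV - {m})) = a k" "k \<in> UNIV - {m}" by (rule imageE)
  then have k_le: "a k \<le> a i" if "i \<noteq> m" for i
    using that Min_le[of "a ` (UNIV - {m})" "a i"] by simp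
  have "Max (a ` (UNIV - {m})) \<in> a ` (UNIV - {m})" using fin by (intro Max_in) auto
  then obtain l where l: "Max (a ` (UNIV - {m})) = a l" "l \<in> UNIV - {m}" by (rule imageE)
  then have le_l: "a i \<le> a l" if "i \<noteq> m" for i
    using that Max_ge[of "a ` (UNIV - {m})" "a i"] by simp
  define R where "R = UNIV - {m} - {k}"
  have card: "card R = 6"
    using k(2) by (simp add: R_def card_Diff_singleton)
  have split: "(\<Sum>i\<in>UNIV. g i) = g m + g k + (\<Sum>i\<in>R. g i)" for g :: "8 \<Rightarrow> real"
    using sum.remove[of UNIV m g] sum.remove[of "UNIV - {m}" k g] k(2) by (simp add: R_def)
  \<comment> \<open>A value \<open>z\<close> between \<open>a k\<close> and \<open>a l\<close>
    satisfies \<open>0 \<le> (a l - z) * (z - a k)\<close>, which bounds its square by a linear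
    expression. The sum of the six values over \<open>R\<close> is then controlled by
    \<open>flip\<close> at the smallest coordinate \<open>k\<close>.\<close>
  have "(\<Sum>i\<in>R. (a i)\<^sup>2) \<le> (\<Sum>i\<in>R. (a l + a k) * a i - a l * a k)"
  proof (rule sum_mono)
    fix i assume "i \<in> R"
    then have "0 \<le> (a l - a i) * (a i - a k)"
      using k_le[of i] le_l[of i] by (intro mult_nonneg_nonneg) (auto simp: R_def)
    then show "(a i)\<^sup>2 \<le> (a l + a k) * a i - a l * a k"
      by (simp add: algebra_simps power2_eq_square)
  qed
  also have "\<dots> = (a l + a k) * (\<Sum>i\<in>R. a i) - 6 * a l * a k"
    by (simp add: sum_subtractf sum_distrib_left card)
  also have "(a l + a k) * (\<Sum>i\<in>R. a i) \<le> (a l + a k) * (6 + a k - a m)"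
    using flip[of k] nonneg[of l] nonneg[of k] by (intro mult_left_mono) (auto simp: split)
  finally have "(\<Sum>i\<in>UNIV. (a i)\<^sup>2) \<le> (a m)\<^sup>2 + (a l + a k) * (6 + a k - a m) - 6 * a l * a k + (a k)\<^sup>2"
    unfolding split by simp
  also have "\<dots> \<le> 9"
    using nonneg[of k] k_le[of l] m[of l] pair[of m l] l(2) by (intro E8_cell_poly) auto
  finally show ?thesis .
qed

lemma E8_0: "0 \<in> E8"
  by (auto simp: E8_def intro: exI[of _ 0])

lemma E8_diff:
  assumes "x \<in> E8" "y \<in> E8"
  shows "x - y \<in> E8"
proof -
  obtain k l :: int where kl: "(\<Sum>i\<in>UNIV. x $ i) = 2 * of_int k" "(\<Sum>i\<in>UNIV. y $ i) = 2 * of_int l"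
    using assms by (auto simp: E8_def)
  have "(\<Sum>i\<in>UNIV. (x - y) $ i) = 2 * of_int (k - l)"
    using kl by (simp add: sum_subtractf)
  moreover have "(\<forall>i. (x - y) $ i \<in> \<int>) \<or> (\<forall>i. (x - y) $ i - 1/2 \<in> \<int>)"
  proof -
    consider "(\<forall>i. x $ i \<in> \<int>)" "(\<forall>i. y $ i \<in> \<int>)" | "(\<forall>i. x $ i - 1/2 \<in> \<int>)" "(\<forall>i. y $ i - 1/2 \<in> \<int>)"
      | "(\<forall>i. x $ i - 1/2 \<in> \<int>)" "(\<forall>i. y $ i \<in> \<int>)" | "(\<forall>i. x $ i \<in> \<int>)" "(\<forall>i. y $ i - 1/2 \<in> \<int>)"
      using assms by (auto simp: E8_def)
    then show ?thesis
    proof cases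
      case 1 then show ?thesis by simp
    next
      case 2
      then have "(x - y) $ i \<in> \<int>" for i
        using Ints_diff[of "x $ i - 1/2" "y $ i - 1/2"] by simp
      then show ?thesis by blast
    next
      case 3
      then have "(x - y) $ i - 1/2 \<in> \<int>" for i
        using Ints_diff[of "x $ i - 1/2" "y $ i"] by (simp add: algebra_simps)
      then show ?thesis by blast
    next
      case 4
      then have "(x - y) $ i - 1/2 \<in> \<int>" for i
        using Ints_diff[OF Ints_diff[of "x $ i" "y $ i - 1/2"] Ints_1] by (simp add: algebra_simps)
      then show ?thesis by blast
    qed
  qed
  ultimately show ?thesis unfolding E8_def by blast
qed

text \<open>Since n (n - 1) is even, the norm of an integral vector has the parity of its coordinate
  sum. In the half-integral case (n + 1/2)^2 = n (n + 1) + 1/4, and the eight quarters add up to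
  2.\<close>

lemma E8_norm:
  assumes "x \<in> E8"
  obtains k :: int where "inner x x = 2 * of_int k"
proof -
  obtain k :: int where k: "(\<Sum>i\<in>UNIV. x $ i) = 2 * of_int k"
    using assms by (auto simp: E8_def)
  have even: "n * (n - 1) = 2 * (n * (n - 1) div 2)" for n :: int
    by simp
  consider "\<forall>i. x $ i \<in> \<int>" | "\<forall>i. x $ i - 1/2 \<in> \<int>" using assms by (auto simp: E8_def)
  then show ?thesis
  proof cases
    case 1
    define n :: "8 \<Rightarrow> int" where "n i = \<lfloor>x $ i\<rfloor>" for i
    have n: "x $ i = of_int (n i)" for i using 1 by (simp add: n_def of_int_floor_cancel)
    define l where "l i = n i * (n i - 1) div 2" for i
    have l: "n i * (n i - 1) = 2 * l i" for i unfolding l_def by (rule even)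
    have "inner x x - (\<Sum>i\<in>UNIV. x $ i) = (\<Sum>i\<in>UNIV. of_int (n i * (n i - 1)))"
      by (simp add: inner_vec_def n sum_subtractf[symmetric] algebra_simps)
    also have "\<dots> = 2 * of_int (\<Sum>i\<in>UNIV. l i)"
      unfolding l by (simp add: sum_distrib_left)
    finally have "inner x x = 2 * of_int ((\<Sum>i\<in>UNIV. l i) + k)" using k by simp
    then show ?thesis by (rule that)
  next
    case 2
    define n :: "8 \<Rightarrow> int" where "n i = \<lfloor>x $ i - 1/2\<rfloor>" for i
    have "of_int (n i) = x $ i - 1/2" for i
      using 2[rule_format, of i] unfolding n_def by (elim Ints_cases) (simp only: floor_of_int)
    then have n: "x $ i = of_int (n i) + 1/2" for i by simp
    define l where "l i = (n i + 1) * (n i + 1 - 1) div 2" for i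
    have l: "(n i + 1) * (n i + 1 - 1) = 2 * l i" for i unfolding l_def by (rule even)
    have "inner x x = (\<Sum>i\<in>UNIV. of_int ((n i + 1) * (n i + 1 - 1)) + 1/4)"
      by (simp add: inner_vec_def n algebra_simps add_divide_distrib)
    also have "\<dots> = 2 * of_int ((\<Sum>i\<in>UNIV. l i) + 1)"
      unfolding l by (simp add: sum_distrib_left sum.distrib)
    finally show ?thesis by (rule that)
  qed
qed

lemma E8_root_pair:
  assumes "i \<noteq> j" "\<sigma> \<in> {-1, 1 :: int}" "\<tau> \<in> {-1, 1 :: int}"
  shows "of_int \<sigma> *\<^sub>R axis i 1 + of_int \<tau> *\<^sub>R axis j 1 \<in> E8"
proof -
  have nth: "(of_int \<sigma> *\<^sub>R axis i 1 + of_int \<tau> *\<^sub>R axis j 1 :: real^8) $ l =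
      (if l = i then of_int \<sigma> else 0) + (if l = j then of_int \<tau> else 0)" for l
    by (simp add: axis_def)
  obtain k where "\<sigma> + \<tau> = 2 * k" using assms by auto
  then have "of_int \<sigma> + of_int \<tau> = (2 * of_int k :: real)"
    by (metis of_int_add of_int_mult of_int_numeral)
  then have "(\<Sum>l\<in>UNIV. (of_int \<sigma> *\<^sub>R axis i 1 + of_int \<tau> *\<^sub>R axis j 1 :: real^8) $ l) = 2 * of_int k"
    unfolding nth by (simp add: sum.distrib)
  moreover have "(of_int \<sigma> *\<^sub>R axis i 1 + of_int \<tau> *\<^sub>R axis j 1 :: real^8) $ l \<in> \<int>" for l
    by (auto simp: axis_def)
  ultimately show ?thesis unfolding E8_def by blast
qed

text \<open>The coordinate sum is the sum of \<open>b\<close> minus 4, so the parity of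
  \<open>b\<close> is what matters. For \<open>b\<close> with values 0 and 1 these are the 128 roots
  with half-integral coordinates.\<close>

lemma E8_root_half:
  assumes "even (\<Sum>i\<in>UNIV. b i :: int)"
  shows "(\<chi> i. of_int (b i) - 1/2) \<in> E8"
proof -
  obtain k where k: "(\<Sum>i\<in>UNIV. b i) = 2 * k" using assms by auto
  have "(\<Sum>i\<in>UNIV. of_int (b i) - 1/2 :: real) = of_int (\<Sum>i\<in>UNIV. b i) - 4"
    by (simp add: sum_subtractf)
  also have "\<dots> = 2 * of_int (k - 2)" unfolding k by simp
  finally have "(\<Sum>i\<in>UNIV. of_int (b i) - 1/2 :: real) = 2 * of_int (k - 2)" .
  moreover have "of_int (b i) - 1/2 - 1/2 \<in> (\<int> :: real set)" for i
  proof -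
    have "of_int (b i) - 1/2 - 1/2 = (of_int (b i - 1) :: real)" by simp
    then show ?thesis by (metis Ints_of_int)
  qed
  ultimately have "\<forall>i. of_int (b i) - 1/2 - 1/2 \<in> (\<int> :: real set)"
    "\<exists>k::int. (\<Sum>i\<in>UNIV. of_int (b i) - 1/2 :: real) = 2 * of_int k" by blast+
  then show ?thesis unfolding E8_def by simp
qed

text \<open>Roots whose signs follow those of \<open>x\<close> turn the hypothesis into the
  inequalities of \<open>E8_cell_bound\<close> for the absolute values. The 3 is
  \<open>inner r r / 2\<close> multiplied by 3, since the cell is that of 3 E8.\<close>

lemma E8_cell:
  fixes x :: "real^8"
  assumes roots: "\<And>r. r \<in> E8 \<Longrightarrow> inner r r = 2 \<Longrightarrow> inner x r \<le> 3"
  shows "inner x x \<le> 9"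
proof -
  define \<sigma> :: "8 \<Rightarrow> int" where "\<sigma> i = (if x $ i \<ge> 0 then 1 else -1)" for i
  have \<sigma>: "\<sigma> i \<in> {-1, 1}" "of_int (\<sigma> i) * x $ i = \<bar>x $ i\<bar>" for i by (auto simp: \<sigma>_def)
  have "(\<Sum>i\<in>UNIV. \<bar>x $ i\<bar>\<^sup>2) \<le> 9"
  proof (rule E8_cell_bound)
    fix i j :: 8 assume ij: "i \<noteq> j"
    let ?r = "of_int (\<sigma> i) *\<^sub>R axis i 1 + of_int (\<sigma> j) *\<^sub>R axis j 1 :: real^8"
    have "inner ?r ?r = 2"
      using ij \<sigma>(1)[of i] \<sigma>(1)[of j] by (auto simp: inner_add_left inner_add_right inner_axis_axis)
    then have "inner x ?r \<le> 3"
      using roots E8_root_pair[OF ij \<sigma>(1) \<sigma>(1)] by blast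
    then show "\<bar>x $ i\<bar> + \<bar>x $ j\<bar> \<le> 3"
      by (simp add: inner_add_right inner_axis \<sigma>(2))
  next
    fix k :: 8
    have half: "(\<Sum>i\<in>UNIV. (2 * of_int (b i) - 1) * x $ i) \<le> 6"
      if b: "\<And>i. b i \<in> {0, 1}" and "even (\<Sum>i\<in>UNIV. b i)" for b :: "8 \<Rightarrow> int"
    proof -
      let ?r = "(\<chi> i. of_int (b i) - 1/2) :: real^8"
      have "(of_int (b i) - 1/2) * (of_int (b i) - 1/2) = (1/4 :: real)" for i
        using b[of i] by auto
      then have "inner ?r ?r = 2"
        by (simp only: inner_vec_def vec_lambda_beta inner_real_def) simp
      then have "inner x ?r \<le> 3" using roots E8_root_half that(2) by blast
      moreover have "(\<Sum>i\<in>UNIV. (2 * of_int (b i) - 1) * x $ i) = 2 * inner x ?r"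
        by (simp add: inner_vec_def sum_distrib_left algebra_simps)
      ultimately show ?thesis by simp
    qed
    \<comment> \<open>\<open>b\<close> marks the nonnegative coordinates. If their number is odd,
      the half-integral vector with these signs is not in \<open>E8\<close>; switching the sign at
      \<open>k\<close> repairs this at the cost of \<open>2 * \<bar>x $ k\<bar>\<close>.\<close>
    define b where "b i = (\<sigma> i + 1) div 2" for i
    have b: "b i \<in> {0, 1}" "2 * b i - 1 = \<sigma> i" for i using \<sigma>(1)[of i] by (auto simp: b_def)
    define b' where "b' i = (if i = k then 1 - b i else b i)" for i
    have b': "b' i \<in> {0, 1}" for i using b(1)[of i] by (auto simp: b'_def)
    have b_x: "(2 * of_int (b i) - 1) * x $ i = \<bar>x $ i\<bar>" for i
      using \<sigma>(2)[of i] unfolding b(2)[symmetric] by simp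
    have b'_x: "(2 * of_int (b' i) - 1) * x $ i = \<bar>x $ i\<bar> - (if i = k then 2 * \<bar>x $ k\<bar> else 0)" for i
      using b_x[of i] by (auto simp: b'_def algebra_simps)
    show "(\<Sum>i\<in>UNIV. \<bar>x $ i\<bar>) - 2 * \<bar>x $ k\<bar> \<le> 6"
    proof (cases "even (\<Sum>i\<in>UNIV. b i)")
      case True
      from half[OF b(1) this] have "(\<Sum>i\<in>UNIV. \<bar>x $ i\<bar>) \<le> 6" by (simp only: b_x)
      then show ?thesis using abs_ge_zero[of "x $ k"] by linarith
    next
      case False
      have "(\<Sum>i\<in>UNIV. b' i) = (\<Sum>i\<in>UNIV. b i + (if i = k then 1 - 2 * b k else 0))"
        by (intro sum.cong) (auto simp: b'_def)
      also have "\<dots> = (\<Sum>i\<in>UNIV. b i) + (1 - 2 * b k)" by (simp add: sum.distrib)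
      finally have "even (\<Sum>i\<in>UNIV. b' i)" using False by simp
      from half[OF b' this] show ?thesis by (simp add: b'_x sum_subtractf)
    qed
  qed auto
  then show ?thesis by (simp add: inner_vec_def power2_eq_square)
qed

lemma E8_add: "x \<in> E8 \<Longrightarrow> y \<in> E8 \<Longrightarrow> x + y \<in> E8"
  using E8_diff[OF _ E8_diff[OF E8_0], of x y] by simp

text \<open>A representative of \<open>x\<close> modulo 3 E8 of least norm is not improved by
  subtracting three times a root, which is the hypothesis of \<open>E8_cell\<close>. Its norm is
  thus at most 9 and, being even, at most 8.\<close>

lemma E8_covering:
  assumes "x \<in> E8"
  obtains y where "y \<in> E8" "inner (x - 3 *\<^sub>R y) (x - 3 *\<^sub>R y) \<le> 8"
proof -
  have E8_3: "x - 3 *\<^sub>R y \<in> E8" if "y \<in> E8" for y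
  proof -
    have "3 *\<^sub>R y = (1 + 1 + 1) *\<^sub>R y" by simp
    then have "3 *\<^sub>R y = y + y + y" by (simp only: scaleR_add_left scaleR_one)
    then show ?thesis using E8_add[OF E8_add[OF that that] that] E8_diff[OF assms] by simp
  qed
  \<comment> \<open>On \<open>E8\<close> these norms are integers, so passing to naturals loses
    nothing and makes a minimum available.\<close>
  define \<mu> where "\<mu> y = nat \<lfloor>inner (x - 3 *\<^sub>R y) (x - 3 *\<^sub>R y)\<rfloor>" for y
  have \<mu>: "real (\<mu> y) = inner (x - 3 *\<^sub>R y) (x - 3 *\<^sub>R y)" if y: "y \<in> E8" for y
  proof -
    obtain k where "inner (x - 3 *\<^sub>R y) (x - 3 *\<^sub>R y) = 2 * of_int k"
      using E8_norm[OF E8_3[OF y]] .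
    then have "inner (x - 3 *\<^sub>R y) (x - 3 *\<^sub>R y) = of_int (2 * k)" by simp
    moreover from this have "0 \<le> 2 * k"
      using inner_ge_zero[of "x - 3 *\<^sub>R y"] by linarith
    ultimately show ?thesis by (simp add: \<mu>_def)
  qed
  obtain y where y: "y \<in> E8" "\<And>z. z \<in> E8 \<Longrightarrow> \<mu> y \<le> \<mu> z"
    using ex_has_least_nat[of "\<lambda>y. y \<in> E8" 0 \<mu>] E8_0 by blast
  let ?z = "x - 3 *\<^sub>R y"
  have "inner ?z ?z \<le> 9"
  proof (rule E8_cell)
    fix r assume r: "r \<in> E8" "inner r r = 2"
    have "real (\<mu> y) \<le> real (\<mu> (y + r))"
      using y(2)[OF E8_add[OF y(1) r(1)]] by simp
    then have "inner ?z ?z \<le> inner (?z - 3 *\<^sub>R r) (?z - 3 *\<^sub>R r)"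
      using \<mu>[OF y(1)] \<mu>[OF E8_add[OF y(1) r(1)]] by (simp add: algebra_simps)
    also have "\<dots> = inner ?z ?z - 6 * inner ?z r + 9 * inner r r"
      by (simp add: inner_diff_left[of ?z] inner_diff_right[of _ ?z] inner_commute[of r ?z])
    finally show "inner ?z r \<le> 3" using r(2) by simp
  qed
  moreover obtain k where k: "inner ?z ?z = 2 * of_int k"
    using E8_norm[OF E8_3[OF y(1)]] .
  ultimately have "of_int (2 * k) \<le> (9 :: real)" by simp
  then have "k \<le> 4" by linarith
  then have "inner ?z ?z \<le> 8" using k by simp
  with y(1) that show ?thesis by blast
qed

section \<open>Sublattices similar to E8\<close>

lemma bij_of_nat_bit0:
  "bij_betw of_nat {..<CARD('a::finite bit0)} (UNIV :: 'a bit0 set)"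
proof -
  have surj: "of_nat ` {..<CARD('a bit0)} = (UNIV :: 'a bit0 set)"
  proof (intro equalityI subsetI UNIV_I)
    fix x :: "'a bit0"
    show "x \<in> of_nat ` {..<CARD('a bit0)}"
    proof (cases x)
      case (of_int z)
      then have "x = of_nat (nat z)" "nat z < CARD('a bit0)" by auto
      then show ?thesis by blast
    qed
  qed
  moreover have "inj_on (of_nat :: nat \<Rightarrow> 'a bit0) {..<CARD('a bit0)}"
    by (rule eq_card_imp_inj_on) (simp_all only: surj finite_lessThan card_lessThan)
  ultimately show ?thesis by (simp add: bij_betw_def)
qed

text \<open>The index types \<open>8\<close> and \<open>48\<close> are \<open>4 bit0\<close> and
  \<open>24 bit0\<close>, so one definition numbers the coordinates of both spaces.\<close>

definition coord_index :: "'n::finite bit0 \<Rightarrow> nat" where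
  "coord_index = the_inv_into {..<CARD('n bit0)} of_nat"

lemma coord_index_of_nat: "k < CARD('n::finite bit0) \<Longrightarrow> coord_index (of_nat k :: 'n bit0) = k"
  using bij_of_nat_bit0[where 'a='n] by (auto simp: coord_index_def bij_betw_def the_inv_into_f_f)

lemma coord_index_less: "coord_index (i :: 'n::finite bit0) < CARD('n bit0)"
  using the_inv_into_into[OF _ _ subset_refl, of of_nat "{..<CARD('n bit0)}" i] bij_of_nat_bit0[where 'a='n]
  by (simp add: coord_index_def bij_betw_def)

text \<open>The numbering \<open>p\<close> is a parameter because the quadratic residue code is read
  in two different orders.\<close>

definition coord_vec :: "('n::finite \<Rightarrow> nat) \<Rightarrow> (nat \<Rightarrow> int) \<Rightarrow> real ^ 'n" where
  "coord_vec p f = (\<chi> i. of_int (f (p i)))"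

lemma inner_coord_vec:
  assumes "bij_betw p UNIV {..<n}"
  shows "inner (coord_vec p f) (coord_vec p g) = of_int (\<Sum>k<n. f k * g k)"
  using sum.reindex_bij_betw[OF assms, of "\<lambda>k. of_int (f k) * of_int (g k) :: real"]
  by (simp add: coord_vec_def inner_vec_def)

lemma bij_coord_index: "bij_betw coord_index (UNIV :: 'n::finite bit0 set) {..<CARD('n bit0)}"
  unfolding coord_index_def using bij_betw_the_inv_into[OF bij_of_nat_bit0] .

text \<open>An integer copy of \<open>K10_gram\<close>, on which identities can be checked by
  evaluation.\<close>

definition K10_rows :: "int list list" where
  "K10_rows =
    [[ 6,-3,-3,-3,-3,-3,-3, 3,-2, 1],
     [-3, 6, 3, 3, 3, 3, 3, 0, 1,-1],
     [-3, 3, 6, 0, 3, 0, 0,-3, 3, 1],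
     [-3, 3, 0, 6, 3, 3, 3, 0,-1, 0],
     [-3, 3, 3, 3, 6, 3, 3,-3, 1,-1],
     [-3, 3, 0, 3, 3, 6, 3, 0, 0,-2],
     [-3, 3, 0, 3, 3, 3, 6, 0, 1,-2],
     [ 3, 0,-3, 0,-3, 0, 0, 6,-1, 1],
     [-2, 1, 3,-1, 1, 0, 1,-1, 6, 2],
     [ 1,-1, 1, 0,-1,-2,-2, 1, 2, 6]]"

lemma K10_gram_index: "i < 10 \<Longrightarrow> j < 10 \<Longrightarrow> K10_gram $$ (i, j) = of_int (K10_rows ! i ! j)"
proof -
  assume ij: "i < 10" "j < 10"
  have eq: "K10_gram = mat_of_rows_list 10 (map (map of_int) K10_rows)"
    by (simp add: K10_gram_def K10_rows_def)
  have len: "length K10_rows = 10" by (simp add: K10_rows_def)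
  have "length (K10_rows ! i) = 10"
  proof -
    have "\<forall>r\<in>set K10_rows. length r = 10" by (simp add: K10_rows_def)
    then show ?thesis using ij(1) len by simp
  qed
  then show "K10_gram $$ (i, j) = of_int (K10_rows ! i ! j)"
    unfolding eq using ij len by (simp add: mat_of_rows_list_def)
qed

definition K8_gram :: "real mat" where
  "K8_gram = Matrix.mat 8 8 (\<lambda>(i, j). K10_gram $$ (i, j))"

text \<open>\<open>K8_gram\<close> is three times a unimodular matrix, with inverse \<open>K8_dual\<close>.\<close>

definition K8_dual :: "int list list" where
  "K8_dual =
    [[4, -1, 3, 2, -3, 2, 2, -2], [-1, 2, -2, -1, 1, -1, -1, 0], [3, -2, 4, 2, -3, 2, 2, -1],
     [2, -1, 2, 2, -2, 1, 1, -1], [-3, 1, -3, -2, 4, -2, -2, 2], [2, -1, 2, 1, -2, 2, 1, -1],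
     [2, -1, 2, 1, -2, 1, 2, -1], [-2, 0, -1, -1, 2, -1, -1, 2]]"

text \<open>Twice the coordinates of a basis of \<open>E8\<close>.\<close>

definition E8_rows :: "int list list" where
  "E8_rows =
    [[-2, -2, 0, 0, 0, 0, 0, 0], [0, 2, -2, 0, 0, 0, 0, 0], [0, 2, 0, -2, 0, 0, 0, 0],
     [0, 2, 0, 2, 0, 0, 0, 0], [0, 2, 0, 0, -2, 0, 0, 0], [1, 1, -1, 1, -1, 1, 1, 1],
     [1, 1, -1, 1, -1, 1, -1, -1], [-1, -1, -1, 1, 1, 1, 1, -1]]"

definition E8_basis :: "(real^8) list" where
  "E8_basis = map (\<lambda>l. (1/2) *\<^sub>R coord_vec coord_index ((!) l)) E8_rows"

lemma sum_lessThan_list: "(\<Sum>k<n. f k) = sum_list (map f [0..<n])"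
  for f :: "nat \<Rightarrow> 'b::comm_monoid_add"
  by (simp add: interv_sum_list_conv_sum_set_nat lessThan_atLeast0)

text \<open>The 4 comes from the doubled coordinates, the 3 from the scaling of
  \<open>sqrt3_E8\<close>: the rows were chosen to reproduce the leading block of
  \<open>K10_gram\<close>.\<close>

lemma E8_rows_gram:
  "\<forall>i\<in>set [0..<8]. \<forall>j\<in>set [0..<8].
    3 * sum_list (map (\<lambda>k. E8_rows ! i ! k * E8_rows ! j ! k) [0..<8]) = 4 * K10_rows ! i ! j"
  by code_simp

lemma K8_dual_mult:
  "\<forall>i\<in>set [0..<8]. \<forall>j\<in>set [0..<8].
    sum_list (map (\<lambda>k. K8_dual ! i ! k * K10_rows ! k ! j) [0..<8]) = (if i = j then 3 else 0)"
  by code_simp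

lemma length_E8_basis: "length E8_basis = 8"
  by (simp add: E8_basis_def E8_rows_def)

lemma inner_E8_basis:
  assumes "i < 8" "j < 8"
  shows "inner (E8_basis ! i) (E8_basis ! j) = of_int (K10_rows ! i ! j) / 3"
proof -
  let ?S = "\<Sum>k<8. E8_rows ! i ! k * E8_rows ! j ! k"
  have "3 * ?S = 4 * K10_rows ! i ! j"
    using E8_rows_gram assms by (simp add: sum_lessThan_list)
  then have "real_of_int (3 * ?S) = real_of_int (4 * K10_rows ! i ! j)"
    by (rule arg_cong)
  then have "3 * real_of_int ?S = 4 * real_of_int (K10_rows ! i ! j)"
    by (simp only: of_int_mult of_int_numeral)
  moreover have "length E8_rows = 8" by (simp add: E8_rows_def)
  then have "inner (E8_basis ! i) (E8_basis ! j) = real_of_int ?S / 4"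
    using assms bij_coord_index[where 'n = 4]
    by (simp add: E8_basis_def inner_coord_vec[where n = 8] del: of_int_sum)
  ultimately show ?thesis by linarith
qed

text \<open>\<open>B\<close> is \<open>q\<close> times the inverse Gram matrix, an explicit
  certificate that delivers both independence and coordinates. It is applied to
  \<open>K8_dual\<close> with \<open>q = 1\<close> for E8 and \<open>q = 3\<close> for the scaled
  copy.\<close>

lemma dual_expand:
  assumes len: "length bs = n" and q: "q \<noteq> 0"
    and dual: "\<And>i k. i < n \<Longrightarrow> k < n \<Longrightarrow> (\<Sum>j<n. B i j * inner (bs ! j) (bs ! k)) = (if i = k then q else 0)"
  shows "indep_list bs"
    and "x \<in> span (set bs) \<Longrightarrow> x = rcomb (\<lambda>i. (\<Sum>j<n. B i j * inner (bs ! j) x) / q) bs"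
proof -
  have coeff: "(\<Sum>j<n. B i j * inner (bs ! j) (rcomb c bs)) = q * c i" if "i < n" for i c
  proof -
    have "(\<Sum>j<n. B i j * inner (bs ! j) (rcomb c bs)) = (\<Sum>j<n. \<Sum>k<n. c k * (B i j * inner (bs ! j) (bs ! k)))"
      by (simp add: rcomb_def inner_sum_right sum_distrib_left len mult_ac)
    also have "\<dots> = (\<Sum>k<n. c k * (\<Sum>j<n. B i j * inner (bs ! j) (bs ! k)))"
      by (subst sum.swap) (simp add: sum_distrib_left)
    also have "\<dots> = (\<Sum>k<n. if i = k then q * c k else 0)"
      using that by (intro sum.cong) (auto simp: dual)
    finally show ?thesis using that by simp
  qed
  show indep: "indep_list bs"
  proof (rule indep_listI)
    fix c i assume "rcomb c bs = 0" "i < length bs"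
    then show "c i = 0" using coeff[of i c] q len by simp
  qed
  assume "x \<in> span (set bs)"
  then obtain c where c: "x = rcomb c bs" using mem_span_rcomb[OF indep] by blast
  show "x = rcomb (\<lambda>i. (\<Sum>j<n. B i j * inner (bs ! j) x) / q) bs"
    unfolding c using coeff q len by (intro rcomb_cong) simp
qed

lemma K8_dual_gram:
  assumes "i < 8" "k < 8"
  shows "(\<Sum>j<8. of_int (K8_dual ! i ! j) * of_int (K10_rows ! j ! k)) = (if i = k then 3 else 0 :: real)"
proof -
  have "(\<Sum>j<8. K8_dual ! i ! j * K10_rows ! j ! k) = (if i = k then 3 else 0)"
    using K8_dual_mult assms by (simp add: sum_lessThan_list)
  then have "real_of_int (\<Sum>j<8. K8_dual ! i ! j * K10_rows ! j ! k) = (if i = k then 3 else 0)"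
    by simp
  then show ?thesis by simp
qed

lemma E8_inner:
  assumes "x \<in> E8" "y \<in> E8"
  shows "inner x y \<in> \<int>"
proof -
  obtain k where "inner x x = 2 * of_int k" using E8_norm[OF assms(1)] .
  moreover obtain l where "inner y y = 2 * of_int l" using E8_norm[OF assms(2)] .
  moreover obtain m where "inner (x + y) (x + y) = 2 * of_int m" using E8_norm[OF E8_add[OF assms]] .
  ultimately have "inner x y = of_int (m - k - l)"
    by (simp add: inner_add_left inner_add_right inner_commute[of y x])
  then show ?thesis by simp
qed

interpretation E8: integral_group E8
  by unfold_locales (auto intro: E8_0 E8_diff E8_inner)

lemma E8_row_mem:
  assumes "length l = 8" "(\<forall>a\<in>set l. even a) \<or> (\<forall>a\<in>set l. odd a)" "4 dvd sum_list l"
  shows "(1/2) *\<^sub>R coord_vec coord_index ((!) l) \<in> E8"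
proof -
  obtain k where k: "sum_list l = 4 * k" using assms(3) by auto
  have "(\<Sum>i\<in>UNIV. ((1/2) *\<^sub>R coord_vec coord_index ((!) l) :: real^8) $ i) = (\<Sum>k<8. of_int (l ! k) / 2)"
    using sum.reindex_bij_betw[OF bij_coord_index[where 'n = 4], of "\<lambda>k. of_int (l ! k) / 2 :: real"]
    by (simp add: coord_vec_def)
  also have "\<dots> = of_int (sum_list l) / 2"
    using assms(1) by (simp add: sum_list_sum_nth lessThan_atLeast0 sum_divide_distrib)
  finally have "(\<Sum>i\<in>UNIV. ((1/2) *\<^sub>R coord_vec coord_index ((!) l) :: real^8) $ i) = 2 * of_int k"
    unfolding k by simp
  moreover have nth: "l ! coord_index (i :: 8) \<in> set l" for i
    using coord_index_less[of i] assms(1) by simp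
  have "(\<forall>i. ((1/2) *\<^sub>R coord_vec coord_index ((!) l) :: real^8) $ i \<in> \<int>) \<or> (\<forall>i. ((1/2) *\<^sub>R coord_vec coord_index ((!) l) :: real^8) $ i - 1/2 \<in> \<int>)"
    using assms(2)
  proof
    assume ev: "\<forall>a\<in>set l. even a"
    have "((1/2) *\<^sub>R coord_vec coord_index ((!) l) :: real^8) $ i \<in> \<int>" for i
    proof -
      obtain b where "l ! coord_index i = 2 * b" using ev nth[of i] by (auto elim: evenE)
      then show ?thesis by (simp add: coord_vec_def)
    qed
    then show ?thesis by blast
  next
    assume od: "\<forall>a\<in>set l. odd a"
    have "((1/2) *\<^sub>R coord_vec coord_index ((!) l) :: real^8) $ i - 1/2 \<in> \<int>" for i
    proof -
      obtain b where "l ! coord_index i = 2 * b + 1" using od nth[of i] by (auto elim: oddE)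
      then show ?thesis by (simp add: coord_vec_def)
    qed
    then show ?thesis by blast
  qed
  ultimately show ?thesis unfolding E8_def by blast
qed

text \<open>\<open>K8_dual\<close> is the integral inverse of the Gram matrix of
  \<open>E8_basis\<close>. As \<open>E8\<close> is integral, all its vectors have integer
  coordinates in this basis.\<close>

lemma E8_basis: "lattice_basis E8 E8_basis"
proof -
  have dual: "(\<Sum>j<8. of_int (K8_dual ! i ! j) * inner (E8_basis ! j) (E8_basis ! k)) = (if i = k then 1 else 0)"
    if "i < 8" "k < 8" for i k
    using K8_dual_gram[OF that] that
    by (simp add: inner_E8_basis sum_divide_distrib[symmetric] split: if_splits)
  have indep: "indep_list E8_basis"
    by (rule dual_expand(1)[OF length_E8_basis _ dual]) simp_all
  have span: "span (set E8_basis) = UNIV"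
    by (rule dim_eq_full[THEN iffD1]) (simp add: dim_indep_list[OF indep] length_E8_basis)
  have "\<forall>l\<in>set E8_rows. length l = 8 \<and> ((\<forall>a\<in>set l. even a) \<or> (\<forall>a\<in>set l. odd a)) \<and> 4 dvd sum_list l"
    by code_simp
  then have mem: "E8_basis ! i \<in> E8" if "i < 8" for i
    using that E8_row_mem by (simp add: E8_basis_def length_E8_basis[unfolded E8_basis_def length_map])
  have "int_span E8_basis \<subseteq> E8"
    using mem by (intro E8.int_span_subset) (auto simp: in_set_conv_nth length_E8_basis)
  moreover have "x \<in> int_span E8_basis" if x: "x \<in> E8" for x
  proof -
    define c where "c i = (\<Sum>j<8. K8_dual ! i ! j * \<lfloor>inner (E8_basis ! j) x\<rfloor>)" for i
    have fl: "of_int \<lfloor>inner (E8_basis ! j) x\<rfloor> = inner (E8_basis ! j) x" if "j < 8" for j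
      using E8_inner[OF mem[OF that] x] by (elim Ints_cases) simp
    have "x = rcomb (\<lambda>i. (\<Sum>j<8. of_int (K8_dual ! i ! j) * inner (E8_basis ! j) x) / 1) E8_basis"
      by (rule dual_expand(2)[OF length_E8_basis _ dual]) (simp_all add: span)
    also have "\<dots> = rcomb (\<lambda>i. of_int (c i)) E8_basis"
      by (intro rcomb_cong) (simp add: c_def fl)
    finally show ?thesis unfolding mem_int_span by (rule exI[where x = c])
  qed
  ultimately show ?thesis using indep by (auto simp: lattice_basis_alt)
qed

definition sqrt3_E8_basis :: "(real^8) list" where
  "sqrt3_E8_basis = map ((*\<^sub>R) (sqrt 3)) E8_basis"

lemma rcomb_map_scale: "rcomb c (map ((*\<^sub>R) r) bs) = r *\<^sub>R rcomb c bs"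
  by (simp add: rcomb_def scaleR_sum_right mult.commute)

lemma sqrt3_E8_basis: "lattice_basis sqrt3_E8 sqrt3_E8_basis"
proof -
  have "indep_list sqrt3_E8_basis"
  proof (rule indep_listI)
    fix c i assume "rcomb c sqrt3_E8_basis = 0" "i < length sqrt3_E8_basis"
    then show "c i = 0"
      using rcomb_eq_0[of E8_basis c i] E8_basis
      by (simp add: sqrt3_E8_basis_def rcomb_map_scale lattice_basis_alt)
  qed
  moreover have "sqrt3_E8 = int_span sqrt3_E8_basis"
  proof -
    have "E8 = int_span E8_basis" using E8_basis by (simp add: lattice_basis_alt)
    then have "x \<in> sqrt3_E8 \<longleftrightarrow> (\<exists>c :: nat \<Rightarrow> int. x = sqrt 3 *\<^sub>R rcomb (\<lambda>i. of_int (c i)) E8_basis)" for x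
      unfolding sqrt3_E8_def image_iff Bex_def \<open>E8 = int_span E8_basis\<close> mem_int_span by auto
    then show ?thesis
      unfolding set_eq_iff mem_int_span sqrt3_E8_basis_def rcomb_map_scale by simp
  qed
  ultimately show ?thesis by (simp add: lattice_basis_alt)
qed

lemma gram_sqrt3_E8_basis: "gram sqrt3_E8_basis = K8_gram"
  by (rule eq_matI)
    (simp_all add: gram_def K8_gram_def sqrt3_E8_basis_def length_E8_basis K10_gram_index inner_E8_basis)

section \<open>Transport along equal Gram matrices\<close>

lemma gram_eq_length: "gram bs = gram cs \<Longrightarrow> length bs = length cs"
  by (metis dim_row_mat(1) gram_def)

lemma gram_eq_inner:
  assumes "gram bs = gram cs" "i < length bs" "j < length bs"
  shows "inner (bs ! i) (bs ! j) = inner (cs ! i) (cs ! j)"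
proof -
  have "gram bs $$ (i, j) = gram cs $$ (i, j)" using assms(1) by simp
  then show ?thesis using assms(2,3) gram_eq_length[OF assms(1)] by (simp add: gram_def)
qed

lemma gram_eq_rcomb:
  assumes "gram bs = gram cs"
  shows "inner (rcomb c bs) (rcomb d bs) = inner (rcomb c cs) (rcomb d cs)"
  using gram_eq_inner[OF assms] gram_eq_length[OF assms]
  by (simp add: inner_rcomb_rcomb)

lemma gram_eq_indep:
  assumes "gram bs = gram cs" "indep_list cs"
  shows "indep_list bs"
proof (rule indep_listI)
  fix c i assume c: "rcomb c bs = 0" "i < length bs"
  then have "rcomb c cs = 0" using gram_eq_rcomb[OF assms(1), of c c] by simp
  then show "c i = 0" using rcomb_eq_0[OF assms(2)] c(2) gram_eq_length[OF assms(1)] by simp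
qed

lemma gram_eq_isometric:
  assumes "lattice_basis L bs" "lattice_basis M cs" "gram bs = gram cs"
  shows "lattice_isometric L M"
proof -
  have bs: "indep_list bs" "L = int_span bs" and cs: "indep_list cs" "M = int_span cs"
    using assms(1,2) by (auto simp: lattice_basis_alt)
  \<comment> \<open>The coefficients picked by \<open>SOME\<close> are unique on the first
    \<open>length bs\<close> positions by independence, so \<open>f\<close> keeps
    coefficients.\<close>
  define f where "f x = rcomb (SOME c. x = rcomb c bs) cs" for x
  have f: "f (rcomb c bs) = rcomb c cs" for c
  proof -
    have "rcomb c bs = rcomb (SOME c'. rcomb c bs = rcomb c' bs) bs"
      by (rule someI[of "\<lambda>c'. rcomb c bs = rcomb c' bs"]) simp
    from rcomb_inj[OF bs(1) this] show ?thesis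
      unfolding f_def using gram_eq_length[OF assms(3)] by (intro rcomb_cong) simp
  qed
  have "bij_betw f L M"
  proof (rule bij_betw_imageI)
    show "inj_on f L"
    proof (rule inj_onI)
      fix x y assume "x \<in> L" "y \<in> L" and eq: "f x = f y"
      then obtain c d :: "nat \<Rightarrow> int" where x: "x = rcomb (\<lambda>i. of_int (c i)) bs"
        and y: "y = rcomb (\<lambda>i. of_int (d i)) bs"
        unfolding bs(2) mem_int_span by blast
      then show "x = y"
        using rcomb_inj[OF cs(1), of "\<lambda>i. of_int (c i)" "\<lambda>i. of_int (d i)"] eq gram_eq_length[OF assms(3)]
        unfolding x y f by (intro rcomb_cong) simp
    qed
    show "f ` L = M"
    proof (intro equalityI subsetI)
      fix y assume "y \<in> f ` L"
      then obtain c :: "nat \<Rightarrow> int" where "y = f (rcomb (\<lambda>i. of_int (c i)) bs)"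
        unfolding bs(2) image_iff Bex_def mem_int_span by blast
      then show "y \<in> M" unfolding f cs(2) mem_int_span by blast
    next
      fix y assume "y \<in> M"
      then obtain c :: "nat \<Rightarrow> int" where "y = rcomb (\<lambda>i. of_int (c i)) cs"
        unfolding cs(2) mem_int_span by blast
      then have "y = f (rcomb (\<lambda>i. of_int (c i)) bs)" by (simp add: f)
      moreover have "rcomb (\<lambda>i. of_int (c i)) bs \<in> L"
        unfolding bs(2) mem_int_span by (rule exI, rule refl)
      ultimately show "y \<in> f ` L" by blast
    qed
  qed
  moreover have "f (x + y) = f x + f y \<and> inner (f x) (f y) = inner x y" if "x \<in> L" "y \<in> L" for x y
  proof -
    obtain c where "x = rcomb c bs" using \<open>x \<in> L\<close> unfolding bs(2) mem_int_span by blast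
    moreover obtain d where "y = rcomb d bs" using \<open>y \<in> L\<close> unfolding bs(2) mem_int_span by blast
    ultimately show ?thesis by (simp add: rcomb_add f gram_eq_rcomb[OF assms(3)])
  qed
  ultimately show ?thesis unfolding lattice_isometric_def by blast
qed

lemma isometric_basis:
  assumes "is_lattice L" "lattice_isometric L M" "lattice_basis M cs"
  obtains bs where "lattice_basis L bs" "gram bs = gram cs"
proof -
  have cs: "indep_list cs" "M = int_span cs" using assms(3) by (auto simp: lattice_basis_alt)
  obtain f where f: "bij_betw f L M" "\<And>x y. x \<in> L \<Longrightarrow> y \<in> L \<Longrightarrow> inner (f x) (f y) = inner x y"
    using assms(2) by (auto simp: lattice_isometric_def)
  obtain es where es: "L = int_span es" using assms(1) by (auto simp: is_lattice_def lattice_basis_alt)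
  define bs where "bs = map (the_inv_into L f) cs"
  have cM: "cs ! i \<in> M" if "i < length cs" for i using cs(2) int_span_nth[OF that] by simp
  have bL: "bs ! i \<in> L" and fb: "f (bs ! i) = cs ! i" if "i < length cs" for i
    using that cM[OF that] f(1) the_inv_into_into[of f L "cs ! i" L] f_the_inv_into_f[of f L "cs ! i"]
    by (auto simp: bs_def bij_betw_def)
  have len: "length bs = length cs" by (simp add: bs_def)
  have "inner (bs ! i) (bs ! j) = inner (cs ! i) (cs ! j)" if "i < length cs" "j < length cs" for i j
    using f(2)[OF bL[OF that(1)] bL[OF that(2)]] fb that by simp
  then have gram: "gram bs = gram cs"
    using len by (intro eq_matI) (auto simp: gram_def)
  have indep: "indep_list bs" by (rule gram_eq_indep[OF gram cs(1)])
  have "int_span bs \<subseteq> L"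
  proof
    fix x assume "x \<in> int_span bs"
    then obtain c :: "nat \<Rightarrow> int" where "x = (\<Sum>i<length bs. of_int (c i) *\<^sub>R bs ! i)"
      by (auto simp: int_span_def)
    then show "x \<in> L"
      using bL unfolding es len by (auto intro!: int_span_sum int_span_scale)
  qed
  moreover have "x \<in> int_span bs" if x: "x \<in> L" for x
  proof -
    have "f x \<in> int_span cs" using f(1) x cs(2) by (auto simp: bij_betw_def)
    then obtain c :: "nat \<Rightarrow> int" where c: "f x = rcomb (\<lambda>i. of_int (c i)) cs"
      unfolding mem_int_span by blast
    \<comment> \<open>That \<open>x\<close> equals the pulled-back combination \<open>?y\<close> is
      read off from \<open>inner (x - ?y) (x - ?y) = 0\<close>, as all inner products involved can
      be computed after applying \<open>f\<close>.\<close>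
    let ?y = "rcomb (\<lambda>i. of_int (c i)) bs"
    have "inner ?y x = (\<Sum>i<length bs. of_int (c i) * inner (f (bs ! i)) (f x))"
      unfolding inner_rcomb using f(2) bL x len by simp
    also have "\<dots> = inner (f x) (f x)"
      using fb len by (subst (2) c) (simp add: inner_rcomb)
    finally have "inner ?y x = inner x x" using f(2) x by simp
    moreover have "inner ?y ?y = inner x x"
      using gram_eq_rcomb[OF gram] f(2)[OF x x] c by metis
    ultimately have "inner (x - ?y) (x - ?y) = 0"
      by (simp add: inner_diff_left inner_diff_right inner_commute[of x ?y])
    then have "x = ?y" by simp
    then show ?thesis unfolding mem_int_span by (rule exI[where x = c])
  qed
  ultimately have "lattice_basis L bs" using indep by (auto simp: lattice_basis_alt)
  with gram that show ?thesis by blast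
qed

text \<open>Integral products with \<open>bs\<close> make the coordinates of \<open>x\<close>
  integers over 3, because the inverse Gram matrix is \<open>K8_dual\<close> over 3. The numerators
  form a vector of \<open>E8\<close>, whose reduction modulo 3 E8 has norm at most 8; the way back
  divides by 9 and multiplies by 3.\<close>

lemma K8_covering:
  fixes bs :: "'a::euclidean_space list"
  assumes gram: "gram bs = K8_gram" and x: "x \<in> span (set bs)"
    and int: "\<And>i. i < length bs \<Longrightarrow> inner (bs ! i) x \<in> \<int>"
  obtains y where "y \<in> int_span bs" "inner (x - y) (x - y) \<le> 8/3"
proof -
  have gr: "gram bs = gram sqrt3_E8_basis" using gram gram_sqrt3_E8_basis by simp
  then have len: "length bs = 8"
    using gram_eq_length by (fastforce simp: sqrt3_E8_basis_def length_E8_basis)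
  have dual: "(\<Sum>j<8. of_int (K8_dual ! i ! j) * inner (bs ! j) (bs ! k)) = (if i = k then 3 else 0)"
    if "i < 8" "k < 8" for i k
  proof -
    have "inner (bs ! j) (bs ! k) = of_int (K10_rows ! j ! k)" if "j < 8" for j
    proof -
      have "gram bs $$ (j, k) = of_int (K10_rows ! j ! k)"
        unfolding gram using that \<open>k < 8\<close> by (simp add: K8_gram_def K10_gram_index)
      then show ?thesis using that \<open>k < 8\<close> len by (simp add: gram_def)
    qed
    then show ?thesis using K8_dual_gram[OF that] by simp
  qed
  define c where "c i = (\<Sum>j<8. K8_dual ! i ! j * \<lfloor>inner (bs ! j) x\<rfloor>)" for i
  have fl: "of_int \<lfloor>inner (bs ! j) x\<rfloor> = inner (bs ! j) x" if "j < 8" for j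
  proof -
    have "inner (bs ! j) x \<in> \<int>" using int len that by simp
    then show ?thesis by (elim Ints_cases) simp
  qed
  have "x = rcomb (\<lambda>i. (\<Sum>j<8. of_int (K8_dual ! i ! j) * inner (bs ! j) x) / 3) bs"
    by (rule dual_expand(2)[OF len _ dual x]) simp_all
  also have "\<dots> = rcomb (\<lambda>i. of_int (c i) / 3) bs"
    by (intro rcomb_cong) (simp add: c_def fl)
  finally have x_eq: "x = rcomb (\<lambda>i. of_int (c i) / 3) bs" .
  have E8_eq: "E8 = int_span E8_basis" using E8_basis by (simp add: lattice_basis_alt)
  have "rcomb (\<lambda>i. of_int (c i)) E8_basis \<in> E8"
    unfolding E8_eq mem_int_span by (rule exI, rule refl)
  then obtain z where z: "z \<in> E8"
    "inner (rcomb (\<lambda>i. of_int (c i)) E8_basis - 3 *\<^sub>R z) (rcomb (\<lambda>i. of_int (c i)) E8_basis - 3 *\<^sub>R z) \<le> 8"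
    by (rule E8_covering)
  obtain d :: "nat \<Rightarrow> int" where d: "z = rcomb (\<lambda>i. of_int (d i)) E8_basis"
    using z(1) unfolding E8_eq mem_int_span by blast
  let ?y = "rcomb (\<lambda>i. of_int (d i)) bs" and ?e = "\<lambda>i. of_int (c i) - 3 * of_int (d i) :: real"
  have "x - ?y = (1/3) *\<^sub>R rcomb ?e bs"
    unfolding x_eq rcomb_diff rcomb_scale by (intro rcomb_cong) (simp add: diff_divide_distrib)
  then have "inner (x - ?y) (x - ?y) = (1/9) * inner (rcomb ?e bs) (rcomb ?e bs)"
    by simp
  also have "\<dots> = (1/9) * (3 * inner (rcomb ?e E8_basis) (rcomb ?e E8_basis))"
    unfolding gram_eq_rcomb[OF gr] sqrt3_E8_basis_def rcomb_map_scale by simp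
  also have "rcomb ?e E8_basis = rcomb (\<lambda>i. of_int (c i)) E8_basis - 3 *\<^sub>R z"
    unfolding d rcomb_scale rcomb_diff ..
  finally have "inner (x - ?y) (x - ?y) \<le> 8/3" using z(2) by simp
  moreover have "?y \<in> int_span bs" unfolding mem_int_span by (rule exI, rule refl)
  ultimately show ?thesis using that by blast
qed

text \<open>Gaussian elimination without fractions: \<open>elim_lower * K10_rows = elim_upper\<close>.\<close>

definition elim_lower :: "int list list" where
  "elim_lower =
    [[1, 0, 0, 0, 0, 0, 0, 0, 0, 0], [1, 2, 0, 0, 0, 0, 0, 0, 0, 0], [1, -1, 3, 0, 0, 0, 0, 0, 0, 0],
     [1, -1, 1, 2, 0, 0, 0, 0, 0, 0], [0, 0, -1, -1, 2, 0, 0, 0, 0, 0], [2, -2, 3, 1, -2, 4, 0, 0, 0, 0],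
     [2, -2, 3, 1, -2, 1, 3, 0, 0, 0], [-2, 0, -1, -1, 2, -1, -1, 2, 0, 0],
     [1, 1, -2, 1, 0, 0, -1, -1, 3, 0], [-3, 3, -4, -5, 2, 0, 1, -1, -3, 6]]"

definition elim_upper :: "int list list" where
  "elim_upper =
    [[6, -3, -3, -3, -3, -3, -3, 3, -2, 1], [0, 9, 3, 3, 3, 3, 3, 3, 0, -1],
     [0, 0, 12, -6, 3, -6, -6, -6, 6, 5], [0, 0, 0, 6, 3, 0, 0, 0, -2, 3],
     [0, 0, 0, 0, 6, 3, 3, -3, 0, -3], [0, 0, 0, 0, 0, 9, -3, 3, 0, 1],
     [0, 0, 0, 0, 0, 0, 6, 3, 3, 1], [0, 0, 0, 0, 0, 0, 0, 3, 1, 1],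
     [0, 0, 0, 0, 0, 0, 0, 0, 10, 5], [0, 0, 0, 0, 0, 0, 0, 0, 0, 15]]"

definition leading_gram :: "nat \<Rightarrow> real mat" where
  "leading_gram n = Matrix.mat n n (\<lambda>(i, j). K10_gram $$ (i, j))"

lemma leading_gram_8: "leading_gram 8 = K8_gram"
  and leading_gram_9: "leading_gram 9 = K9_gram"
  by (simp_all add: leading_gram_def K8_gram_def K9_gram_def)

lemma leading_gram_10: "leading_gram 10 = K10_gram"
proof (rule eq_matI)
  have "dim_row K10_gram = 10" "dim_col K10_gram = 10"
    by (simp_all add: K10_gram_def mat_of_rows_list_def)
  then show "dim_row (leading_gram 10) = dim_row K10_gram" "dim_col (leading_gram 10) = dim_col K10_gram"
    "\<And>i j. i < dim_row K10_gram \<Longrightarrow> j < dim_col K10_gram \<Longrightarrow> leading_gram 10 $$ (i, j) = K10_gram $$ (i, j)"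
    by (simp_all add: leading_gram_def)
qed

lemma elim_check:
  "\<forall>n\<in>{8, 9, 10}. \<forall>i\<in>set [0..<n]. \<forall>j\<in>set [0..<n].
    sum_list (map (\<lambda>k. elim_lower ! i ! k * K10_rows ! k ! j) [0..<n]) = elim_upper ! i ! j"
  "\<forall>i\<in>set [0..<10]. \<forall>j\<in>set [0..<i]. elim_lower ! j ! i = 0 \<and> elim_upper ! i ! j = 0"
  by code_simp+

lemma det_int_triangular:
  "(\<And>i j. i < j \<Longrightarrow> j < n \<Longrightarrow> A ! i ! j = 0) \<Longrightarrow>
    Determinant.det (Matrix.mat n n (\<lambda>(i, j). real_of_int (A ! i ! j))) = of_int (\<Prod>i<n. A ! i ! i)"
  "(\<And>i j. j < i \<Longrightarrow> i < n \<Longrightarrow> A ! i ! j = 0) \<Longrightarrow>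
    Determinant.det (Matrix.mat n n (\<lambda>(i, j). real_of_int (A ! i ! j))) = of_int (\<Prod>i<n. A ! i ! i)"
proof -
  let ?M = "Matrix.mat n n (\<lambda>(i, j). real_of_int (A ! i ! j))"
  have diag: "prod_list (diag_mat ?M) = of_int (\<Prod>i<n. A ! i ! i)"
  proof -
    have "diag_mat ?M = map (\<lambda>i. real_of_int (A ! i ! i)) [0..<n]"
      by (simp add: diag_mat_def)
    then show ?thesis
      by (simp add: lessThan_atLeast0 prod.distinct_set_conv_list[symmetric])
  qed
  {
    assume "\<And>i j. i < j \<Longrightarrow> j < n \<Longrightarrow> A ! i ! j = 0"
    then have "Determinant.det ?M = prod_list (diag_mat ?M)"
      by (intro Determinant.det_lower_triangular[where n = n]) auto
    with diag show "Determinant.det ?M = of_int (\<Prod>i<n. A ! i ! i)" by simp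
  }
  {
    assume "\<And>i j. j < i \<Longrightarrow> i < n \<Longrightarrow> A ! i ! j = 0"
    then have "Determinant.det ?M = prod_list (diag_mat ?M)"
      by (intro Determinant.det_upper_triangular[where n = n]) (auto simp: upper_triangular_def)
    with diag show "Determinant.det ?M = of_int (\<Prod>i<n. A ! i ! i)" by simp
  }
qed

text \<open>As \<open>elim_lower\<close> is lower triangular, its leading blocks eliminate the
  leading blocks of the matrix, and one table serves all three determinants.\<close>

lemma det_leading_gram_eq:
  assumes "n \<in> {8, 9, 10}"
  shows "of_int (\<Prod>i<n. elim_lower ! i ! i) * Determinant.det (leading_gram n) = of_int (\<Prod>i<n. elim_upper ! i ! i)"
proof -
  let ?M = "\<lambda>A. Matrix.mat n n (\<lambda>(i, j). real_of_int (A ! i ! j))"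
  have n: "n \<le> 10" using assms by auto
  have "?M elim_lower * leading_gram n = ?M elim_upper"
  proof (rule eq_matI)
    fix i j assume "i < dim_row (?M elim_upper)" "j < dim_col (?M elim_upper)"
    then have ij: "i < n" "j < n" by auto
    have "(\<Sum>k<n. elim_lower ! i ! k * K10_rows ! k ! j) = elim_upper ! i ! j"
      using elim_check(1) assms ij unfolding sum_lessThan_list by auto
    then have "(\<Sum>k<n. real_of_int (elim_lower ! i ! k) * real_of_int (K10_rows ! k ! j)) = real_of_int (elim_upper ! i ! j)"
      by (simp flip: of_int_mult of_int_sum)
    then show "(?M elim_lower * leading_gram n) $$ (i, j) = ?M elim_upper $$ (i, j)"
      using ij n by (simp add: leading_gram_def K10_gram_index scalar_prod_def lessThan_atLeast0)
  qed (simp_all add: leading_gram_def)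
  moreover have "?M elim_lower \<in> carrier_mat n n" "leading_gram n \<in> carrier_mat n n"
    by (simp_all add: leading_gram_def)
  ultimately have "Determinant.det (?M elim_lower) * Determinant.det (leading_gram n) = Determinant.det (?M elim_upper)"
    using Determinant.det_mult by metis
  moreover have "Determinant.det (?M elim_lower) = of_int (\<Prod>i<n. elim_lower ! i ! i)"
    using elim_check(2) n by (intro det_int_triangular(1)) auto
  moreover have "Determinant.det (?M elim_upper) = of_int (\<Prod>i<n. elim_upper ! i ! i)"
    using elim_check(2) n by (intro det_int_triangular(2)) auto
  ultimately show ?thesis by simp
qed

lemma det_K8_gram: "Determinant.det K8_gram = 6561"
  and det_K9_gram: "Determinant.det K9_gram = 21870"
  and det_K10_gram: "Determinant.det K10_gram = 54675"
proof -
  have "(\<Prod>i<8. elim_lower ! i ! i) = 576" "(\<Prod>i<9. elim_lower ! i ! i) = 1728"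
    "(\<Prod>i<10. elim_lower ! i ! i) = 10368" "(\<Prod>i<8. elim_upper ! i ! i) = 3779136"
    "(\<Prod>i<9. elim_upper ! i ! i) = 37791360" "(\<Prod>i<10. elim_upper ! i ! i) = 566870400"
    by (simp_all add: elim_lower_def elim_upper_def numeral_eq_Suc lessThan_Suc)
  then show "Determinant.det K8_gram = 6561" "Determinant.det K9_gram = 21870"
    "Determinant.det K10_gram = 54675"
    using det_leading_gram_eq[of 8] det_leading_gram_eq[of 9] det_leading_gram_eq[of 10]
    by (simp_all only: leading_gram_8 leading_gram_9 leading_gram_10) simp_all
qed

section \<open>Two vectors appended to a basis, and the hexagonal lattice\<close>

lemma length_of_gram: "dim_row (gram bs) = length bs"
  by (simp add: gram_def)

lemma indep_list_dim:
  assumes "dim (int_span cs) = length cs"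
  shows "indep_list cs"
proof -
  have "dim (set cs) = length cs" using assms dim_span span_int_span by metis
  moreover have "dim (set cs) \<le> card (set cs)" by (rule dim_le_card') auto
  ultimately have card: "card (set cs) = length cs" using card_length[of cs] by simp
  then have "independent (set cs)"
    using \<open>dim (set cs) = length cs\<close>
    using card_le_dim_spanning[OF subset_refl span_superset finite_set, of cs] by simp
  with card show ?thesis by (simp add: indep_list_def card_distinct)
qed

lemma int_span_pair:
  "x \<in> int_span (bs @ [v, w]) \<longleftrightarrow> (\<exists>y\<in>int_span bs. \<exists>m n::int. x = y + of_int m *\<^sub>R v + of_int n *\<^sub>R w)"
proof -
  have "x \<in> int_span ((bs @ [v]) @ [w]) \<longleftrightarrow> (\<exists>z\<in>int_span (bs @ [v]). \<exists>n::int. x = z + of_int n *\<^sub>R w)"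
    by (rule int_span_snoc)
  also have "\<dots> \<longleftrightarrow> (\<exists>z. (\<exists>y\<in>int_span bs. \<exists>m::int. z = y + of_int m *\<^sub>R v) \<and> (\<exists>n::int. x = z + of_int n *\<^sub>R w))"
    unfolding Bex_def[of "int_span (bs @ [v])"] int_span_snoc ..
  also have "\<dots> \<longleftrightarrow> (\<exists>y\<in>int_span bs. \<exists>m n::int. x = y + of_int m *\<^sub>R v + of_int n *\<^sub>R w)"
    by auto
  finally show ?thesis by simp
qed

text \<open>The elementary moves of Lagrange-Gauss reduction for binary forms, carried out in
  \<open>hexagonal_basis\<close>.\<close>

lemma int_span_pair_shear:
  "int_span (bs @ [v, w + of_int e *\<^sub>R v]) = int_span (bs @ [v, w])"
  "int_span (bs @ [v + of_int e *\<^sub>R w, w]) = int_span (bs @ [v, w])"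
proof -
  have 1: "int_span (bs @ [v, w + of_int e *\<^sub>R v]) \<subseteq> int_span (bs @ [v, w])" for v w :: 'a and e
  proof
    fix x assume "x \<in> int_span (bs @ [v, w + of_int e *\<^sub>R v])"
    then obtain y m n where y: "y \<in> int_span bs" "x = y + of_int m *\<^sub>R v + of_int n *\<^sub>R (w + of_int e *\<^sub>R v)"
      unfolding int_span_pair by blast
    then have "x = y + of_int (m + n * e) *\<^sub>R v + of_int n *\<^sub>R w"
      by (simp add: algebra_simps)
    with y(1) show "x \<in> int_span (bs @ [v, w])" unfolding int_span_pair by blast
  qed
  have 2: "int_span (bs @ [v, w + of_int e *\<^sub>R v]) = int_span (bs @ [v, w])" for v w :: 'a and e
    using 1[of v w e] 1[of v "w + of_int e *\<^sub>R v" "- e"] by auto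
  have swap: "int_span (bs @ [v, w]) = int_span (bs @ [w, v])" for v w :: 'a
  proof -
    have "int_span (bs @ [v, w]) \<subseteq> int_span (bs @ [w, v])" for v w :: 'a
    proof
      fix x assume "x \<in> int_span (bs @ [v, w])"
      then obtain y m n where y: "y \<in> int_span bs" "x = y + of_int m *\<^sub>R v + of_int n *\<^sub>R w"
        unfolding int_span_pair by blast
      then have "x = y + of_int n *\<^sub>R w + of_int m *\<^sub>R v" by simp
      with y(1) show "x \<in> int_span (bs @ [w, v])" unfolding int_span_pair by blast
    qed
    then show ?thesis by blast
  qed
  show "int_span (bs @ [v, w + of_int e *\<^sub>R v]) = int_span (bs @ [v, w])" by (rule 2)
  show "int_span (bs @ [v + of_int e *\<^sub>R w, w]) = int_span (bs @ [v, w])"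
    using 2[of w v e] swap by blast
qed

text \<open>The covering radius of the hexagonal lattice: the nearest vertex of a lattice triangle containing
  the point is the one with the largest barycentric coordinate.\<close>

lemma hexagonal_covering:
  fixes s t \<epsilon> :: real
  assumes "\<epsilon> \<in> {-1, 1}"
  obtains i j :: int where
    "(s - of_int i)\<^sup>2 + \<epsilon> * (s - of_int i) * (t - of_int j) + (t - of_int j)\<^sup>2 \<le> 1/3"
proof -
  define Q :: "real \<Rightarrow> real \<Rightarrow> real" where "Q x y = x\<^sup>2 + x * y + y\<^sup>2" for x y
  have largest: "Q x y \<le> 1/3" if "0 \<le> x" "0 \<le> y" "x \<le> 1 - x - y" "y \<le> 1 - x - y" for x y
  proof -
    have "x * (2 * x + y) \<le> x * 1" "y * (x + 2 * y) \<le> y * 1"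
      using that by (intro mult_left_mono; simp)+
    moreover have "2 * Q x y = x * (2 * x + y) + y * (x + 2 * y)"
      by (simp add: Q_def power2_eq_square algebra_simps)
    ultimately show ?thesis using that by simp
  qed
  \<comment> \<open>Moving the origin to another vertex of the triangle permutes the barycentric
    coordinates \<open>1 - x - y\<close>, \<open>x\<close>, \<open>y\<close>, and \<open>Q\<close>
    is unchanged by this.\<close>
  have vertex: "Q (x - 1) y = Q (1 - x - y) y" "Q x (y - 1) = Q x (1 - x - y)" for x y
    by (simp_all add: Q_def power2_eq_square algebra_simps)
  have tri: "Q x y \<le> 1/3 \<or> Q (x - 1) y \<le> 1/3 \<or> Q x (y - 1) \<le> 1/3"
    if "0 \<le> x" "0 \<le> y" "x + y \<le> 1" for x y
    using largest[of x y] largest[of "1 - x - y" y] largest[of x "1 - x - y"] that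
    unfolding vertex by linarith
  have Q_ex: "\<exists>i j :: int. Q (x - of_int i) (y - of_int j) \<le> 1/3" for x y
  proof (cases "frac x + frac y \<le> 1")
    case True
    have "frac x = x - of_int \<lfloor>x\<rfloor>" "frac x - 1 = x - of_int (\<lfloor>x\<rfloor> + 1)"
      "frac y = y - of_int \<lfloor>y\<rfloor>" "frac y - 1 = y - of_int (\<lfloor>y\<rfloor> + 1)"
      by (simp_all add: frac_def)
    then show ?thesis
      using tri[OF frac_ge_0 frac_ge_0 True] by metis
  next
    case False
    \<comment> \<open>The upper half of the unit cell is carried to the lower one by the point
      reflection in the centre of the cell.\<close>
    have neg: "Q a b = Q (- a) (- b)" for a b by (simp add: Q_def)
    have "- (1 - frac x) = x - of_int (\<lfloor>x\<rfloor> + 1)" "- (1 - frac x - 1) = x - of_int \<lfloor>x\<rfloor>"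
      "- (1 - frac y) = y - of_int (\<lfloor>y\<rfloor> + 1)" "- (1 - frac y - 1) = y - of_int \<lfloor>y\<rfloor>"
      by (simp_all add: frac_def)
    moreover have "0 \<le> 1 - frac x" "0 \<le> 1 - frac y" "(1 - frac x) + (1 - frac y) \<le> 1"
      using False frac_lt_1[of x] frac_lt_1[of y] by linarith+
    from tri[OF this] have "Q (- (1 - frac x)) (- (1 - frac y)) \<le> 1/3 \<or>
        Q (- (1 - frac x - 1)) (- (1 - frac y)) \<le> 1/3 \<or> Q (- (1 - frac x)) (- (1 - frac y - 1)) \<le> 1/3"
      using neg[of "1 - frac x" "1 - frac y"] neg[of "1 - frac x - 1" "1 - frac y"] neg[of "1 - frac x" "1 - frac y - 1"]
      by simp
    ultimately show ?thesis by metis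
  qed
  show ?thesis
  proof (cases "\<epsilon> = 1")
    case True
    obtain i j :: int where "Q (s - of_int i) (t - of_int j) \<le> 1/3" using Q_ex by blast
    then show ?thesis using True by (intro that[of i j]) (simp add: Q_def)
  next
    case False
    then have e: "\<epsilon> = -1" using assms by simp
    obtain i j :: int where "Q (s - of_int i) (- t - of_int j) \<le> 1/3" using Q_ex by blast
    then show ?thesis using e by (intro that[of i "- j"]) (simp add: Q_def power2_eq_square algebra_simps)
  qed
qed

section \<open>Determinants of sections containing K8\<close>

lemma inner_three:
  fixes u v w :: "'a::real_inner"
  shows "inner (u + x *\<^sub>R v + y *\<^sub>R w) (u + x *\<^sub>R v + y *\<^sub>R w) =
    inner u u + 2 * x * inner u v + 2 * y * inner u w + x\<^sup>2 * inner v v + 2 * x * y * inner v w + y\<^sup>2 * inner w w"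
  by (simp add: inner_add_left inner_add_right inner_commute[of v u] inner_commute[of w u]
      inner_commute[of w v] power2_eq_square algebra_simps)

locale extremal_K8 = integral_group L for L :: "'a::euclidean_space set" +
  fixes bs :: "'a list"
  assumes min: "x \<in> L \<Longrightarrow> x \<noteq> 0 \<Longrightarrow> 6 \<le> inner x x"
    and gram_bs: "gram bs = K8_gram"
    and bs_subset: "set bs \<subseteq> L"
begin

abbreviation \<pi> :: "'a \<Rightarrow> 'a" where "\<pi> \<equiv> perp (set bs)"

lemma length_bs: "length bs = 8"
  using length_of_gram[of bs] by (simp add: gram_bs K8_gram_def)

lemma indep_bs: "indep_list bs"
  using gram_eq_indep[of bs sqrt3_E8_basis] sqrt3_E8_basis gram_bs gram_sqrt3_E8_basis
  by (simp add: lattice_basis_alt)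

lemma det_bs: "Determinant.det (gram bs) = 6561"
  by (simp add: gram_bs det_K8_gram)

lemma projected_min:
  assumes "v \<in> L" "v \<notin> int_span bs"
  shows "10/3 \<le> inner (\<pi> v) (\<pi> v)"
proof -
  let ?p = "v - \<pi> v"
  \<comment> \<open>\<open>\<pi> v\<close> is orthogonal to \<open>bs\<close>, so \<open>?p\<close>
    inherits the integral products of \<open>v\<close> and lies in the dual of K8.\<close>
  have "inner (bs ! i) ?p \<in> \<int>" if i: "i < length bs" for i
  proof -
    have "inner (\<pi> v) (bs ! i) = 0" using i by (intro inner_perp) (simp add: span_base)
    then have "inner (bs ! i) ?p = inner (bs ! i) v"
      by (simp add: inner_diff_right inner_commute)
    also have "\<dots> \<in> \<int>" using i bs_subset assms(1) by (intro integral) auto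
    finally show ?thesis .
  qed
  then obtain y where y: "y \<in> int_span bs" "inner (?p - y) (?p - y) \<le> 8/3"
    using K8_covering[OF gram_bs diff_perp_in_span[of v "set bs"]] by blast
  have "v - y \<in> L" "v - y \<noteq> 0"
    using y(1) assms int_span_subset[OF bs_subset] by (auto intro: diff_mem)
  then have "6 \<le> inner (v - y) (v - y)" by (rule min)
  also have "\<pi> (v - y) = \<pi> v"
    by (simp add: perp_diff perp_span[OF subsetD[OF int_span_subset_span y(1)]])
  then have "inner (v - y) (v - y) = inner (?p - y) (?p - y) + inner (\<pi> v) (\<pi> v)"
    using norm_decomp[of "v - y" "set bs"] by (simp add: algebra_simps)
  finally show ?thesis using y(2) by simp
qed

text \<open>A lattice vector in the span projects to 0, which \<open>projected_min\<close> allows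
  only for integral combinations of \<open>bs\<close>.\<close>

lemma primitive_bs: "primitive L bs"
  unfolding primitive_def
proof (intro conjI indep_bs equalityI)
  show "int_span bs \<subseteq> L \<inter> span (set bs)"
    using int_span_subset[OF bs_subset] int_span_subset_span by blast
  show "L \<inter> span (set bs) \<subseteq> int_span bs"
  proof
    fix v assume "v \<in> L \<inter> span (set bs)"
    then show "v \<in> int_span bs"
      using projected_min[of v] by (cases "v \<in> int_span bs") (auto simp: perp_span)
  qed
qed

lemma det_snoc: "Determinant.det (gram (bs @ [w])) = 6561 * inner (\<pi> w) (\<pi> w)"
  using det_gram_snoc[OF indep_bs, of w] by (simp add: det_bs)

lemma not_in_int_span: "v \<notin> span (set bs) \<Longrightarrow> v \<notin> int_span bs"
  using int_span_subset_span by blast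

theorem det_rank_9:
  assumes "w \<in> L" "w \<notin> span (set bs)"
  shows "21870 \<le> Determinant.det (gram (bs @ [w]))"
  using projected_min[OF assms(1) not_in_int_span[OF assms(2)]] by (simp add: det_snoc)

text \<open>Rounding the coefficient \<open>s\<close> leaves at most a quarter of the norm 10/3
  along \<open>u\<close>, so the part orthogonal to K9 has norm at least 5/2, and 21870 * 5/2 =
  54675.\<close>

theorem det_rank_10:
  assumes w: "w \<in> L" "w \<notin> span (set bs)" "Determinant.det (gram (bs @ [w])) = 21870"
    and v: "v \<in> L" "v \<notin> span (set (bs @ [w]))"
  shows "54675 \<le> Determinant.det (gram ((bs @ [w]) @ [v]))"
proof -
  let ?T = "set (bs @ [w])"
  have T: "?T = insert w (set bs)" by auto
  define u where "u = \<pi> w"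
  have u: "inner u u = 10/3" using w(3) by (simp add: det_snoc u_def)
  define o' where "o' = perp ?T v"
  have u_T: "u \<in> span ?T"
    using span_diff[OF span_base[of w ?T], of "w - u"] diff_perp_in_span[of w "set bs"]
      span_mono[of "set bs" ?T] by (auto simp: u_def)
  have "v - o' \<in> span (insert w (set bs))"
    using diff_perp_in_span[of v ?T] by (simp add: T o'_def)
  then obtain s where s: "v - o' - s *\<^sub>R w \<in> span (set bs)"
    unfolding span_breakdown_eq by blast
  have "\<pi> o' = o'"
    unfolding o'_def using span_mono[of "set bs" ?T]
    by (intro perp_eqI) (auto intro: inner_perp simp: span_zero)
  moreover have "\<pi> (v - o' - s *\<^sub>R w) = 0" using s by (rule perp_span)
  ultimately have \<pi>v: "\<pi> v = o' + s *\<^sub>R u"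
    by (simp add: perp_add perp_diff perp_scale u_def algebra_simps)
  define j where "j = round s"
  have "v - of_int j *\<^sub>R w \<notin> span (set bs)"
  proof
    assume "v - of_int j *\<^sub>R w \<in> span (set bs)"
    then have "v \<in> span (insert w (set bs))" unfolding span_breakdown_eq by (rule exI)
    then show False using v(2) T by simp
  qed
  then have "10/3 \<le> inner (\<pi> (v - of_int j *\<^sub>R w)) (\<pi> (v - of_int j *\<^sub>R w))"
    using projected_min[OF diff_mem[OF v(1) scale_mem[OF w(1)]]] not_in_int_span by blast
  also have "\<pi> (v - of_int j *\<^sub>R w) = o' + (s - of_int j) *\<^sub>R u"
    by (simp add: perp_diff perp_scale \<pi>v u_def algebra_simps)
  also have "inner (o' + (s - of_int j) *\<^sub>R u) (o' + (s - of_int j) *\<^sub>R u) = inner o' o' + (s - of_int j)\<^sup>2 * (10/3)"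
    using inner_three[of o' "s - of_int j" u 0 0] inner_perp[OF u_T, of v] by (simp add: o'_def u)
  also have "(s - of_int j)\<^sup>2 \<le> (1/2)\<^sup>2"
    using of_int_round_abs_le[of s] by (intro abs_le_square_iff[THEN iffD1]) (simp add: j_def abs_minus_commute)
  finally have "5/2 \<le> inner o' o'" by (simp add: power2_eq_square)
  moreover have "indep_list (bs @ [w])" using indep_bs w(2) by (simp add: indep_list_snoc)
  ultimately show ?thesis
    using det_gram_snoc[of "bs @ [w]" v] w(3) by (simp add: o'_def)
qed

text \<open>Among the bases extending \<open>bs\<close>, one minimizing the sum of the squared norms of the projections
  of the two new vectors is reduced. The determinant then forces the projections to span a hexagonal
  lattice.\<close>

lemma hexagonal_basis:
  assumes "primitive L (bs @ [w1, w2])" "Determinant.det (gram (bs @ [w1, w2])) = 54675"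
  obtains v1 v2 \<epsilon> where "v1 \<in> L" "v2 \<in> L" "span (set (bs @ [v1, v2])) = span (set (bs @ [w1, w2]))"
    "inner (\<pi> v1) (\<pi> v1) = 10/3" "inner (\<pi> v2) (\<pi> v2) = 10/3" "\<epsilon> \<in> {-1, 1}"
    "inner (\<pi> v1) (\<pi> v2) = \<epsilon> * (5/3)"
proof -
  define P where "P = (\<lambda>(v1, v2). int_span (bs @ [v1, v2]) = int_span (bs @ [w1, w2]))"
  define N where "N v = inner (\<pi> v) (\<pi> v)" for v
  \<comment> \<open>The factor 6561 turns the norms of the projections into Gram determinants of
    integral vectors, hence into integers, so that a minimum exists.\<close>
  define \<mu> where "\<mu> = (\<lambda>(v1, v2). nat \<lfloor>6561 * (N v1 + N v2)\<rfloor>)"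
  have ws: "indep_list (bs @ [w1, w2])" "int_span (bs @ [w1, w2]) \<subseteq> L"
    using assms(1) by (auto simp: primitive_def)
  have P_mem: "v1 \<in> L" "v2 \<in> L" if "P (v1, v2)" for v1 v2
    using that int_span_nth[of 8 "bs @ [v1, v2]"] int_span_nth[of 9 "bs @ [v1, v2]"] ws(2)
    by (auto simp: P_def nth_append length_bs)
  have P_indep: "indep_list (bs @ [v1, v2])" if "P (v1, v2)" for v1 v2
    using that dim_int_span[OF ws(1)] by (intro indep_list_dim) (simp add: P_def)
  have N_int: "6561 * N v \<in> \<int>" if "v \<in> L" for v
  proof -
    have "set (bs @ [v]) \<subseteq> L" using bs_subset that by auto
    then have "Determinant.det (gram (bs @ [v])) \<in> \<int>"
      by (intro det_gram_Ints integral; meson nth_mem subsetD)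
    then show ?thesis by (simp add: det_snoc N_def)
  qed
  have \<mu>: "real (\<mu> (v1, v2)) = 6561 * (N v1 + N v2)" if "P (v1, v2)" for v1 v2
  proof -
    have "6561 * (N v1 + N v2) \<in> \<int>"
      using Ints_add[OF N_int[OF P_mem(1)[OF that]] N_int[OF P_mem(2)[OF that]]]
      by (simp add: distrib_left)
    then obtain k where k: "6561 * (N v1 + N v2) = of_int k" by (rule Ints_cases)
    moreover have "0 \<le> 6561 * (N v1 + N v2)" by (simp add: N_def)
    ultimately have "0 \<le> k" by simp
    then show ?thesis unfolding \<mu>_def by (simp only: prod.case k floor_of_int of_nat_nat)
  qed
  have "P (w1, w2)" by (simp add: P_def)
  then obtain x where "P x" "\<And>y. P y \<Longrightarrow> \<mu> x \<le> \<mu> y"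
    using ex_has_least_nat[of P "(w1, w2)" \<mu>] by blast
  then obtain v1 v2 where v: "P (v1, v2)" "\<And>x. P x \<Longrightarrow> \<mu> (v1, v2) \<le> \<mu> x"
    by (cases x) blast
  have least: "N v1 + N v2 \<le> N x1 + N x2" if "P (x1, x2)" for x1 x2
  proof -
    have "real (\<mu> (v1, v2)) \<le> real (\<mu> (x1, x2))" using v(2)[OF that] by simp
    then show ?thesis using \<mu>[OF v(1)] \<mu>[OF that] by simp
  qed
  define a b c where "a = N v1" and "b = inner (\<pi> v1) (\<pi> v2)" and "c = N v2"
  have shear: "N (v + of_int e *\<^sub>R w) = N v + 2 * of_int e * inner (\<pi> v) (\<pi> w) + (of_int e)\<^sup>2 * N w" for v w e
    by (simp add: N_def perp_add perp_scale inner_add_left inner_add_right inner_commute[of "\<pi> w" "\<pi> v"]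
        power2_eq_square algebra_simps)
  have "P (v1, v2 + of_int e *\<^sub>R v1)" "P (v1 + of_int e *\<^sub>R v2, v2)" for e
    using v(1) by (simp_all only: P_def prod.case int_span_pair_shear)
  from least[OF this(1)] least[OF this(2)]
  have "0 \<le> 2 * of_int e * b + (of_int e)\<^sup>2 * a" "0 \<le> 2 * of_int e * b + (of_int e)\<^sup>2 * c" for e
    by (simp_all add: shear a_def b_def c_def inner_commute[of "\<pi> v2" "\<pi> v1"])
  \<comment> \<open>The shears by 1 and -1 do not lower the sum, which is the reducedness of the
    binary form.\<close>
  from this[of 1] this[of "-1"] have b: "2 * \<bar>b\<bar> \<le> a" "2 * \<bar>b\<bar> \<le> c" by auto
  have "indep_list ((bs @ [v1]) @ [v2])" using P_indep[OF v(1)] by simp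
  then have indep1: "indep_list (bs @ [v1])" and v2: "v2 \<notin> span (set (bs @ [v1]))"
    unfolding indep_list_snoc[of "bs @ [v1]"] by auto
  have v1: "v1 \<notin> span (set bs)" using indep1 by (simp add: indep_list_snoc)
  have v2': "v2 \<notin> span (set bs)" using v2 span_mono[of "set bs" "set (bs @ [v1])"] by auto
  have ac: "10/3 \<le> a" "10/3 \<le> c"
    using projected_min P_mem[OF v(1)] not_in_int_span v1 v2' by (auto simp: a_def c_def N_def)
  have span: "span (set (bs @ [v1, v2])) = span (set (bs @ [w1, w2]))"
    using v(1) span_int_span[of "bs @ [v1, v2]"] span_int_span[of "bs @ [w1, w2]"] by (simp add: P_def)
  \<comment> \<open>25/3 is 54675 / 6561, the determinant of the projected lattice of rank
    two.\<close>
  have det: "a * c - b\<^sup>2 = 25/3"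
  proof -
    have "perp (set (bs @ [v1])) v2 = \<pi> v2 - (b / a) *\<^sub>R \<pi> v1"
    proof (rule perp_eqI)
      have S: "span (set bs) \<subseteq> span (set (bs @ [v1]))" by (intro span_mono) auto
      have d: "v - \<pi> v \<in> span (set (bs @ [v1]))" for v
        by (rule subsetD[OF S diff_perp_in_span])
      have v1_in: "v1 \<in> span (set (bs @ [v1]))" by (simp add: span_base)
      have "(v2 - \<pi> v2) + (b / a) *\<^sub>R (v1 - (v1 - \<pi> v1)) \<in> span (set (bs @ [v1]))"
        by (rule span_add[OF d span_scale[OF span_diff[OF v1_in d]]])
      then show "v2 - (\<pi> v2 - (b / a) *\<^sub>R \<pi> v1) \<in> span (set (bs @ [v1]))"
        by (simp add: algebra_simps)
      fix w assume "w \<in> span (set (bs @ [v1]))"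
      then obtain t where t: "w - t *\<^sub>R v1 \<in> span (set bs)"
        using span_breakdown_eq[of w v1 "set bs"] by auto
      have "inner (\<pi> v) w = t * inner (\<pi> v) (\<pi> v1)" for v
      proof -
        have "inner (\<pi> v) w = inner (\<pi> v) (w - t *\<^sub>R v1) + t * (inner (\<pi> v) (v1 - \<pi> v1) + inner (\<pi> v) (\<pi> v1))"
          by (simp add: inner_diff_right algebra_simps)
        then show ?thesis
          using inner_perp[OF t, of v] inner_perp[OF diff_perp_in_span[of v1 "set bs"], of v] by simp
      qed
      then have "inner (\<pi> v2) w = t * b" "inner (\<pi> v1) w = t * a"
        by (simp_all add: a_def b_def N_def inner_commute[of "\<pi> v2" "\<pi> v1"])
      then show "inner (\<pi> v2 - (b / a) *\<^sub>R \<pi> v1) w = 0"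
        using ac by (simp add: inner_diff_left)
    qed
    then have "inner (perp (set (bs @ [v1])) v2) (perp (set (bs @ [v1])) v2) = c - b\<^sup>2 / a"
      using ac by (simp add: inner_diff_left inner_diff_right a_def[symmetric] N_def[symmetric] b_def[symmetric]
          c_def[symmetric] inner_commute[of "\<pi> v2" "\<pi> v1"] power2_eq_square)
    then have "Determinant.det (gram ((bs @ [v1]) @ [v2])) = 6561 * a * (c - b\<^sup>2 / a)"
      using det_gram_snoc[OF indep1, of v2] by (simp add: det_snoc a_def N_def)
    moreover have "Determinant.det (gram (bs @ [v1, v2])) = 54675"
      using lattice_basis_det_eq(2)[OF P_indep[OF v(1)] ws(1)] v(1) assms(2) by (simp add: P_def)
    ultimately show ?thesis using ac by (simp add: field_simps)
  qed
  \<comment> \<open>With the determinant this gives \<open>a * c \<le> 100/9\<close>. Both factors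
    are at least 10/3, so equality holds, and only the sign of \<open>b\<close> remains
    open.\<close>
  have "4 * b\<^sup>2 \<le> a * c"
  proof -
    have "(2 * \<bar>b\<bar>) * (2 * \<bar>b\<bar>) \<le> a * c" using b by (intro mult_mono) auto
    then show ?thesis by (simp add: power2_eq_square)
  qed
  with det have prod_le: "a * c \<le> 100/9" by simp
  have "10/3 * c \<le> a * c" "a * (10/3) \<le> a * c"
    using ac by (intro mult_right_mono mult_left_mono; simp)+
  with prod_le ac have ac_eq: "a = 10/3" "c = 10/3" by linarith+
  with det have "(b - 5/3) * (b + 5/3) = 0" by (simp add: power2_eq_square algebra_simps)
  then have "b = 1 * (5/3) \<or> b = -1 * (5/3)" by auto
  then obtain \<epsilon> where "\<epsilon> \<in> {-1, 1}" "b = \<epsilon> * (5/3)" by blast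
  then show ?thesis
    using that[of v1 v2 \<epsilon>] P_mem[OF v(1)] span ac_eq by (simp add: a_def b_def c_def N_def)
qed

text \<open>Translation by the hexagonal lattice brings the part of \<open>\<pi> v\<close> along
  \<open>\<pi> v1\<close> and \<open>\<pi> v2\<close> down to norm at most 10/3 * 1/3, which leaves
  at least 20/9 for the orthogonal part, and 54675 * 20/9 = 121500.\<close>

theorem det_rank_11:
  assumes w: "primitive L (bs @ [w1, w2])" "Determinant.det (gram (bs @ [w1, w2])) = 54675"
    and v: "v \<in> L" "v \<notin> span (set (bs @ [w1, w2]))"
  shows "121500 \<le> Determinant.det (gram ((bs @ [w1, w2]) @ [v]))"
proof -
  let ?T = "set (bs @ [w1, w2])"
  obtain v1 v2 \<epsilon> where v12: "v1 \<in> L" "v2 \<in> L" "span (set (bs @ [v1, v2])) = span ?T"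
    "inner (\<pi> v1) (\<pi> v1) = 10/3" "inner (\<pi> v2) (\<pi> v2) = 10/3" "\<epsilon> \<in> {-1, 1}"
    "inner (\<pi> v1) (\<pi> v2) = \<epsilon> * (5/3)"
    using hexagonal_basis[OF w] .
  have T: "span ?T = span (insert v2 (insert v1 (set bs)))"
  proof -
    have "set (bs @ [v1, v2]) = insert v2 (insert v1 (set bs))" by auto
    then show ?thesis using v12(3) by simp
  qed
  define o' where "o' = perp ?T v"
  have sub: "span (set bs) \<subseteq> span ?T" by (intro span_mono) auto
  have \<pi>_T: "\<pi> x \<in> span ?T" if "x \<in> span ?T" for x
  proof -
    have "x - (x - \<pi> x) \<in> span ?T"
      by (rule span_diff[OF that subsetD[OF sub diff_perp_in_span]])
    then show ?thesis by simp
  qed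
  have "v1 \<in> span ?T" "v2 \<in> span ?T" unfolding T by (rule span_base, simp)+
  then have o_orth: "inner o' (\<pi> v1) = 0" "inner o' (\<pi> v2) = 0"
    unfolding o'_def using \<pi>_T by (auto intro: inner_perp)
  have "v - o' \<in> span (insert v2 (insert v1 (set bs)))"
    using diff_perp_in_span[of v ?T] unfolding T o'_def .
  then obtain t where "v - o' - t *\<^sub>R v2 \<in> span (insert v1 (set bs))"
    unfolding span_breakdown_eq[of "v - o'" v2] by blast
  then obtain s where "v - o' - t *\<^sub>R v2 - s *\<^sub>R v1 \<in> span (set bs)"
    unfolding span_breakdown_eq[of "v - o' - t *\<^sub>R v2" v1] by blast
  then have "\<pi> (v - o' - t *\<^sub>R v2 - s *\<^sub>R v1) = 0" by (rule perp_span)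
  moreover have "\<pi> o' = o'"
    unfolding o'_def using sub by (intro perp_eqI) (auto intro: inner_perp simp: span_zero)
  ultimately have \<pi>v: "\<pi> v = o' + s *\<^sub>R \<pi> v1 + t *\<^sub>R \<pi> v2"
    by (simp add: perp_add perp_diff perp_scale algebra_simps)
  obtain i j :: int where ij:
    "(s - of_int i)\<^sup>2 + \<epsilon> * (s - of_int i) * (t - of_int j) + (t - of_int j)\<^sup>2 \<le> 1/3"
    using hexagonal_covering[OF v12(6)] .
  let ?x = "s - of_int i" and ?y = "t - of_int j" and ?v = "v - of_int i *\<^sub>R v1 - of_int j *\<^sub>R v2"
  have "?v \<notin> span (set bs)"
  proof
    assume "?v \<in> span (set bs)"
    then have "?v + of_int i *\<^sub>R v1 + of_int j *\<^sub>R v2 \<in> span ?T"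
      using sub \<open>v1 \<in> span ?T\<close> \<open>v2 \<in> span ?T\<close> by (intro span_add span_scale) auto
    then show False using v(2) by simp
  qed
  moreover have "?v \<in> L" using v(1) v12(1,2) by (intro diff_mem scale_mem)
  ultimately have ge: "10/3 \<le> inner (\<pi> ?v) (\<pi> ?v)"
    using projected_min not_in_int_span by blast
  have \<pi>v': "\<pi> ?v = o' + ?x *\<^sub>R \<pi> v1 + ?y *\<^sub>R \<pi> v2"
    by (simp add: perp_add perp_diff perp_scale \<pi>v algebra_simps)
  have "inner (\<pi> ?v) (\<pi> ?v) = inner o' o' + 10/3 * (?x\<^sup>2 + \<epsilon> * ?x * ?y + ?y\<^sup>2)"
    unfolding \<pi>v' inner_three o_orth v12(4,5,7) by (simp add: algebra_simps)
  with ge have "20/9 \<le> inner o' o'" using ij by argo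
  moreover have "indep_list (bs @ [w1, w2])" using w(1) by (simp add: primitive_def)
  ultimately show ?thesis
    using det_gram_snoc[of "bs @ [w1, w2]" v] w(2) by (simp add: o'_def)
qed

end

section \<open>Cross-sections as primitive lists\<close>

lemma (in integral_group) cross_section_extend:
  assumes "primitive L bs" "cross_section n L K" "int_span bs \<subseteq> K"
  obtains cs where "primitive L (bs @ cs)" "K = int_span (bs @ cs)" "length bs + length cs = n"
proof -
  obtain es where es: "primitive L es" "K = int_span es" "length es = n" "span (set es) = span K"
    using cross_section_basis[OF assms(2)] .
  have "set bs \<subseteq> span K"
    using assms(3) int_span_nth[of _ bs] span_superset[of K] by (fastforce simp: in_set_conv_nth)
  then obtain cs where cs: "primitive L (bs @ cs)" "int_span (bs @ cs) = L \<inter> span K"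
    by (rule primitive_complete[OF assms(1) _ subspace_span])
  have K: "K = int_span (bs @ cs)"
    using cs(2) es by (simp add: primitive_def)
  have "length (bs @ cs) = length es"
    using dim_int_span[of "bs @ cs"] dim_int_span[of es] cs(1) es(1,2) K by (simp add: primitive_def)
  then show ?thesis using that cs(1) K es(3) by simp
qed

lemma lattice_det_int_span: "indep_list bs \<Longrightarrow> lattice_det (int_span bs) = Determinant.det (gram bs)"
  by (rule lattice_det_eq) (simp add: lattice_basis_alt)

text \<open>Modulo the span of \<open>bs\<close>, \<open>v\<close> is an integer multiple
  \<open>j\<close> of a vector \<open>w\<close> that extends \<open>bs\<close> primitively, and the
  determinant with \<open>v\<close> is j^2 times the one with \<open>w\<close>, which is at least
  \<open>D\<close>. Below \<open>4 * D\<close> only j = 1 and j = -1 remain.\<close>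

lemma (in integral_group) primitive_snoc:
  assumes "primitive L bs" "v \<in> L" "v \<notin> span (set bs)"
    and "\<And>w. w \<in> L \<Longrightarrow> w \<notin> span (set bs) \<Longrightarrow> D \<le> Determinant.det (gram (bs @ [w]))"
    and "Determinant.det (gram (bs @ [v])) < 4 * D"
  shows "primitive L (bs @ [v])"
proof -
  have bs: "indep_list bs" using assms(1) by (simp add: primitive_def)
  obtain w where w: "w \<in> L" "primitive L (bs @ [w])" "span (insert w (set bs)) = span (insert v (set bs))"
    using primitive_extend[OF assms(1-3)] .
  have w_notin: "w \<notin> span (set bs)" using w(2) by (simp add: primitive_def indep_list_snoc)
  have "v \<in> span (set (bs @ [w]))" using w(3) by (simp add: span_base)
  then have "v \<in> int_span (bs @ [w])" using w(2) assms(2) by (simp add: primitive_def)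
  then obtain y j where y: "y \<in> int_span bs" "v = y + of_int j *\<^sub>R w"
    unfolding int_span_snoc by blast
  have y_span: "y \<in> span (set bs)" using y(1) int_span_subset_span by blast
  have "perp (set bs) v = of_int j *\<^sub>R perp (set bs) w"
    unfolding y(2) by (simp add: perp_add perp_scale perp_span[OF y_span])
  then have det: "Determinant.det (gram (bs @ [v])) = (of_int j)\<^sup>2 * Determinant.det (gram (bs @ [w]))"
    by (simp add: det_gram_snoc[OF bs] power2_eq_square)
  have pos: "0 < Determinant.det (gram (bs @ [w]))"
    using w(2) by (intro det_gram_pos) (simp add: primitive_def)
  have "j\<^sup>2 < 4"
  proof (rule ccontr)
    assume "\<not> j\<^sup>2 < 4"
    then have "4 \<le> (of_int j :: real)\<^sup>2" by (simp flip: of_int_power)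
    then have "4 * Determinant.det (gram (bs @ [w])) \<le> Determinant.det (gram (bs @ [v]))"
      unfolding det using pos by (intro mult_right_mono) auto
    with assms(4)[OF w(1) w_notin] assms(5) show False by linarith
  qed
  moreover have "j \<noteq> 0" using y_span y(2) assms(3) by auto
  ultimately have "j = 1 \<or> j = -1"
    using power2_less_imp_less[of "\<bar>j\<bar>" 2] by auto
  then have j: "of_int j * of_int j = (1 :: real)" by auto
  have "int_span (bs @ [v]) = int_span (bs @ [w])"
  proof (intro equalityI subsetI)
    fix x assume "x \<in> int_span (bs @ [v])"
    then obtain z m where "z \<in> int_span bs" "x = z + of_int m *\<^sub>R v" unfolding int_span_snoc by blast
    then have "x = (z + of_int m *\<^sub>R y) + of_int (m * j) *\<^sub>R w" "z + of_int m *\<^sub>R y \<in> int_span bs"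
      using y by (auto simp: algebra_simps intro!: int_span_add int_span_scale)
    then show "x \<in> int_span (bs @ [w])" unfolding int_span_snoc by blast
  next
    fix x assume "x \<in> int_span (bs @ [w])"
    then obtain z m where z: "z \<in> int_span bs" "x = z + of_int m *\<^sub>R w" unfolding int_span_snoc by blast
    have "of_int (m * j) *\<^sub>R v = of_int (m * j) *\<^sub>R y + (of_int m * (of_int j * of_int j)) *\<^sub>R w"
      unfolding y(2) by (simp add: algebra_simps)
    then have "x = (z - of_int (m * j) *\<^sub>R y) + of_int (m * j) *\<^sub>R v" using z(2) j by simp
    moreover have "z - of_int (m * j) *\<^sub>R y \<in> int_span bs"
      using z(1) y(1) by (intro int_span_diff int_span_scale)
    ultimately show "x \<in> int_span (bs @ [v])" unfolding int_span_snoc by blast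
  qed
  moreover have "span (set (bs @ [v])) = span (set (bs @ [w]))" using w(3) by simp
  ultimately show ?thesis
    using w(2) bs assms(3) by (simp add: primitive_def indep_list_snoc)
qed

lemma gram_take: "n \<le> length bs \<Longrightarrow> gram (take n bs) = Matrix.mat n n (\<lambda>(i, j). gram bs $$ (i, j))"
  by (rule eq_matI) (auto simp: gram_def)

lemma extremal_K8I:
  assumes "unimodular L" "has_minimum L 6" "set bs \<subseteq> L" "gram bs = K8_gram"
  shows "extremal_K8 L bs"
proof -
  interpret integral_group L by (rule unimodular_integral_group[OF assms(1)])
  show ?thesis
    by unfold_locales (use assms in \<open>auto simp: has_minimum_def\<close>)
qed

lemma extremal_K8_of_isometric:
  assumes "unimodular L" "has_minimum L 6" "saturated K8 L" "lattice_isometric K8 sqrt3_E8"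
  obtains bs where "extremal_K8 L bs" "K8 = int_span bs"
proof -
  have "is_lattice K8" using assms(3) by (simp add: saturated_def)
  then obtain bs where bs: "lattice_basis K8 bs" "gram bs = gram sqrt3_E8_basis"
    using isometric_basis[OF _ assms(4) sqrt3_E8_basis] by blast
  then have K8: "K8 = int_span bs" by (simp add: lattice_basis_alt)
  have "set bs \<subseteq> K8" unfolding K8 using int_span_nth[of _ bs] by (auto simp: in_set_conv_nth)
  then have "set bs \<subseteq> L" using assms(3) by (auto simp: saturated_def)
  then show ?thesis
    using that[OF extremal_K8I[OF assms(1,2)]] bs(2) gram_sqrt3_E8_basis K8 by simp
qed

context extremal_K8
begin

lemma cross_section_9:
  assumes "cross_section 9 L K" "int_span bs \<subseteq> K"
  obtains w where "primitive L (bs @ [w])" "K = int_span (bs @ [w])" "w \<in> L" "w \<notin> span (set bs)"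
    "lattice_det K = Determinant.det (gram (bs @ [w]))"
proof -
  obtain cs where cs: "primitive L (bs @ cs)" "K = int_span (bs @ cs)" "length bs + length cs = 9"
    using cross_section_extend[OF primitive_bs assms] .
  then have "length cs = Suc 0" using length_bs by simp
  then obtain w where w: "cs = [w]" by (auto simp: length_Suc_conv)
  have "w \<in> L" "w \<notin> span (set bs)" and indep: "indep_list (bs @ [w])"
    using cs(1) int_span_nth[of 8 "bs @ [w]"] length_bs w by (auto simp: primitive_def indep_list_snoc nth_append)
  with indep show ?thesis using that[of w] cs w lattice_det_int_span[OF indep] by simp
qed

lemma cross_section_10:
  assumes w: "primitive L (bs @ [w])" and K: "cross_section 10 L K" "int_span (bs @ [w]) \<subseteq> K"
  obtains v where "primitive L (bs @ [w, v])" "K = int_span (bs @ [w, v])" "v \<in> L" "v \<notin> span (set (bs @ [w]))"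
    "lattice_det K = Determinant.det (gram (bs @ [w, v]))"
proof -
  obtain cs where cs: "primitive L ((bs @ [w]) @ cs)" "K = int_span ((bs @ [w]) @ cs)"
    "length (bs @ [w]) + length cs = 10"
    using cross_section_extend[OF w K] .
  then have "length cs = Suc 0" using length_bs by simp
  then obtain v where v: "cs = [v]" by (auto simp: length_Suc_conv)
  have indep: "indep_list ((bs @ [w]) @ [v])" using cs(1) v by (simp only: primitive_def)
  moreover have "v \<in> L"
    using cs(1) int_span_nth[of 9 "bs @ [w, v]"] length_bs v by (auto simp: primitive_def nth_append)
  moreover have "v \<notin> span (set (bs @ [w]))"
    using indep unfolding indep_list_snoc by blast
  ultimately show ?thesis using that[of v] cs v lattice_det_int_span[OF indep] by simp
qed

lemma cross_section_11:
  assumes w: "primitive L (bs @ [w1, w2])" and K: "cross_section 11 L K" "int_span (bs @ [w1, w2]) \<subseteq> K"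
  obtains v where "primitive L ((bs @ [w1, w2]) @ [v])" "K = int_span ((bs @ [w1, w2]) @ [v])" "v \<in> L"
    "v \<notin> span (set (bs @ [w1, w2]))"
    "lattice_det K = Determinant.det (gram ((bs @ [w1, w2]) @ [v]))"
proof -
  obtain cs where cs: "primitive L ((bs @ [w1, w2]) @ cs)" "K = int_span ((bs @ [w1, w2]) @ cs)"
    "length (bs @ [w1, w2]) + length cs = 11"
    using cross_section_extend[OF w K] .
  then have "length cs = Suc 0" using length_bs by simp
  then obtain v where v: "cs = [v]" by (auto simp: length_Suc_conv)
  have indep: "indep_list ((bs @ [w1, w2]) @ [v])" using cs(1) v by (simp only: primitive_def)
  moreover have "v \<in> L"
    using cs(1) int_span_nth[of 10 "bs @ [w1, w2, v]"] length_bs v by (auto simp: primitive_def nth_append)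
  moreover have "v \<notin> span (set (bs @ [w1, w2]))"
    using indep unfolding indep_list_snoc by blast
  ultimately show ?thesis
    using that[of v] cs(1,2) lattice_det_int_span[OF indep] unfolding v by blast
qed

end

lemma rank_9_bound:
  assumes "unimodular L" "has_minimum L 6" "saturated K8 L" "lattice_isometric K8 sqrt3_E8"
    and K: "cross_section 9 L K" "K8 \<subseteq> K"
  shows "21870 \<le> lattice_det K"
proof -
  obtain bs where bs: "extremal_K8 L bs" "K8 = int_span bs"
    using extremal_K8_of_isometric[OF assms(1-4)] .
  interpret extremal_K8 L bs by (rule bs(1))
  show ?thesis
    using cross_section_9[OF K(1)] K(2) bs(2) det_rank_9 by metis
qed

lemma has_gram_matrix_det: "has_gram_matrix K G \<Longrightarrow> lattice_det K = Determinant.det G"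
  using lattice_det_eq by (auto simp: has_gram_matrix_def)

lemma rank_10_bound:
  assumes "unimodular L" "has_minimum L 6" "saturated K8 L" "lattice_isometric K8 sqrt3_E8"
    and K9: "cross_section 9 L K9" "K8 \<subseteq> K9" "has_gram_matrix K9 K9_gram"
    and K: "cross_section 10 L K" "K9 \<subseteq> K"
  shows "54675 \<le> lattice_det K"
proof -
  obtain bs where bs: "extremal_K8 L bs" "K8 = int_span bs"
    using extremal_K8_of_isometric[OF assms(1-4)] .
  interpret extremal_K8 L bs by (rule bs(1))
  obtain w where w: "primitive L (bs @ [w])" "K9 = int_span (bs @ [w])" "w \<in> L" "w \<notin> span (set bs)"
    "lattice_det K9 = Determinant.det (gram (bs @ [w]))"
    using cross_section_9[OF K9(1)] K9(2) bs(2) by blast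
  have d: "Determinant.det (gram (bs @ [w])) = 21870"
    using w(5) has_gram_matrix_det[OF K9(3)] det_K9_gram by simp
  obtain v where v: "v \<in> L" "v \<notin> span (set (bs @ [w]))" "lattice_det K = Determinant.det (gram (bs @ [w, v]))"
    using cross_section_10[OF w(1) K(1)] K(2) w(2) by blast
  show ?thesis using det_rank_10[OF w(3,4) d v(1,2)] v(3) by simp
qed

lemma rank_11_bound:
  fixes L :: "'a::euclidean_space set"
  assumes L: "unimodular L" "has_minimum L 6" "saturated K8 L" "lattice_isometric K8 sqrt3_E8"
    and dim: "dim L = DIM('a)" "DIM('a) = 48"
    and K10: "cross_section 10 L K10" "K8 \<subseteq> K10" "has_gram_matrix K10 K10_gram"
    and K: "cross_section 11 L K" "K10 \<subseteq> K"
  shows "121500 \<le> lattice_det K" "is_bare_packing 37 L K"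
    "bare_center_density L K \<le> (3/2) powr (37/2) / sqrt 121500"
proof -
  obtain bs where bs: "extremal_K8 L bs" "K8 = int_span bs"
    using extremal_K8_of_isometric[OF L] .
  interpret extremal_K8 L bs by (rule bs(1))
  obtain cs where cs: "primitive L (bs @ cs)" "K10 = int_span (bs @ cs)" "length bs + length cs = 10"
    using cross_section_extend[OF primitive_bs K10(1)] K10(2) bs(2) by blast
  then have "length cs = Suc (Suc 0)" using length_bs by simp
  then obtain w1 w2 where w12: "cs = [w1, w2]" by (auto simp: length_Suc_conv)
  have d: "Determinant.det (gram (bs @ [w1, w2])) = 54675"
    using cs(1,2) w12 has_gram_matrix_det[OF K10(3)] det_K10_gram lattice_det_int_span[of "bs @ [w1, w2]"]
    by (simp add: primitive_def)
  obtain v where v: "primitive L ((bs @ [w1, w2]) @ [v])" "K = int_span ((bs @ [w1, w2]) @ [v])" "v \<in> L"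
    "v \<notin> span (set (bs @ [w1, w2]))" "lattice_det K = Determinant.det (gram ((bs @ [w1, w2]) @ [v]))"
    using cross_section_11[OF _ K(1)] cs(1,2) K(2) w12 by blast
  show bound: "121500 \<le> lattice_det K"
    using det_rank_11[OF _ d v(3,4)] cs(1) w12 v(5) by simp
  have n: "DIM('a) - length ((bs @ [w1, w2]) @ [v]) = 37"
    using dim(2) length_bs by simp
  note packing = bare_packing[OF L(1) dim(1) v(1) L(2), folded v(2,5), unfolded n]
  show "is_bare_packing 37 L K" by (rule packing(1))
  have "sqrt 121500 \<le> sqrt (lattice_det K)" using bound by simp
  then show "bare_center_density L K \<le> (3/2) powr (37/2) / sqrt 121500"
    unfolding packing(2) using bound by (simp add: frac_le)
qed

section \<open>Center densities, and the sections given by ten vectors\<close>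

lemma center_density_39: "(3/2) powr (39/2) / sqrt 21870 = (2 :: real) powr (-20) * 3 powr 16 * 5 powr (-1/2)"
proof -
  have "sqrt 21870 = (2 * 3 powr 7 * 5 :: real) powr (1/2)" by (simp add: powr_half_sqrt)
  also have "\<dots> = 2 powr (1/2) * 3 powr (7/2) * 5 powr (1/2)" by (simp only: powr_mult powr_powr) simp
  finally have "sqrt 21870 = (2::real) powr (1/2) * 3 powr (7/2) * 5 powr (1/2)" .
  moreover have "(3/2 :: real) powr (39/2) = 3 powr (39/2) * 2 powr (-39/2)"
    by (simp add: powr_divide powr_minus_divide)
  ultimately have "(3/2) powr (39/2) / sqrt 21870 =
      (3 powr (39/2) * 3 powr (-7/2)) * (2 powr (-39/2) * 2 powr (-1/2)) * (5 :: real) powr (-1/2)"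
    by (simp add: powr_minus_divide)
  also have "\<dots> = 3 powr 16 * 2 powr (-20) * 5 powr (-1/2)"
    by (simp only: powr_add[symmetric]) simp
  finally show ?thesis by simp
qed

lemma center_density_38: "(3/2) powr (38/2) / sqrt 54675 = (2 :: real) powr (-19) * 3 powr (31/2) * 5 powr (-1)"
proof -
  have "sqrt 54675 = (3 powr 7 * 5 powr 2 :: real) powr (1/2)" by (simp add: powr_half_sqrt)
  also have "\<dots> = 3 powr (7/2) * 5 powr 1" by (simp only: powr_mult powr_powr) simp
  finally have "sqrt 54675 = (3::real) powr (7/2) * 5 powr 1" .
  moreover have "(3/2 :: real) powr (38/2) = 3 powr (38/2) * 2 powr (-19)"
    by (simp add: power_divide powr_neg_numeral)
  ultimately have "(3/2) powr (38/2) / sqrt 54675 = (3 powr (38/2) * 2 powr (-19)) / (3 powr (7/2) * (5 :: real) powr 1)"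
    by (simp only:)
  also have "\<dots> = (3 powr (38/2) * 3 powr (-(7/2))) * 2 powr (-19) * 5 powr (-1)"
    by (simp only: powr_minus divide_inverse inverse_mult_distrib mult_ac)
  also have "3 powr (38/2) * 3 powr (-(7/2)) = (3 :: real) powr (31/2)"
    by (subst powr_add[symmetric]) simp
  finally show ?thesis by (simp only: mult_ac)
qed

text \<open>The determinants 21870 and 54675 equal the lower bounds for ranks 9 and 10, so
  \<open>primitive_snoc\<close> makes the prefixes of length 9 and 10 primitive. It thus remains to
  find ten lattice vectors with the right Gram matrix.\<close>

lemma K10_sections:
  fixes L :: "'a::euclidean_space set"
  assumes L: "unimodular L" "has_minimum L 6" "dim L = DIM('a)" "DIM('a) = 48"
    and bs: "length bs = 10" "set bs \<subseteq> L" "gram bs = K10_gram"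
  shows "\<exists>K8 K9 K10 bs.
          length bs = 10 \<and> gram bs = K10_gram \<and>
          lattice_basis K8 (take 8 bs) \<and> lattice_basis K9 (take 9 bs) \<and> lattice_basis K10 bs \<and>
          saturated K8 L \<and> lattice_isometric K8 sqrt3_E8 \<and>
          saturated K9 L \<and> cross_section 9 L K9 \<and> K8 \<subseteq> K9 \<and>
          has_gram_matrix K9 K9_gram \<and> lattice_det K9 = 21870 \<and>
          is_bare_packing 39 L K9 \<and>
          bare_center_density L K9 = 2 powr (-20) * 3 powr 16 * 5 powr (-1/2) \<and>
          saturated K10 L \<and> cross_section 10 L K10 \<and> K9 \<subseteq> K10 \<and>
          has_gram_matrix K10 K10_gram \<and> lattice_det K10 = 54675 \<and>
          is_bare_packing 38 L K10 \<and>
          bare_center_density L K10 = 2 powr (-19) * 3 powr (31/2) * 5 powr (-1)"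
proof -
  let ?as = "take 8 bs" and ?v = "bs ! 8" and ?w = "bs ! 9"
  have take9: "take 9 bs = ?as @ [?v]"
    using bs(1) take_Suc_conv_app_nth[of 8 bs] by simp
  have bs_eq: "bs = take 9 bs @ [?w]"
    using bs(1) take_Suc_conv_app_nth[of 9 bs] by simp
  have gram8: "gram ?as = K8_gram" and gram9: "gram (take 9 bs) = K9_gram"
    using bs gram_take[of 8 bs] gram_take[of 9 bs] by (simp_all add: K8_gram_def K9_gram_def)
  have "set ?as \<subseteq> L" using bs(2) set_take_subset[of 8 bs] by blast
  then interpret extremal_K8 L ?as by (intro extremal_K8I L gram8)
  have vw: "?v \<in> L" "?w \<in> L" using bs by auto
  have det9: "Determinant.det (gram (?as @ [?v])) = 21870"
    using gram9 det_K9_gram by (simp add: take9)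
  then have v_notin: "?v \<notin> span (set ?as)"
    using det_gram_snoc[OF indep_bs, of ?v] by (auto simp: perp_eq_0_iff[symmetric])
  have prim9: "primitive L (take 9 bs)"
    unfolding take9 using det9
    by (intro primitive_snoc[OF primitive_bs vw(1) v_notin, of 21870]) (auto intro: det_rank_9)
  have indep9: "indep_list (take 9 bs)" using prim9 by (simp add: primitive_def)
  have det10: "Determinant.det (gram (take 9 bs @ [?w])) = 54675"
    using bs(3) det_K10_gram bs_eq by simp
  then have w_notin: "?w \<notin> span (set (take 9 bs))"
    using det_gram_snoc[OF indep9, of ?w] by (auto simp: perp_eq_0_iff[symmetric])
  have "primitive L (take 9 bs @ [?w])"
    using det10 det_rank_10[OF vw(1) v_notin det9]
    by (intro primitive_snoc[OF prim9 vw(2) w_notin, of 54675]) (auto simp: take9)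
  then have prim10: "primitive L bs" using bs_eq by simp
  have basis: "lattice_basis (int_span ?as) ?as" "lattice_basis (int_span (take 9 bs)) (take 9 bs)"
    "lattice_basis (int_span bs) bs"
    using indep_bs indep9 prim10 by (auto simp: lattice_basis_alt primitive_def)
  have len9: "length (take 9 bs) = 9" using bs(1) by simp
  have n: "DIM('a) - length (take 9 bs) = 39" "DIM('a) - length bs = 38"
    using L(4) bs(1) by auto
  note packing9 = bare_packing[OF L(1,3) prim9 L(2), unfolded n]
  note packing10 = bare_packing[OF L(1,3) prim10 L(2), unfolded n]
  have dens9: "bare_center_density L (int_span (take 9 bs)) = 2 powr (-20) * 3 powr 16 * 5 powr (-1/2)"
    unfolding packing9(2) using center_density_39 det9 by (simp add: take9)
  have dens10: "bare_center_density L (int_span bs) = 2 powr (-19) * 3 powr (31/2) * 5 powr (-1)"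
    unfolding packing10(2) using center_density_38 det10 bs_eq by simp
  have "int_span ?as \<subseteq> int_span (take 9 bs)" "int_span (take 9 bs) \<subseteq> int_span bs"
    using int_span_snoc[of _ ?as ?v] int_span_snoc[of _ "take 9 bs" ?w] take9 bs_eq
    by (metis add.right_neutral of_int_0 scaleR_zero_left subsetI)+
  moreover have "has_gram_matrix (int_span (take 9 bs)) K9_gram" "has_gram_matrix (int_span bs) K10_gram"
    using basis gram9 bs(3) by (auto simp: has_gram_matrix_def)
  moreover from this have "lattice_det (int_span (take 9 bs)) = 21870" "lattice_det (int_span bs) = 54675"
    using has_gram_matrix_det det_K9_gram det_K10_gram by metis+
  moreover have "lattice_isometric (int_span ?as) sqrt3_E8"
    using gram_eq_isometric[OF basis(1) sqrt3_E8_basis] gram8 gram_sqrt3_E8_basis by simp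
  moreover have "cross_section 9 L (int_span (take 9 bs))" "cross_section 10 L (int_span bs)"
    using primitive_cross_section[OF prim9] primitive_cross_section[OF prim10] len9 bs(1) by simp_all
  moreover note primitive_saturated[OF primitive_bs] primitive_saturated[OF prim9]
    primitive_saturated[OF prim10] packing9(1) packing10(1) dens9 dens10 basis bs(1,3)
  ultimately show ?thesis by blast
qed

text \<open>Squaring removes the half-integral exponents, so that the decimal intervals become
  inequalities between rational numbers.\<close>

lemma density_numerics:
  "2 powr (-20) * 3 powr 16 * 5 powr (-1/2) \<in> {18.35..<18.36 :: real}"
  "2 powr (-19) * 3 powr (31/2) * 5 powr (-1) \<in> {9.48..<9.49 :: real}"
  "(3/2) powr (37/2) / sqrt 121500 \<in> {5.19..<5.20 :: real}"
  "(3/2) powr (37/2) / sqrt 121500 < (2 :: real) powr (5/2)"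
  "2 powr (5/2) \<in> {5.65..<5.66 :: real}"
proof -
  have sq: "x \<in> {l..<u}" if "x\<^sup>2 = q" "l\<^sup>2 \<le> q" "q < u\<^sup>2" "0 \<le> x" "0 \<le> u" for x l u q :: real
    using that power2_le_imp_le[of l x] power2_less_imp_less[of x u] by auto
  have pw: "(a powr b)\<^sup>2 = a powr (2 * b)" for a b :: real
    by (simp add: power2_eq_square powr_add[symmetric])
  have "(2 powr (-20) * 3 powr 16 * 5 powr (-1/2) :: real)\<^sup>2 = 2 powr (-40) * 3 powr 32 * 5 powr (-1)"
    by (simp only: power_mult_distrib pw) simp
  also have "\<dots> = 3 ^ 32 / (2 ^ 40 * 5)" by (simp add: powr_neg_numeral)
  finally show "2 powr (-20) * 3 powr 16 * 5 powr (-1/2) \<in> {18.35..<18.36 :: real}"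
    by (rule sq) (simp_all add: power2_eq_square)
  have "(2 powr (-19) * 3 powr (31/2) * 5 powr (-1) :: real)\<^sup>2 = 2 powr (-38) * 3 powr 31 * 5 powr (-2)"
    by (simp only: power_mult_distrib pw) simp
  also have "\<dots> = 3 ^ 31 / (2 ^ 38 * 5 ^ 2)" by (simp add: powr_neg_numeral)
  finally show "2 powr (-19) * 3 powr (31/2) * 5 powr (-1) \<in> {9.48..<9.49 :: real}"
    by (rule sq) (simp_all add: power2_eq_square)
  have "((3/2) powr (37/2) / sqrt 121500 :: real)\<^sup>2 = (3/2) powr 37 / 121500"
    by (simp add: power_divide pw)
  also have "\<dots> = (3/2) ^ 37 / 121500" by simp
  finally show d: "(3/2) powr (37/2) / sqrt 121500 \<in> {5.19..<5.20 :: real}"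
    by (rule sq) (simp_all add: power2_eq_square power_divide)
  have "(2 powr (5/2) :: real)\<^sup>2 = 2 powr 5" by (simp add: pw)
  also have "\<dots> = 32" by simp
  finally show "2 powr (5/2) \<in> {5.65..<5.66 :: real}"
    by (rule sq) (simp_all add: power2_eq_square)
  with d show "(3/2) powr (37/2) / sqrt 121500 < (2 :: real) powr (5/2)" by auto
qed

section \<open>Neighbours of ternary code lattices\<close>

lemma F3_of_int_eq_0: "3 dvd a \<Longrightarrow> (of_int a :: F3) = 0"
proof -
  assume "3 dvd a"
  moreover have "(of_int 3 :: F3) = 0"
    using of_nat_card_eq_0[where 'a = three] by (simp add: CARD_three)
  ultimately show ?thesis by (auto elim!: dvdE)
qed

lemma F3_of_int_cong:
  assumes "[a = b] (mod 3)"
  shows "(of_int a :: F3) = of_int b"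
proof -
  have "3 dvd a - b" using assms by (simp add: cong_iff_dvd_diff)
  then have "(of_int (a - b) :: F3) = 0" by (rule F3_of_int_eq_0)
  then show ?thesis by simp
qed

definition codeword :: "(48 \<Rightarrow> nat) \<Rightarrow> (nat \<Rightarrow> int) \<Rightarrow> F3^48" where
  "codeword p f = (\<chi> i. of_int (f (p i)))"

text \<open>A self-dual ternary code with systematic generator matrix \<open>[I | B]\<close>, where \<open>B\<^sup>T B = -I\<close>; the map
  \<open>p\<close> numbers the coordinates.\<close>

locale ternary_code =
  fixes C :: "(F3^48) set" and p :: "48 \<Rightarrow> nat" and R :: "int list list"
  assumes p: "bij_betw p UNIV {..<48}"
    and subspace_C: "vec.subspace C"
    and row_mem: "i < 24 \<Longrightarrow> codeword p ((!) (R ! i)) \<in> C"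
    and systematic: "i < 24 \<Longrightarrow> j < 24 \<Longrightarrow> R ! i ! j = (if i = j then 1 else 0)"
    and self_orthogonal: "i < 24 \<Longrightarrow> j < 24 \<Longrightarrow> [(\<Sum>k<48. R ! i ! k * R ! j ! k) = 0] (mod 3)"
    and right_dual: "j < 24 \<Longrightarrow> k < 24 \<Longrightarrow>
      [(\<Sum>i<24. R ! i ! (24 + j) * R ! i ! (24 + k)) = (if j = k then -1 else 0)] (mod 3)"
begin

text \<open>Integer lifts of words orthogonal to all rows. For a self-dual code these are lifts of
  codewords (\<open>dual_word_mem\<close>), and the condition can be tested by dot products instead
  of solving for coefficients.\<close>

definition dual_word :: "(nat \<Rightarrow> int) \<Rightarrow> bool" where
  "dual_word f \<longleftrightarrow> (\<forall>i<24. [(\<Sum>k<48. f k * R ! i ! k) = 0] (mod 3))"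

lemma sum_48: "(\<Sum>k<48. g k) = (\<Sum>k<24. g k) + (\<Sum>k<24. g (24 + k))" for g :: "nat \<Rightarrow> int"
proof -
  have "(\<lambda>k. 24 + k) ` {..<24} = {24..<48 :: nat}"
    using image_add_atLeastLessThan[of 24 0 24] by (simp add: lessThan_atLeast0)
  then have "(\<Sum>k<24. g (24 + k)) = (\<Sum>k\<in>{24..<48}. g k)"
    using sum.reindex[of "\<lambda>k. 24 + k" "{..<24 :: nat}" g] by simp
  then show ?thesis
    by (simp add: lessThan_atLeast0 sum.atLeastLessThan_concat)
qed

text \<open>Write the word as (u, w). Orthogonality to the rows of \<open>[I | B]\<close> says u =
  -B w, so the combination of the rows with coefficients u has the right half
  \<open>B\<^sup>T u = - B\<^sup>T B w = w\<close> modulo 3.\<close>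

lemma dual_word_expand:
  assumes "dual_word f" "k < 48"
  shows "[f k = (\<Sum>i<24. f i * R ! i ! k)] (mod 3)"
proof (cases "k < 24")
  case True
  have "(\<Sum>i<24. f i * R ! i ! k) = (\<Sum>i<24. if i = k then f i else 0)"
    using True by (intro sum.cong) (auto simp: systematic)
  then show ?thesis using True by simp
next
  case False
  define j where "j = k - 24"
  have j: "j < 24" "k = 24 + j" using False assms(2) by (auto simp: j_def)
  let ?w = "\<lambda>l. f (24 + l)" and ?B = "\<lambda>i l. R ! i ! (24 + l)"
  have row: "[f i + (\<Sum>l<24. ?w l * ?B i l) = 0] (mod 3)" if "i < 24" for i
  proof -
    have "(\<Sum>k<24. f k * R ! i ! k) = (\<Sum>k<24. if k = i then f k else 0)"
      using that by (intro sum.cong) (auto simp: systematic)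
    then show ?thesis
      using assms(1)[unfolded dual_word_def, rule_format, OF that] that unfolding sum_48 by simp
  qed
  let ?S = "\<Sum>i<24. f i * ?B i j" and ?U = "\<Sum>l<24. ?w l * (\<Sum>i<24. ?B i l * ?B i j)"
  have "[(\<Sum>i<24. (f i + (\<Sum>l<24. ?w l * ?B i l)) * ?B i j) = (\<Sum>i<24. 0 * ?B i j)] (mod 3)"
    by (intro cong_sum cong_mult cong_refl row) simp
  moreover have "(\<Sum>i<24. (f i + (\<Sum>l<24. ?w l * ?B i l)) * ?B i j) =
      ?S + (\<Sum>i<24. \<Sum>l<24. ?w l * (?B i l * ?B i j))"
    by (simp add: distrib_right sum.distrib sum_distrib_right mult.assoc)
  moreover have "(\<Sum>i<24. \<Sum>l<24. ?w l * (?B i l * ?B i j)) = ?U"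
    by (subst sum.swap) (simp add: sum_distrib_left)
  ultimately have "[?S + ?U = 0] (mod 3)" by simp
  moreover have "[?U = (\<Sum>l<24. ?w l * (if l = j then -1 else 0))] (mod 3)"
    using j(1) by (intro cong_sum cong_mult cong_refl right_dual) simp_all
  moreover have "(\<Sum>l<24. ?w l * (if l = j then -1 else 0)) = - ?w j"
    using j(1) by (simp add: if_distrib cong: if_cong)
  ultimately have "[?S + ?U - (?U - - ?w j) = 0 - 0] (mod 3)"
    by (intro cong_diff) (simp_all add: cong_iff_dvd_diff)
  then have "[?S - ?w j = 0] (mod 3)" by simp
  then show ?thesis
    unfolding j(2) by (simp add: cong_iff_dvd_diff dvd_diff_commute)
qed

lemma dual_word_mem:
  assumes "dual_word f"
  shows "codeword p f \<in> C"
proof -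
  have p_less: "p i < 48" for i using p by (auto simp: bij_betw_def)
  have "codeword p f = (\<Sum>i<24. of_int (f i) *s codeword p ((!) (R ! i)))"
  proof -
    have "(of_int (f (p k)) :: F3) = (\<Sum>i<24. of_int (f i) * of_int (R ! i ! p k))" for k
      using F3_of_int_cong[OF dual_word_expand[OF assms p_less[of k]]] by simp
    then show ?thesis
      unfolding codeword_def Finite_Cartesian_Product.vec_eq_iff by simp
  qed
  also have "\<dots> \<in> C"
    by (intro vec.subspace_sum vec.subspace_scale subspace_C row_mem) simp
  finally show ?thesis .
qed

text \<open>One of the two factors is expanded in the rows, each of which is orthogonal to the other
  factor modulo 3.\<close>

lemma dual_word_norm:
  assumes "dual_word f"
  shows "[(\<Sum>k<48. f k * f k) = 0] (mod 3)"
proof -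
  have "[(\<Sum>k<48. f k * f k) = (\<Sum>k<48. f k * (\<Sum>i<24. f i * R ! i ! k))] (mod 3)"
    using dual_word_expand[OF assms] by (intro cong_sum cong_mult cong_refl) simp
  also have "(\<Sum>k<48. f k * (\<Sum>i<24. f i * R ! i ! k)) = (\<Sum>i<24. f i * (\<Sum>k<48. f k * R ! i ! k))"
    unfolding sum_distrib_left by (subst sum.swap) (simp add: mult_ac)
  also have "[\<dots> = (\<Sum>i<24. f i * 0)] (mod 3)"
    using assms by (intro cong_sum cong_mult cong_refl) (simp add: dual_word_def)
  finally show ?thesis by simp
qed

text \<open>The sum of squares is divisible by 3 by \<open>dual_word_norm\<close> and has the parity
  of the coordinate sum; it is a multiple of 6, and the norm is a third of it.\<close>

lemma even_part_mem:
  assumes "dual_word f" "even (\<Sum>k<48. f k)"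
  shows "(1 / sqrt 3) *\<^sub>R coord_vec p f \<in> even_part (code_lattice C)"
proof -
  define x :: "int^48" where "x = (\<chi> i. f (p i))"
  have "(\<chi> i. of_int (x $ i)) \<in> C"
    using dual_word_mem[OF assms(1)] by (simp add: x_def codeword_def)
  moreover have "(1 / sqrt 3) *\<^sub>R coord_vec p f = (\<chi> i. of_int (x $ i) / sqrt 3)"
    by (simp add: x_def coord_vec_def Finite_Cartesian_Product.vec_eq_iff)
  ultimately have "(1 / sqrt 3) *\<^sub>R coord_vec p f \<in> code_lattice C"
    unfolding code_lattice_def by blast
  moreover have "\<exists>k::int. inner ((1 / sqrt 3) *\<^sub>R coord_vec p f) ((1 / sqrt 3) *\<^sub>R coord_vec p f) = 2 * of_int k"
  proof -
    have "even (\<Sum>k<48. f k * f k - f k)" by (rule dvd_sum) simp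
    then have "even (\<Sum>k<48. f k * f k)" using assms(2) by (simp add: sum_subtractf)
    moreover have "3 dvd (\<Sum>k<48. f k * f k)" using dual_word_norm[OF assms(1)] by (simp add: cong_0_iff)
    ultimately have "6 dvd (\<Sum>k<48. f k * f k)" by presburger
    then obtain k where k: "(\<Sum>k<48. f k * f k) = 6 * k" by (rule dvdE)
    have "inner ((1 / sqrt 3) *\<^sub>R coord_vec p f) ((1 / sqrt 3) *\<^sub>R coord_vec p f) = of_int (\<Sum>k<48. f k * f k) / 3"
      by (simp add: inner_coord_vec[OF p] del: of_int_sum)
    then show ?thesis unfolding k by (intro exI[of _ k]) simp
  qed
  ultimately show ?thesis by (simp add: even_part_def)
qed

lemma dual_word_row: "i < 24 \<Longrightarrow> dual_word (\<lambda>k. c * R ! i ! k)"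
  unfolding dual_word_def
proof (intro allI impI)
  fix j :: nat assume ij: "i < 24" "j < 24"
  have "[c * (\<Sum>k<48. R ! i ! k * R ! j ! k) = c * 0] (mod 3)"
    by (intro cong_mult cong_refl self_orthogonal ij)
  then show "[(\<Sum>k<48. c * R ! i ! k * R ! j ! k) = 0] (mod 3)"
    by (simp add: sum_distrib_left mult.assoc)
qed

lemma dual_word_mult3: "dual_word (\<lambda>k. 3 * f k)"
proof -
  have "(\<Sum>k<48. 3 * f k * R ! i ! k) = 3 * (\<Sum>k<48. f k * R ! i ! k)" for i
    by (simp add: sum_distrib_left mult.assoc)
  then show ?thesis unfolding dual_word_def cong_0_iff by simp
qed

lemma dual_word_diff: "dual_word f \<Longrightarrow> dual_word g \<Longrightarrow> dual_word (\<lambda>k. f k - g k)"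
  unfolding dual_word_def left_diff_distrib sum_subtractf cong_0_iff by (simp add: dvd_diff)

lemma dual_word_half:
  assumes "dual_word f" "\<And>k. k < 48 \<Longrightarrow> f k = 2 * g k"
  shows "dual_word g"
  unfolding dual_word_def cong_0_iff
proof (intro allI impI)
  fix i :: nat assume "i < 24"
  then have "3 dvd (\<Sum>k<48. f k * R ! i ! k)" using assms(1) by (simp add: dual_word_def cong_0_iff)
  also have "(\<Sum>k<48. f k * R ! i ! k) = 2 * (\<Sum>k<48. g k * R ! i ! k)"
    using assms(2) by (simp add: sum_distrib_left mult.assoc)
  finally show "3 dvd (\<Sum>k<48. g k * R ! i ! k)" by presburger
qed

end

locale code_neighbour = ternary_code +
  fixes L :: "(real^48) set"
  assumes neighbour: "extremal_neighbour C L"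
begin

lemma unimodular_L: "unimodular L" and min_L: "has_minimum L 6"
  using neighbour by (auto simp: extremal_neighbour_def even_unimodular_def)

sublocale integral_group L by (rule unimodular_integral_group[OF unimodular_L])

lemma norm_L: "x \<in> L \<Longrightarrow> \<exists>k::int. inner x x = 2 * of_int k"
  using neighbour unfolding extremal_neighbour_def even_unimodular_def even_part_def by blast

lemma even_mem: "dual_word f \<Longrightarrow> even (\<Sum>k<48. f k) \<Longrightarrow> (1 / sqrt 3) *\<^sub>R coord_vec p f \<in> L"
  using even_part_mem neighbour by (auto simp: extremal_neighbour_def)

lemma coord_vec_diff: "coord_vec p f - coord_vec p g = coord_vec p (\<lambda>k. f k - g k)"
  by (simp add: coord_vec_def Finite_Cartesian_Product.vec_eq_iff)

lemma inner_unit: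
  assumes "l < 48"
  shows "inner (coord_vec p (\<lambda>k. if k = l then c else 0)) y = of_int c * (y $ (THE i. p i = l))"
proof -
  have "l \<in> range p" using p assms by (simp add: bij_betw_def)
  then obtain i where i: "p i = l" by auto
  have inj: "p j = l \<longleftrightarrow> j = i" for j using p i by (auto simp: bij_betw_def inj_on_def)
  have "(THE i. p i = l) = i" using inj by auto
  then show ?thesis
    by (simp add: inner_vec_def coord_vec_def inj if_distrib[of of_int] if_distrib[of "\<lambda>x. x * _"] cong: if_cong)
qed

text \<open>Multiples of 3 lift the zero word, and the doubling makes the coordinate sum even. These
  vectors show the full rank of \<open>L\<close> and bound the denominators of its
  coordinates.\<close>

lemma unit_mem:
  assumes "l < 48"
  shows "(6 / sqrt 3) *\<^sub>R coord_vec p (\<lambda>k. if k = l then 1 else 0) \<in> L"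
proof -
  let ?f = "\<lambda>k. 3 * (if k = l then 2 else 0) :: int"
  have "(\<Sum>k<48. ?f k) = 6" using assms by (simp add: if_distrib cong: if_cong)
  then have "(1 / sqrt 3) *\<^sub>R coord_vec p ?f \<in> L" by (intro even_mem dual_word_mult3) simp
  moreover have "coord_vec p ?f = 6 *\<^sub>R coord_vec p (\<lambda>k. if k = l then 1 else 0)"
    by (simp add: coord_vec_def Finite_Cartesian_Product.vec_eq_iff)
  ultimately show ?thesis by simp
qed

lemma dim_L: "dim L = 48"
proof -
  have "axis i 1 \<in> span L" for i
  proof -
    have "coord_vec p (\<lambda>k. if k = p i then 1 else 0) = axis i 1"
      using p by (auto simp: coord_vec_def axis_def Finite_Cartesian_Product.vec_eq_iff bij_betw_def inj_on_def)
    moreover have "p i < 48" using p by (auto simp: bij_betw_def)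
    ultimately have "(6 / sqrt 3) *\<^sub>R axis i 1 \<in> L" using unit_mem[of "p i"] by simp
    then have "(sqrt 3 / 6) *\<^sub>R (6 / sqrt 3) *\<^sub>R (axis i 1 :: real^48) \<in> span L" by (intro span_scale span_base)
    then show ?thesis by simp
  qed
  then have "Basis \<subseteq> span L" by (auto simp: Basis_vec_def)
  from span_mono[OF this] have "span L = UNIV" by (simp add: top.extremum_unique real_vector.span_span)
  then show ?thesis using dim_eq_full[of L] by simp
qed

text \<open>Products with vectors of the even part are integers: \<open>2 * sqrt 3\<close> times a
  unit vector bounds the denominators, and \<open>sqrt 3\<close> times a sum of two unit vectors
  shows that any two numerators have the same parity.\<close>

lemma integral_coords:
  assumes "y \<in> L"
  obtains Y :: "nat \<Rightarrow> int" where "y = (1 / (2 * sqrt 3)) *\<^sub>R coord_vec p Y"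
    "(\<forall>k<48. even (Y k)) \<or> (\<forall>k<48. odd (Y k))"
proof -
  define i where "i l = (THE i. p i = l)" for l
  have i: "i (p j) = j" for j
    unfolding i_def using p by (intro the_equality) (auto simp: bij_betw_def inj_on_def)
  define Y where "Y l = \<lfloor>2 * sqrt 3 * y $ i l\<rfloor>" for l
  have Y: "of_int (Y l) = 2 * sqrt 3 * y $ i l" if "l < 48" for l
  proof -
    have "inner ((6 / sqrt 3) *\<^sub>R coord_vec p (\<lambda>k. if k = l then 1 else 0)) y \<in> \<int>"
      by (intro integral unit_mem that assms)
    moreover have "6 / sqrt 3 = 2 * sqrt 3" by (simp add: field_simps)
    ultimately have "2 * sqrt 3 * y $ i l \<in> \<int>" by (simp add: inner_unit[OF that] i_def)
    then show ?thesis unfolding Y_def by (elim Ints_cases) simp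
  qed
  have p_less: "p j < 48" for j using p by (auto simp: bij_betw_def)
  have y: "y = (1 / (2 * sqrt 3)) *\<^sub>R coord_vec p Y"
    by (simp add: Finite_Cartesian_Product.vec_eq_iff coord_vec_def Y[OF p_less] i)
  have "even (Y k + Y l)" if "k < 48" "l < 48" for k l
  proof -
    let ?f = "\<lambda>j. 3 * ((if j = k then 1 else 0) + (if j = l then 1 else 0)) :: int"
    have "(\<Sum>j<48. ?f j) = 6" using that by (simp add: sum_distrib_left[symmetric] sum.distrib)
    then have "(1 / sqrt 3) *\<^sub>R coord_vec p ?f \<in> L" by (intro even_mem dual_word_mult3) simp
    then have "inner ((1 / sqrt 3) *\<^sub>R coord_vec p ?f) y \<in> \<int>" by (rule integral[OF _ assms])
    moreover have "coord_vec p ?f = 3 *\<^sub>R (coord_vec p (\<lambda>j. if j = k then 1 else 0) + coord_vec p (\<lambda>j. if j = l then 1 else 0))"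
      by (simp add: coord_vec_def Finite_Cartesian_Product.vec_eq_iff)
    ultimately have "(3 / sqrt 3) * (y $ i k + y $ i l) \<in> \<int>"
      by (simp add: inner_add_left inner_unit[OF that(1)] inner_unit[OF that(2)] i_def)
    moreover have "3 / sqrt 3 = sqrt 3" by (simp add: field_simps)
    ultimately obtain m where m: "sqrt 3 * (y $ i k + y $ i l) = of_int m" by (auto elim: Ints_cases)
    have "of_int (Y k + Y l) = 2 * (sqrt 3 * (y $ i k + y $ i l))"
      using Y that by (simp add: algebra_simps)
    then have "(of_int (Y k + Y l) :: real) = of_int (2 * m)" unfolding m by simp
    then have "Y k + Y l = 2 * m" by (rule of_int_eq_iff[THEN iffD1])
    then show ?thesis by simp
  qed
  from this[of _ 0] have "(\<forall>k<48. even (Y k)) \<or> (\<forall>k<48. odd (Y k))" by (cases "even (Y 0)") auto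
  with y that show ?thesis by blast
qed

lemma dual_word_coords:
  assumes "(1 / (2 * sqrt 3)) *\<^sub>R coord_vec p Y \<in> L"
  shows "dual_word Y"
  unfolding dual_word_def cong_0_iff
proof (intro allI impI)
  fix i :: nat assume i: "i < 24"
  let ?y = "(1 / (2 * sqrt 3)) *\<^sub>R coord_vec p Y" and ?S = "\<Sum>k<48. Y k * R ! i ! k"
  \<comment> \<open>The multiplier 4 makes the coordinate sum even for every row and is invertible
    modulo 3.\<close>
  have "(\<Sum>k<48. 4 * R ! i ! k) = 4 * (\<Sum>k<48. R ! i ! k)" by (simp add: sum_distrib_left)
  then have "(1 / sqrt 3) *\<^sub>R coord_vec p (\<lambda>k. 4 * R ! i ! k) \<in> L"
    by (intro even_mem dual_word_row i) simp
  from integral[OF assms this] obtain m where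
    "inner ?y ((1 / sqrt 3) *\<^sub>R coord_vec p (\<lambda>k. 4 * R ! i ! k)) = of_int m" by (rule Ints_cases)
  moreover have "sqrt 3 * (2 * sqrt 3) = 6" by (simp add: mult.left_commute)
  ultimately have "of_int (\<Sum>k<48. Y k * (4 * R ! i ! k)) / 6 = (of_int m :: real)"
    by (simp add: inner_coord_vec[OF p] del: of_int_sum)
  moreover have "(\<Sum>k<48. Y k * (4 * R ! i ! k)) = 4 * ?S" by (simp add: sum_distrib_left mult_ac)
  ultimately have "(of_int (4 * ?S) :: real) = of_int (6 * m)" by (simp del: of_int_sum)
  then have "4 * ?S = 6 * m" by (rule of_int_eq_iff[THEN iffD1])
  then show "3 dvd ?S" by presburger
qed

lemma even_coords_mem:
  assumes "dual_word F" "\<And>k. k < 48 \<Longrightarrow> even (F k)" "4 dvd (\<Sum>k<48. F k)"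
  shows "(1 / (2 * sqrt 3)) *\<^sub>R coord_vec p F \<in> L"
proof -
  define f where "f k = F k div 2" for k
  have f: "F k = 2 * f k" if "k < 48" for k using assms(2)[OF that] by (simp add: f_def)
  have "(\<Sum>k<48. F k) = 2 * (\<Sum>k<48. f k)" using f by (simp add: sum_distrib_left)
  then have "even (\<Sum>k<48. f k)" using assms(3) by presburger
  then have "(1 / sqrt 3) *\<^sub>R coord_vec p f \<in> L" by (intro even_mem dual_word_half[OF assms(1) f])
  moreover have "coord_vec p F = 2 *\<^sub>R coord_vec p f"
  proof -
    have "p i < 48" for i using p by (auto simp: bij_betw_def)
    then show ?thesis using f by (simp add: coord_vec_def Finite_Cartesian_Product.vec_eq_iff)
  qed
  ultimately show ?thesis by simp
qed

text \<open>If all numerators were even, \<open>sqrt 3\<close> times a unit vector would have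
  integral products with \<open>L\<close> and would lie in \<open>L\<close> by self-duality; but its
  norm 3 is odd.\<close>

lemma odd_coords_exist:
  obtains Y where "(1 / (2 * sqrt 3)) *\<^sub>R coord_vec p Y \<in> L" "\<forall>k<48. odd (Y k)"
proof (rule ccontr)
  assume no: "\<not> thesis"
  have delta: "(\<Sum>k<48. (if k = 0 then 1 else 0) * g k) = g 0" for g :: "nat \<Rightarrow> int"
    by (simp add: if_distrib[of "\<lambda>x. x * _"] cong: if_cong)
  note odd_mem = that
  let ?e = "sqrt 3 *\<^sub>R coord_vec p (\<lambda>k. if k = 0 then 1 else 0)"
  have "inner ?e y \<in> \<int>" if "y \<in> L" for y
  proof -
    obtain Y :: "nat \<Rightarrow> int" where Y: "y = (1 / (2 * sqrt 3)) *\<^sub>R coord_vec p Y"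
      "(\<forall>k<48. even (Y k)) \<or> (\<forall>k<48. odd (Y k))"
      using integral_coords[OF \<open>y \<in> L\<close>] .
    then have "even (Y 0)" using no odd_mem[of Y] \<open>y \<in> L\<close> by auto
    then obtain m where m: "Y 0 = 2 * m" by (rule evenE)
    have "inner ?e y = of_int (\<Sum>k<48. (if k = 0 then 1 else 0) * Y k) / 2"
      unfolding Y(1) by (simp add: inner_coord_vec[OF p] del: of_int_sum)
    then show ?thesis unfolding delta m by simp
  qed
  then have "?e \<in> L" by (intro unimodular_self_dual[OF unimodular_L]) (simp_all add: dim_L)
  then obtain k :: int where k: "inner ?e ?e = 2 * of_int k" using norm_L by blast
  have "inner ?e ?e = of_int 3"
    by (simp add: inner_coord_vec[OF p] delta mult.assoc[symmetric] del: of_int_sum)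
  then have "(of_int 3 :: real) = of_int (2 * k)" using k by simp
  then have "3 = 2 * k" by (rule of_int_eq_iff[THEN iffD1])
  then show False by presburger
qed

text \<open>The vector with all coordinates \<open>1 / (2 * sqrt 3)\<close> has norm 4, so it is not in \<open>L\<close>. This determines
  which of the two glue classes with half-integral coordinates belongs to \<open>L\<close>.\<close>

lemma odd_coords_mem:
  assumes ones: "dual_word (\<lambda>_. 1)"
    and F: "dual_word F" "\<And>k. k < 48 \<Longrightarrow> odd (F k)" "[(\<Sum>k<48. F k) = 2] (mod 4)"
  shows "(1 / (2 * sqrt 3)) *\<^sub>R coord_vec p F \<in> L"
proof -
  let ?v = "\<lambda>f. (1 / (2 * sqrt 3)) *\<^sub>R coord_vec p f"
  have diff: "?v f - ?v g = ?v (\<lambda>k. f k - g k)" for f g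
    unfolding coord_vec_diff[symmetric] by (simp add: scaleR_diff_right)
  obtain Y where Y: "?v Y \<in> L" "\<forall>k<48. odd (Y k)" using odd_coords_exist .
  have dY: "dual_word Y" by (rule dual_word_coords[OF Y(1)])
  \<comment> \<open>Otherwise \<open>Y\<close> and the all-ones word would differ by a vector of
    \<open>L\<close>, putting the vector of norm 48/12 = 4 into \<open>L\<close>.\<close>
  have not4: "\<not> 4 dvd (\<Sum>k<48. Y k - 1)"
  proof
    assume "4 dvd (\<Sum>k<48. Y k - 1)"
    then have "?v (\<lambda>k. Y k - 1) \<in> L"
      using Y(2) by (intro even_coords_mem dual_word_diff dY ones) auto
    then have "?v Y - ?v (\<lambda>_. 1) \<in> L" by (simp add: diff)
    from diff_mem[OF Y(1) this] have one: "?v (\<lambda>_. 1) \<in> L" by simp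
    have "inner (?v (\<lambda>_. 1)) (?v (\<lambda>_. 1)) = 4"
      by (simp add: inner_coord_vec[OF p])
    moreover from this have "?v (\<lambda>_. 1) \<in> L - {0}" using one by force
    then have "6 \<le> inner (?v (\<lambda>_. 1)) (?v (\<lambda>_. 1))"
      using min_L unfolding has_minimum_def by blast
    ultimately show False by simp
  qed
  have "even (\<Sum>k<48. Y k - 1)" using Y(2) by (intro dvd_sum) auto
  moreover have "[t = 2] (mod 4)" if ev: "even t" and n4: "\<not> 4 dvd t" for t :: int
  proof -
    obtain m where m: "t = 2 * m" using ev by (rule evenE)
    with n4 have "odd m" by auto
    then obtain l where "m = 2 * l + 1" by (rule oddE)
    with m show ?thesis by (simp add: cong_def)
  qed
  ultimately have "[(\<Sum>k<48. Y k - 1) = 2] (mod 4)" using not4 by blast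
  \<comment> \<open>The 48 ones vanish modulo 4, so \<open>Y\<close> and \<open>F\<close> have the
    same coordinate sum modulo 4 and their difference falls under
    \<open>even_coords_mem\<close>.\<close>
  then have "[(\<Sum>k<48. Y k) = 2] (mod 4)" by (simp add: sum_subtractf cong_def) presburger
  then have "4 dvd (\<Sum>k<48. F k - Y k)"
    using cong_diff[OF F(3), of "\<Sum>k<48. Y k" 2] by (simp add: sum_subtractf cong_0_iff)
  then have "?v (\<lambda>k. F k - Y k) \<in> L"
    using F(2) Y(2) by (intro even_coords_mem dual_word_diff F(1) dY) auto
  then have "?v F - ?v Y \<in> L" by (simp add: diff)
  from add_mem[OF this Y(1)] show ?thesis by simp
qed

end

section \<open>Explicit generators and sections\<close>

text \<open>The tabulated matrix \<open>[I | S]\<close>; \<open>pless_gen_check\<close> compares its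
  right half with the quadratic character.\<close>

definition pless_gen :: "int list list" where
  "pless_gen =
    [[1,0,0,0,0,0,0,0,0,0,0,0,0,0,0,0,0,0,0,0,0,0,0,0,0,1,1,1,1,1,1,1,1,1,1,1,1,1,1,1,1,1,1,1,1,1,
      1,1],
     [0,1,0,0,0,0,0,0,0,0,0,0,0,0,0,0,0,0,0,0,0,0,0,0,-1,0,1,1,1,1,-1,1,-1,1,1,-1,-1,1,1,-1,-1,1,
      -1,1,-1,-1,-1,-1],
     [0,0,1,0,0,0,0,0,0,0,0,0,0,0,0,0,0,0,0,0,0,0,0,0,-1,-1,0,1,1,1,1,-1,1,-1,1,1,-1,-1,1,1,-1,-1,
      1,-1,1,-1,-1,-1],
     [0,0,0,1,0,0,0,0,0,0,0,0,0,0,0,0,0,0,0,0,0,0,0,0,-1,-1,-1,0,1,1,1,1,-1,1,-1,1,1,-1,-1,1,1,-1,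
      -1,1,-1,1,-1,-1],
     [0,0,0,0,1,0,0,0,0,0,0,0,0,0,0,0,0,0,0,0,0,0,0,0,-1,-1,-1,-1,0,1,1,1,1,-1,1,-1,1,1,-1,-1,1,1,
      -1,-1,1,-1,1,-1],
     [0,0,0,0,0,1,0,0,0,0,0,0,0,0,0,0,0,0,0,0,0,0,0,0,-1,-1,-1,-1,-1,0,1,1,1,1,-1,1,-1,1,1,-1,-1,1,
      1,-1,-1,1,-1,1],
     [0,0,0,0,0,0,1,0,0,0,0,0,0,0,0,0,0,0,0,0,0,0,0,0,-1,1,-1,-1,-1,-1,0,1,1,1,1,-1,1,-1,1,1,-1,-1,
      1,1,-1,-1,1,-1],
     [0,0,0,0,0,0,0,1,0,0,0,0,0,0,0,0,0,0,0,0,0,0,0,0,-1,-1,1,-1,-1,-1,-1,0,1,1,1,1,-1,1,-1,1,1,-1,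
      -1,1,1,-1,-1,1],
     [0,0,0,0,0,0,0,0,1,0,0,0,0,0,0,0,0,0,0,0,0,0,0,0,-1,1,-1,1,-1,-1,-1,-1,0,1,1,1,1,-1,1,-1,1,1,
      -1,-1,1,1,-1,-1],
     [0,0,0,0,0,0,0,0,0,1,0,0,0,0,0,0,0,0,0,0,0,0,0,0,-1,-1,1,-1,1,-1,-1,-1,-1,0,1,1,1,1,-1,1,-1,1,
      1,-1,-1,1,1,-1],
     [0,0,0,0,0,0,0,0,0,0,1,0,0,0,0,0,0,0,0,0,0,0,0,0,-1,-1,-1,1,-1,1,-1,-1,-1,-1,0,1,1,1,1,-1,1,
      -1,1,1,-1,-1,1,1],
     [0,0,0,0,0,0,0,0,0,0,0,1,0,0,0,0,0,0,0,0,0,0,0,0,-1,1,-1,-1,1,-1,1,-1,-1,-1,-1,0,1,1,1,1,-1,1,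
      -1,1,1,-1,-1,1],
     [0,0,0,0,0,0,0,0,0,0,0,0,1,0,0,0,0,0,0,0,0,0,0,0,-1,1,1,-1,-1,1,-1,1,-1,-1,-1,-1,0,1,1,1,1,-1,
      1,-1,1,1,-1,-1],
     [0,0,0,0,0,0,0,0,0,0,0,0,0,1,0,0,0,0,0,0,0,0,0,0,-1,-1,1,1,-1,-1,1,-1,1,-1,-1,-1,-1,0,1,1,1,1,
      -1,1,-1,1,1,-1],
     [0,0,0,0,0,0,0,0,0,0,0,0,0,0,1,0,0,0,0,0,0,0,0,0,-1,-1,-1,1,1,-1,-1,1,-1,1,-1,-1,-1,-1,0,1,1,
      1,1,-1,1,-1,1,1],
     [0,0,0,0,0,0,0,0,0,0,0,0,0,0,0,1,0,0,0,0,0,0,0,0,-1,1,-1,-1,1,1,-1,-1,1,-1,1,-1,-1,-1,-1,0,1,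
      1,1,1,-1,1,-1,1],
     [0,0,0,0,0,0,0,0,0,0,0,0,0,0,0,0,1,0,0,0,0,0,0,0,-1,1,1,-1,-1,1,1,-1,-1,1,-1,1,-1,-1,-1,-1,0,
      1,1,1,1,-1,1,-1],
     [0,0,0,0,0,0,0,0,0,0,0,0,0,0,0,0,0,1,0,0,0,0,0,0,-1,-1,1,1,-1,-1,1,1,-1,-1,1,-1,1,-1,-1,-1,-1,
      0,1,1,1,1,-1,1],
     [0,0,0,0,0,0,0,0,0,0,0,0,0,0,0,0,0,0,1,0,0,0,0,0,-1,1,-1,1,1,-1,-1,1,1,-1,-1,1,-1,1,-1,-1,-1,
      -1,0,1,1,1,1,-1],
     [0,0,0,0,0,0,0,0,0,0,0,0,0,0,0,0,0,0,0,1,0,0,0,0,-1,-1,1,-1,1,1,-1,-1,1,1,-1,-1,1,-1,1,-1,-1,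
      -1,-1,0,1,1,1,1],
     [0,0,0,0,0,0,0,0,0,0,0,0,0,0,0,0,0,0,0,0,1,0,0,0,-1,1,-1,1,-1,1,1,-1,-1,1,1,-1,-1,1,-1,1,-1,
      -1,-1,-1,0,1,1,1],
     [0,0,0,0,0,0,0,0,0,0,0,0,0,0,0,0,0,0,0,0,0,1,0,0,-1,1,1,-1,1,-1,1,1,-1,-1,1,1,-1,-1,1,-1,1,-1,
      -1,-1,-1,0,1,1],
     [0,0,0,0,0,0,0,0,0,0,0,0,0,0,0,0,0,0,0,0,0,0,1,0,-1,1,1,1,-1,1,-1,1,1,-1,-1,1,1,-1,-1,1,-1,1,
      -1,-1,-1,-1,0,1],
     [0,0,0,0,0,0,0,0,0,0,0,0,0,0,0,0,0,0,0,0,0,0,0,1,-1,1,1,1,1,-1,1,-1,1,1,-1,-1,1,1,-1,-1,1,-1,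
      1,-1,-1,-1,-1,0]]"

text \<open>The vectors of the sections were found by computer search. These are the coordinates of a basis of
  \<open>K\<^sub>1\<^sub>0\<close> in \<open>P\<^sub>4\<^sub>8\<^sub>p\<close>, multiplied by \<open>sqrt 3\<close>.\<close>

definition pless_sections :: "int list list" where
  "pless_sections =
    [[0,0,0,1,0,0,0,-1,-1,-1,0,0,0,1,0,0,0,0,0,-1,0,0,0,0,-1,0,1,0,0,-1,0,0,-1,0,-1,1,1,-1,0,-1,-1,
      0,0,0,-1,0,0,1],
     [-1,0,0,-1,0,0,0,1,1,0,0,0,1,0,0,0,0,0,0,1,0,0,0,0,0,0,-1,0,-1,1,0,0,1,0,0,1,-1,0,-1,1,0,1,1,
      0,1,0,1,0],
     [-1,0,0,-2,0,0,-1,1,1,1,1,0,1,0,0,0,0,0,0,0,1,0,0,0,0,0,-1,0,0,1,-1,-1,0,0,0,0,0,0,0,1,0,0,0,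
      0,0,0,0,-1],
     [0,0,0,0,0,0,1,1,0,0,-1,0,0,-1,0,0,0,0,0,1,-1,0,0,0,0,0,-1,0,-1,1,0,0,1,1,1,0,-1,0,0,0,1,1,0,
      1,0,1,1,0],
     [-1,0,0,-1,-1,0,-1,0,0,0,0,0,0,0,0,0,0,0,0,0,0,0,0,0,0,0,-1,1,-1,1,0,-1,1,1,1,0,-1,0,0,1,1,0,
      0,1,0,0,1,-1],
     [0,0,0,0,0,0,0,0,1,0,-1,0,0,-1,0,0,0,0,0,1,0,0,0,0,0,-1,0,1,-1,0,1,0,1,1,1,0,-1,0,0,1,1,0,1,0,
      1,-1,1,0],
     [0,0,0,0,-1,0,0,0,0,-1,-1,0,-1,0,0,0,0,0,0,1,-1,0,0,0,1,0,-1,0,0,1,0,0,1,0,0,0,-1,0,-1,1,1,0,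
      1,0,1,0,1,-1],
     [1,0,0,1,1,0,1,0,0,-1,-1,0,0,0,0,0,0,0,0,1,-1,0,0,0,-1,0,0,0,0,-1,0,0,0,0,-1,1,1,-1,-1,0,-1,0,
      1,0,0,0,0,1],
     [-1,-1,-1,-1,0,0,-1,0,1,0,0,0,0,0,0,0,0,1,0,1,0,0,1,0,0,0,-1,0,1,0,-1,0,0,0,0,-1,0,0,0,1,-1,
      -1,0,-1,0,0,0,-1],
     [0,-1,-1,-1,1,-1,1,0,0,0,0,0,0,0,0,0,0,0,0,0,0,0,0,0,-1,0,-1,0,0,0,-1,0,-1,1,-1,-1,1,0,1,0,-1,
      0,0,0,-1,1,0,0]]"

text \<open>Systematic generators; the last column is the overall parity check, as
  \<open>qr_gen_sums\<close> confirms.\<close>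

definition qr_gen :: "int list list" where
  "qr_gen =
    [[1,0,0,0,0,0,0,0,0,0,0,0,0,0,0,0,0,0,0,0,0,0,0,0,-1,-1,-1,0,0,-1,-1,-1,0,-1,1,0,1,0,0,-1,0,1,
      -1,0,1,0,0,1],
     [0,1,0,0,0,0,0,0,0,0,0,0,0,0,0,0,0,0,0,0,0,0,0,0,0,-1,-1,-1,0,0,-1,-1,-1,0,-1,1,0,1,0,0,-1,0,
      1,-1,0,1,0,1],
     [0,0,1,0,0,0,0,0,0,0,0,0,0,0,0,0,0,0,0,0,0,0,0,0,0,0,-1,-1,-1,0,0,-1,-1,-1,0,-1,1,0,1,0,0,-1,
      0,1,-1,0,1,1],
     [0,0,0,1,0,0,0,0,0,0,0,0,0,0,0,0,0,0,0,0,0,0,0,0,1,1,1,-1,-1,0,1,1,-1,0,1,0,1,1,0,-1,0,-1,0,0,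
      0,-1,0,0],
     [0,0,0,0,1,0,0,0,0,0,0,0,0,0,0,0,0,0,0,0,0,0,0,0,0,1,1,1,-1,-1,0,1,1,-1,0,1,0,1,1,0,-1,0,-1,0,
      0,0,-1,0],
     [0,0,0,0,0,1,0,0,0,0,0,0,0,0,0,0,0,0,0,0,0,0,0,0,-1,-1,0,1,1,1,1,-1,1,0,0,0,-1,0,1,0,0,0,-1,
      -1,1,0,0,1],
     [0,0,0,0,0,0,1,0,0,0,0,0,0,0,0,0,0,0,0,0,0,0,0,0,0,-1,-1,0,1,1,1,1,-1,1,0,0,0,-1,0,1,0,0,0,-1,
      -1,1,0,1],
     [0,0,0,0,0,0,0,1,0,0,0,0,0,0,0,0,0,0,0,0,0,0,0,0,0,0,-1,-1,0,1,1,1,1,-1,1,0,0,0,-1,0,1,0,0,0,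
      -1,-1,1,1],
     [0,0,0,0,0,0,0,0,1,0,0,0,0,0,0,0,0,0,0,0,0,0,0,0,1,1,1,-1,-1,1,-1,-1,1,-1,1,1,-1,0,0,0,0,0,1,
      0,-1,-1,-1,0],
     [0,0,0,0,0,0,0,0,0,1,0,0,0,0,0,0,0,0,0,0,0,0,0,0,-1,0,0,1,-1,1,0,1,-1,0,0,1,-1,-1,0,-1,0,1,-1,
      1,1,-1,-1,1],
     [0,0,0,0,0,0,0,0,0,0,1,0,0,0,0,0,0,0,0,0,0,0,0,0,-1,1,-1,0,1,1,0,-1,1,1,1,0,-1,-1,-1,-1,-1,1,
      0,-1,-1,1,-1,-1],
     [0,0,0,0,0,0,0,0,0,0,0,1,0,0,0,0,0,0,0,0,0,0,0,0,-1,1,0,-1,0,0,0,-1,-1,0,-1,1,1,-1,-1,1,-1,0,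
      0,0,0,-1,1,0],
     [0,0,0,0,0,0,0,0,0,0,0,0,1,0,0,0,0,0,0,0,0,0,0,0,1,0,-1,0,-1,1,1,1,-1,0,-1,-1,0,1,-1,0,1,1,1,
      0,-1,0,-1,-1],
     [0,0,0,0,0,0,0,0,0,0,0,0,0,1,0,0,0,0,0,0,0,0,0,0,-1,0,-1,-1,0,1,0,0,1,1,1,-1,0,0,1,1,0,-1,0,1,
      1,-1,0,0],
     [0,0,0,0,0,0,0,0,0,0,0,0,0,0,1,0,0,0,0,0,0,0,0,0,0,-1,0,-1,-1,0,1,0,0,1,1,1,-1,0,0,1,1,0,-1,0,
      1,1,-1,0],
     [0,0,0,0,0,0,0,0,0,0,0,0,0,0,0,1,0,0,0,0,0,0,0,0,-1,-1,1,0,-1,1,-1,0,0,-1,-1,1,-1,-1,0,-1,1,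
      -1,-1,-1,1,1,1,1],
     [0,0,0,0,0,0,0,0,0,0,0,0,0,0,0,0,1,0,0,0,0,0,0,0,1,0,0,1,0,0,-1,0,0,1,1,-1,0,-1,-1,1,-1,0,0,
      -1,1,1,1,0],
     [0,0,0,0,0,0,0,0,0,0,0,0,0,0,0,0,0,1,0,0,0,0,0,0,1,-1,1,0,1,1,1,0,0,1,0,1,1,0,-1,0,1,1,1,0,1,
      1,1,-1],
     [0,0,0,0,0,0,0,0,0,0,0,0,0,0,0,0,0,0,1,0,0,0,0,0,1,-1,0,1,0,-1,-1,-1,0,1,0,0,0,1,0,0,0,0,-1,1,
      -1,1,1,1],
     [0,0,0,0,0,0,0,0,0,0,0,0,0,0,0,0,0,0,0,1,0,0,0,0,1,-1,0,0,1,1,0,0,-1,1,0,0,-1,0,1,1,0,-1,1,-1,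
      0,-1,1,0],
     [0,0,0,0,0,0,0,0,0,0,0,0,0,0,0,0,0,0,0,0,1,0,0,0,1,-1,0,0,0,-1,-1,1,0,0,0,0,-1,-1,0,-1,1,-1,0,
      1,1,0,-1,-1],
     [0,0,0,0,0,0,0,0,0,0,0,0,0,0,0,0,0,0,0,0,0,1,0,0,-1,0,1,0,0,-1,1,1,1,-1,1,0,1,-1,-1,-1,-1,-1,
      1,0,-1,1,0,0],
     [0,0,0,0,0,0,0,0,0,0,0,0,0,0,0,0,0,0,0,0,0,0,1,0,0,-1,0,1,0,0,-1,1,1,1,-1,1,0,1,-1,-1,-1,-1,
      -1,1,0,-1,1,0],
     [0,0,0,0,0,0,0,0,0,0,0,0,0,0,0,0,0,0,0,0,0,0,0,1,1,1,0,0,1,1,1,0,1,-1,0,-1,0,0,1,0,-1,1,0,-1,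
      0,0,-1,-1]]"

text \<open>The first 47 entries of row \<open>i\<close> of \<open>qr_gen\<close> are the product of the polynomials \<open>qr_quotients ! i\<close> and
  \<open>qr_factor\<close> modulo 3, where \<open>x ^ 47 - 1\<close> is \<open>x - 1\<close> times \<open>qr_factor\<close> times its reversal, up to sign.
  Coefficients are listed from the constant term upwards.\<close>

definition qr_quotients :: "int list list" where
  "qr_quotients =
    [[-1,1,0,-1,1,1,1,1,1,-1,0,-1,1,-1,-1,-1,1,0,0,-1,0,1,0,0],
     [0,-1,1,0,-1,1,1,1,1,1,-1,0,-1,1,-1,-1,-1,1,0,0,-1,0,1,0],
     [0,0,-1,1,0,-1,1,1,1,1,1,-1,0,-1,1,-1,-1,-1,1,0,0,-1,0,1],
     [0,0,0,-1,1,0,-1,1,1,1,1,1,-1,0,-1,1,-1,-1,-1,1,0,0,-1,0],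
     [0,0,0,0,-1,1,0,-1,1,1,1,1,1,-1,0,-1,1,-1,-1,-1,1,0,0,-1],
     [0,0,0,0,0,-1,1,0,-1,1,1,1,1,1,-1,0,-1,1,-1,-1,-1,1,0,0],
     [0,0,0,0,0,0,-1,1,0,-1,1,1,1,1,1,-1,0,-1,1,-1,-1,-1,1,0],
     [0,0,0,0,0,0,0,-1,1,0,-1,1,1,1,1,1,-1,0,-1,1,-1,-1,-1,1],
     [0,0,0,0,0,0,0,0,-1,1,0,-1,1,1,1,1,1,-1,0,-1,1,-1,-1,-1],
     [0,0,0,0,0,0,0,0,0,-1,1,0,-1,1,1,1,1,1,-1,0,-1,1,-1,-1],
     [0,0,0,0,0,0,0,0,0,0,-1,1,0,-1,1,1,1,1,1,-1,0,-1,1,-1],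
     [0,0,0,0,0,0,0,0,0,0,0,-1,1,0,-1,1,1,1,1,1,-1,0,-1,1],
     [0,0,0,0,0,0,0,0,0,0,0,0,-1,1,0,-1,1,1,1,1,1,-1,0,-1],
     [0,0,0,0,0,0,0,0,0,0,0,0,0,-1,1,0,-1,1,1,1,1,1,-1,0],
     [0,0,0,0,0,0,0,0,0,0,0,0,0,0,-1,1,0,-1,1,1,1,1,1,-1],
     [0,0,0,0,0,0,0,0,0,0,0,0,0,0,0,-1,1,0,-1,1,1,1,1,1],
     [0,0,0,0,0,0,0,0,0,0,0,0,0,0,0,0,-1,1,0,-1,1,1,1,1],
     [0,0,0,0,0,0,0,0,0,0,0,0,0,0,0,0,0,-1,1,0,-1,1,1,1],
     [0,0,0,0,0,0,0,0,0,0,0,0,0,0,0,0,0,0,-1,1,0,-1,1,1],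
     [0,0,0,0,0,0,0,0,0,0,0,0,0,0,0,0,0,0,0,-1,1,0,-1,1],
     [0,0,0,0,0,0,0,0,0,0,0,0,0,0,0,0,0,0,0,0,-1,1,0,-1],
     [0,0,0,0,0,0,0,0,0,0,0,0,0,0,0,0,0,0,0,0,0,-1,1,0],
     [0,0,0,0,0,0,0,0,0,0,0,0,0,0,0,0,0,0,0,0,0,0,-1,1],
     [0,0,0,0,0,0,0,0,0,0,0,0,0,0,0,0,0,0,0,0,0,0,0,-1]]"

definition qr_factor :: "int list" where
  "qr_factor = [-1,-1,-1,0,0,-1,-1,-1,0,-1,1,0,1,0,0,-1,0,1,-1,0,1,0,0,1]"

text \<open>Coordinates of a basis of \<open>K\<^sub>1\<^sub>0\<close> in \<open>P\<^sub>4\<^sub>8\<^sub>q\<close>, multiplied by \<open>2 * sqrt 3\<close>; rows with odd entries lie in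
  the glue class.\<close>

definition qr_sections :: "int list list" where
  "qr_sections =
    [[-2,0,2,0,0,0,0,2,2,0,-2,0,0,-2,0,2,-2,2,0,0,0,0,-2,0,0,0,2,-2,0,0,0,0,2,0,2,0,0,0,2,0,0,-2,0,
      0,0,0,-2,-2],
     [1,-1,-1,1,1,-1,1,1,-1,-1,1,-1,1,1,-1,-1,1,-1,-3,1,1,1,1,1,1,-1,-1,3,1,1,-1,1,-1,-1,-3,1,-1,1,
      1,1,-1,1,1,-1,-1,1,1,1],
     [1,-1,-1,-1,1,1,-1,1,-1,-1,1,-1,1,3,-1,1,1,-1,-1,1,-1,-1,1,1,1,1,-3,1,1,1,-1,1,-1,1,-1,1,-1,
      -1,1,-1,1,3,-1,-1,-1,1,1,1],
     [1,-1,-1,1,-1,-1,1,-1,-1,-1,1,1,-1,1,1,-1,1,-1,-1,-1,3,1,1,1,-1,1,1,1,1,-1,-1,-1,-3,-1,-3,-1,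
      -1,1,-1,1,-1,-1,1,-1,-1,1,1,1],
     [-1,-1,1,1,1,1,1,1,-1,-1,1,1,-1,3,-1,-1,1,-1,-1,-1,1,1,1,1,1,1,-1,1,1,1,-1,-1,-3,1,-3,1,1,-1,
      -1,-1,1,1,1,-1,-1,1,1,1],
     [0,0,0,2,0,0,2,0,-2,0,2,2,0,0,0,-2,0,-2,-2,0,0,2,0,2,0,-2,0,2,0,0,0,0,-2,0,-2,0,0,0,-2,0,0,0,
      2,0,0,-2,0,2],
     [-1,-1,-1,1,1,-1,1,-1,1,-1,1,1,-1,1,-1,-3,1,-1,-1,-1,1,1,1,-1,1,-1,-1,3,-1,-1,-1,-1,-1,-1,-3,
      1,1,1,-1,-1,-1,-1,1,1,1,1,1,1],
     [-1,-1,-1,1,-1,-3,-1,1,1,-1,-1,1,1,-3,1,1,-1,1,-1,1,1,1,-1,1,-1,-1,1,1,-1,-1,-1,1,1,-1,1,1,-1,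
      1,1,1,-1,-3,1,1,1,-1,-1,-1],
     [-2,-2,-2,-2,0,-2,0,0,0,0,0,-2,0,0,0,0,0,-2,0,0,-2,0,0,0,0,0,-4,0,0,0,0,0,0,2,0,2,0,0,0,-2,0,
      2,0,0,0,0,2,2],
     [-2,-2,-2,-2,-2,0,-2,0,0,0,0,0,0,0,0,2,0,0,0,0,0,0,0,0,-2,0,0,-2,2,-2,-2,0,0,2,2,0,-2,0,2,0,0,
      0,0,0,-2,0,2,0]]"

text \<open>Coordinates with respect to the basis with Gram matrix \<open>P48n_gram\<close>, and their products with that
  matrix.\<close>

definition P48n_sections :: "int list list" where
  "P48n_sections =
    [[-1,0,0,0,0,0,0,0,0,0,0,0,0,0,0,0,0,0,0,0,0,0,0,0,0,0,0,0,0,0,0,0,0,0,0,0,0,0,0,0,0,0,0,0,0,0,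
      0,0],
     [0,2,4,3,1,0,1,0,0,-3,-4,-1,-1,-1,1,2,4,3,2,2,1,2,-1,-2,-3,-4,-2,-1,1,2,1,3,4,3,2,-1,-1,-1,-2,
      -3,-2,1,1,0,0,0,2,3],
     [-5,0,2,2,1,-3,1,2,3,1,-4,1,1,-5,0,-4,1,2,-2,2,-1,4,4,-1,2,-3,-4,1,-2,2,-3,-2,3,-1,4,-1,-1,4,
      0,-2,-2,-1,3,-2,-2,-3,-1,5],
     [6,-2,-1,0,-2,5,-2,-3,-1,-2,3,-1,-1,6,-1,5,-1,-3,4,-4,1,-3,-5,3,-3,2,5,-4,4,-1,2,4,-4,2,-4,0,
      1,-6,2,2,0,3,-4,2,3,0,1,-5],
     [1,-5,-3,1,-1,1,-1,-3,2,3,1,1,1,2,-2,-2,-3,-4,1,-2,-2,1,0,4,3,1,3,-3,0,1,-2,-1,-4,-2,-1,0,1,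
      -1,4,4,-2,1,-1,0,2,-3,-4,-2],
     [7,-2,-1,0,-2,5,-1,-4,-1,-2,3,-1,-1,6,-1,5,-1,-3,5,-3,2,-2,-5,3,-3,2,5,-4,4,-1,3,4,-3,2,-4,1,
      1,-6,2,2,0,3,-4,2,4,2,1,-4],
     [-5,-1,0,3,3,-4,3,1,2,3,-6,0,0,-5,0,-6,2,2,-2,5,-3,5,4,-2,4,-5,-4,0,-6,3,-4,-3,4,-1,6,0,0,5,
      -1,0,-4,-3,4,-2,-1,-2,-3,5],
     [0,3,2,2,2,0,2,0,-2,-2,-3,-2,-1,-1,2,2,4,3,1,3,0,0,-1,-4,-2,-3,-2,1,-1,2,2,2,5,2,2,0,-1,-1,-4,
      -2,-1,-1,2,0,1,3,2,2],
     [0,0,0,0,0,0,0,0,0,0,0,0,0,0,0,0,0,0,0,0,0,0,0,0,0,0,-1,0,0,0,0,0,0,0,0,0,0,0,0,0,0,0,0,0,0,0,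
      0,0],
     [0,1,0,0,0,0,-1,0,-1,0,1,0,1,1,1,1,0,0,-1,-1,-1,-2,0,-1,0,1,0,2,1,1,1,0,0,-1,-1,-1,-1,-1,-1,0,
      1,0,1,0,0,0,0,-1]]"

definition P48n_products :: "int list list" where
  "P48n_products =
    [[-6,1,2,1,-1,-1,0,0,1,-1,1,-1,0,1,0,0,-1,1,0,0,1,0,-1,-1,1,0,2,-1,-2,0,2,0,-1,-1,0,2,0,-2,-1,
      2,0,1,-1,-1,0,1,0,0],
     [3,0,-1,0,1,0,-1,0,1,0,-1,0,0,-1,0,0,0,-1,-1,2,-1,0,0,1,0,0,-1,0,2,0,0,-1,1,2,-1,-1,0,1,0,-1,
      0,0,0,-1,1,-1,0,-1],
     [3,0,-1,0,-1,0,0,1,0,-1,-1,1,1,-2,0,-1,1,0,0,1,-1,-1,1,2,0,0,-3,1,3,0,-1,0,0,1,0,-1,0,-1,0,1,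
      0,-1,-1,0,1,0,-1,0],
     [3,0,-2,0,2,1,-1,0,0,1,0,-1,0,0,0,1,-1,-1,0,1,-2,0,1,0,-1,-1,1,0,1,0,-1,0,1,1,0,-1,0,2,1,-2,0,
      0,1,0,-1,-1,1,0],
     [3,-1,-1,0,0,0,-1,1,-1,1,-1,0,0,-1,1,0,0,-2,1,2,-1,-1,1,1,0,0,-1,0,2,0,0,0,0,1,0,-1,0,1,0,-1,
      0,0,0,0,0,-1,0,1],
     [3,-1,-1,0,1,1,-2,0,0,2,-1,-1,0,1,1,-1,0,-1,0,1,-1,1,0,0,0,0,0,-1,1,0,0,-1,1,1,-1,0,0,2,0,-3,
      1,1,1,-1,0,0,1,0],
     [3,-1,0,-1,2,-1,0,0,0,1,-1,0,-1,1,0,0,0,-2,0,1,0,-1,0,0,0,0,-1,0,1,0,-1,0,1,1,-1,0,0,2,0,-1,0,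
      0,1,0,1,-2,1,0],
     [-3,1,1,1,1,0,-1,-1,2,0,1,-2,0,1,0,0,-1,0,-1,0,0,1,-2,-1,1,0,1,-1,-1,0,1,-1,1,0,-1,2,0,0,-1,1,
      0,1,0,-1,0,0,2,-1],
     [2,0,1,-1,-1,0,1,0,0,1,-1,0,0,1,0,-1,1,-1,1,0,0,-1,-1,1,2,1,-6,1,2,1,-1,-1,0,0,1,-1,1,-1,0,1,
      0,0,-1,1,0,0,1,0],
     [-1,1,0,0,0,0,0,0,1,0,0,-2,0,3,-1,-1,-1,1,1,0,-1,-1,1,0,1,0,-2,1,1,1,-1,0,0,-1,1,0,1,-2,0,0,0,
      1,-1,-1,-1,1,1,0]]"

section \<open>Evaluation of the tables\<close>

fun dot :: "int list \<Rightarrow> int list \<Rightarrow> int" where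
  "dot (x # xs) (y # ys) = x * y + dot xs ys"
| "dot xs ys = 0"

lemma dot_eq_sum: "length xs = n \<Longrightarrow> length ys = n \<Longrightarrow> dot xs ys = (\<Sum>k<n. xs ! k * ys ! k)"
proof (induction xs ys arbitrary: n rule: dot.induct)
  case (1 x xs y ys)
  then show ?case by (cases n) (simp_all add: sum.lessThan_Suc_shift del: sum.lessThan_Suc)
qed auto

definition unit_rows :: "int \<Rightarrow> int list list" where
  "unit_rows c = map (\<lambda>i. map (\<lambda>j. if i = j then c else 0) [0..<24]) [0..<24]"

definition right_columns :: "int list list \<Rightarrow> int list list" where
  "right_columns R = map (\<lambda>j. map (\<lambda>r. r ! (24 + j)) R) [0..<24]"

definition dots_mod3 :: "int list list \<Rightarrow> int list list" where
  "dots_mod3 A = map (\<lambda>x. map (\<lambda>y. dot x y mod 3) A) A"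

text \<open>The congruences of \<open>ternary_code\<close> in a form for evaluation; in the
  condition \<open>B\<^sup>T B = -I\<close> on the right half, 2 stands for -1 modulo 3.\<close>

definition generator_check :: "int list list \<Rightarrow> bool" where
  "generator_check R \<longleftrightarrow>
    length R = 24 \<and> (\<forall>r\<in>set R. length r = 48) \<and> map (take 24) R = unit_rows 1 \<and>
    dots_mod3 R = unit_rows 0 \<and> dots_mod3 (right_columns R) = unit_rows 2"

text \<open>\<open>c\<close> is the square of the common denominator of the tabulated coordinates: 3
  for \<open>sqrt 3\<close> and 12 for \<open>2 * sqrt 3\<close>.\<close>

definition sections_check :: "int \<Rightarrow> int list list \<Rightarrow> int list list \<Rightarrow> bool" where
  "sections_check c R V \<longleftrightarrow>
    length V = 10 \<and> (\<forall>v\<in>set V. length v = 48 \<and> (\<forall>r\<in>set R. dot v r mod 3 = 0)) \<and>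
    map (\<lambda>v. map (dot v) V) V = map (map ((*) c)) K10_rows"

lemma pless_generator_check: "generator_check pless_gen"
  by code_simp

lemma qr_generator_check: "generator_check qr_gen"
  by code_simp

lemma pless_sections_check: "sections_check 3 pless_gen pless_sections"
  by code_simp

lemma qr_sections_check: "sections_check 12 qr_gen qr_sections"
  by code_simp

lemma pless_sections_even: "\<forall>v\<in>set pless_sections. even (sum_list v)"
  by code_simp

text \<open>The alternatives are the parity conditions of \<open>even_coords_mem\<close> and
  \<open>odd_coords_mem\<close>.\<close>

lemma qr_sections_glue:
  "\<forall>v\<in>set qr_sections. (\<forall>a\<in>set v. even a) \<and> 4 dvd sum_list v \<or> (\<forall>a\<in>set v. odd a) \<and> sum_list v mod 4 = 2"
  by code_simp

lemma qr_gen_sums: "\<forall>r\<in>set qr_gen. sum_list r mod 3 = 0"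
  by code_simp

section \<open>The Pless symmetry code\<close>

lemma sum_list_lessThan: "length l = n \<Longrightarrow> (\<Sum>k<n. l ! k) = sum_list l" for l :: "int list"
  by (simp add: sum_list_sum_nth lessThan_atLeast0)

lemma unit_rows_nth: "i < 24 \<Longrightarrow> j < 24 \<Longrightarrow> unit_rows c ! i ! j = (if i = j then c else 0)"
  by (simp add: unit_rows_def)

lemma dots_mod3_nth: "i < length A \<Longrightarrow> j < length A \<Longrightarrow> dots_mod3 A ! i ! j = dot (A ! i) (A ! j) mod 3"
  by (simp add: dots_mod3_def)

lemma generator_checkD:
  assumes "generator_check R"
  shows "length R = 24" "i < 24 \<Longrightarrow> length (R ! i) = 48"
    "i < 24 \<Longrightarrow> j < 24 \<Longrightarrow> R ! i ! j = (if i = j then 1 else 0)"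
    "i < 24 \<Longrightarrow> j < 24 \<Longrightarrow> [(\<Sum>k<48. R ! i ! k * R ! j ! k) = 0] (mod 3)"
    "i < 24 \<Longrightarrow> j < 24 \<Longrightarrow>
      [(\<Sum>k<24. R ! k ! (24 + i) * R ! k ! (24 + j)) = (if i = j then -1 else 0)] (mod 3)"
proof -
  have check: "length R = 24" "\<forall>r\<in>set R. length r = 48" "map (take 24) R = unit_rows 1"
    "dots_mod3 R = unit_rows 0" "dots_mod3 (right_columns R) = unit_rows 2"
    using assms by (auto simp: generator_check_def)
  show len: "length R = 24" by (rule check)
  have row: "length (R ! i) = 48" if "i < 24" for i using check(1,2) that by simp
  show "i < 24 \<Longrightarrow> length (R ! i) = 48" by (rule row)
  assume ij: "i < 24" "j < 24"
  have "R ! i ! j = map (take 24) R ! i ! j" using ij len by simp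
  then show "R ! i ! j = (if i = j then 1 else 0)" using ij by (simp add: check(3) unit_rows_nth)
  have "dot (R ! i) (R ! j) mod 3 = 0"
    using dots_mod3_nth[of i R j] ij len by (simp add: check(4) unit_rows_nth split: if_splits)
  then show "[(\<Sum>k<48. R ! i ! k * R ! j ! k) = 0] (mod 3)"
    using ij row by (simp add: dot_eq_sum[of _ 48] cong_def)
  have col: "length (right_columns R) = 24" "right_columns R ! i = map (\<lambda>r. r ! (24 + i)) R" if "i < 24" for i
    using that by (simp_all add: right_columns_def)
  have "dot (right_columns R ! i) (right_columns R ! j) mod 3 = (if i = j then 2 else 0)"
    using dots_mod3_nth[of i "right_columns R" j] ij col(1)[OF ij(1)] by (simp add: check(5) unit_rows_nth)
  moreover have "dot (right_columns R ! i) (right_columns R ! j) = (\<Sum>k<24. R ! k ! (24 + i) * R ! k ! (24 + j))"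
    using ij len by (subst dot_eq_sum[of _ 24]) (simp_all add: col)
  ultimately show "[(\<Sum>k<24. R ! k ! (24 + i) * R ! k ! (24 + j)) = (if i = j then -1 else 0)] (mod 3)"
    by (simp add: cong_def split: if_splits)
qed

lemma ternary_codeI:
  assumes "bij_betw p UNIV {..<48}" "vec.subspace C" "generator_check R"
    and "\<And>i. i < 24 \<Longrightarrow> codeword p ((!) (R ! i)) \<in> C"
  shows "ternary_code C p R"
  by unfold_locales (use assms generator_checkD[OF assms(3)] in blast)+

lemma sections_checkD:
  assumes "sections_check c R V" "generator_check R"
  shows "length V = 10" "v \<in> set V \<Longrightarrow> length v = 48"
    "v \<in> set V \<Longrightarrow> i < 24 \<Longrightarrow> [(\<Sum>k<48. v ! k * R ! i ! k) = 0] (mod 3)"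
    "i < 10 \<Longrightarrow> j < 10 \<Longrightarrow> (\<Sum>k<48. V ! i ! k * V ! j ! k) = c * K10_rows ! i ! j"
proof -
  note R = generator_checkD(1,2)[OF assms(2)]
  have check: "length V = 10" "\<forall>v\<in>set V. length v = 48 \<and> (\<forall>r\<in>set R. dot v r mod 3 = 0)"
    "map (\<lambda>v. map (dot v) V) V = map (map ((*) c)) K10_rows"
    using assms(1) by (auto simp: sections_check_def)
  show len: "length V = 10" by (rule check)
  have row: "length v = 48" if "v \<in> set V" for v using check(2) that by simp
  show "v \<in> set V \<Longrightarrow> length v = 48" by (rule row)
  {
    assume v: "v \<in> set V" "i < 24"
    then have "dot v (R ! i) mod 3 = 0" using check(2) R(1) by simp
    then show "[(\<Sum>k<48. v ! k * R ! i ! k) = 0] (mod 3)"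
      using v row R(2) by (simp add: dot_eq_sum[of _ 48] cong_def)
  }
  {
    assume ij: "i < 10" "j < 10"
    have K: "length K10_rows = 10" "\<forall>r\<in>set K10_rows. length r = 10" by (simp_all add: K10_rows_def)
    have "map (\<lambda>v. map (dot v) V) V ! i ! j = map (map ((*) c)) K10_rows ! i ! j"
      by (simp only: check(3))
    then have "dot (V ! i) (V ! j) = c * K10_rows ! i ! j"
      using ij len K by (simp add: nth_mem)
    then show "(\<Sum>k<48. V ! i ! k * V ! j ! k) = c * K10_rows ! i ! j"
      using ij row len by (simp add: dot_eq_sum[of _ 48])
  }
qed

lemma K10_gramI:
  assumes "length bs = 10" "\<And>i j. i < 10 \<Longrightarrow> j < 10 \<Longrightarrow> inner (bs ! i) (bs ! j) = of_int (K10_rows ! i ! j)"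
  shows "gram bs = K10_gram"
proof -
  have "gram bs = leading_gram 10"
    using assms by (intro eq_matI) (auto simp: gram_def leading_gram_def K10_gram_index)
  then show ?thesis by (simp add: leading_gram_10)
qed

lemma coord_sections:
  assumes V: "sections_check c R V" and R: "generator_check R" and p: "bij_betw p UNIV {..<48}"
    and s: "s * s * of_int c = 1"
  shows "gram (map (\<lambda>v. s *\<^sub>R coord_vec p ((!) v)) V) = K10_gram"
proof (rule K10_gramI)
  note D = sections_checkD[OF V R]
  show "length (map (\<lambda>v. s *\<^sub>R coord_vec p ((!) v)) V) = 10" using D(1) by simp
  fix i j :: nat assume ij: "i < 10" "j < 10"
  then have "inner (map (\<lambda>v. s *\<^sub>R coord_vec p ((!) v)) V ! i) (map (\<lambda>v. s *\<^sub>R coord_vec p ((!) v)) V ! j) =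
      s * s * of_int (\<Sum>k<48. V ! i ! k * V ! j ! k)"
    using D(1) by (simp add: inner_coord_vec[OF p] del: of_int_sum)
  also have "\<dots> = (s * s * of_int c) * of_int (K10_rows ! i ! j)" using D(4)[OF ij] by simp
  finally show "inner (map (\<lambda>v. s *\<^sub>R coord_vec p ((!) v)) V ! i) (map (\<lambda>v. s *\<^sub>R coord_vec p ((!) v)) V ! j) =
      of_int (K10_rows ! i ! j)" using s by simp
qed

section \<open>The quadratic character modulo 23\<close>

definition residues_23 :: "int list" where
  "residues_23 = [1, 2, 3, 4, 6, 8, 9, 12, 13, 16, 18]"

definition chi_23 :: "int \<Rightarrow> int" where
  "chi_23 a = (if a mod 23 = 0 then 0 else if a mod 23 \<in> set residues_23 then 1 else -1)"

lemma Legendre_23: "Legendre a 23 = chi_23 a"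
proof -
  have squares: "\<forall>z\<in>set [0..22]. z * z mod 23 \<in> set (0 # residues_23)"
    by code_simp
  have roots: "\<forall>r\<in>set residues_23. \<exists>z\<in>set [0..22]. z * z mod 23 = r"
    by code_simp
  have "QuadRes 23 a \<longleftrightarrow> a mod 23 \<in> set residues_23" if "a mod 23 \<noteq> 0"
  proof
    assume "QuadRes 23 a"
    then obtain y where "y\<^sup>2 mod 23 = a mod 23" by (auto simp: QuadRes_def cong_def)
    moreover have "(y mod 23) * (y mod 23) mod 23 = y\<^sup>2 mod 23"
      by (simp add: power2_eq_square mod_mult_eq)
    moreover have "y mod 23 \<in> set [0..22]" by simp
    ultimately show "a mod 23 \<in> set residues_23" using squares that by (metis set_ConsD)
  next
    assume "a mod 23 \<in> set residues_23"
    then obtain z where "z * z mod 23 = a mod 23" using roots by blast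
    then show "QuadRes 23 a" by (auto simp: QuadRes_def cong_def power2_eq_square)
  qed
  then show ?thesis by (auto simp: Legendre_def chi_23_def cong_def)
qed

lemma pless_gen_check:
  "map (drop 24) pless_gen = map (\<lambda>i. map (\<lambda>j.
     if i = 0 \<and> j = 0 then 0 else if i = 0 then 1 else if j = 0 then chi_23 (-1) else chi_23 (int j - int i))
     [0..<24]) [0..<24]"
  by code_simp

lemma codeword_of_nat: "k < 48 \<Longrightarrow> codeword coord_index f $ of_nat k = of_int (f k)"
  using coord_index_of_nat[where 'n = 24, of k] by (simp add: codeword_def)

lemma bij_coord_index_48: "bij_betw coord_index (UNIV :: 48 set) {..<48}"
  using bij_coord_index[where 'n = 24] by simp

lemma pless_ternary_code: "ternary_code pless_code coord_index pless_gen"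
proof (rule ternary_codeI[OF bij_coord_index_48 _ pless_generator_check])
  show "vec.subspace pless_code" unfolding pless_code_def by (rule vec.subspace_span)
  fix i :: nat assume i: "i < 24"
  note D = generator_checkD[OF pless_generator_check]
  have "pless_gen ! i ! (24 + j) = pless_S i j" if j: "j < 24" for j
  proof -
    have "pless_gen ! i ! (24 + j) = map (drop 24) pless_gen ! i ! j" using i j D(1,2) by simp
    then show ?thesis unfolding pless_gen_check using i j by (simp add: pless_S_def Legendre_23)
  qed
  then have "codeword coord_index ((!) (pless_gen ! i)) $ of_nat j = (if j = i then 1 else 0)"
    "codeword coord_index ((!) (pless_gen ! i)) $ of_nat (24 + j) = of_int (pless_S i j)" if "j < 24" for j
    using that i D(3) codeword_of_nat[of "24 + j"] by (simp_all add: codeword_of_nat del: of_nat_add)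
  then have "codeword coord_index ((!) (pless_gen ! i)) \<in> pless_rows"
    unfolding pless_rows_def using i by blast
  then show "codeword coord_index ((!) (pless_gen ! i)) \<in> pless_code"
    unfolding pless_code_def by (rule vec.span_base)
qed

text \<open>All ten vectors are lifts of codewords with even coordinate sum, divided by
  \<open>sqrt 3\<close>. They lie in the even part of the code lattice, which every neighbour
  contains, so no glue vector occurs.\<close>

lemma P48p_vectors:
  assumes "is_P48p L"
  shows "unimodular L" "has_minimum L 6" "dim L = 48"
    "\<exists>bs. length bs = 10 \<and> set bs \<subseteq> L \<and> gram bs = K10_gram"
proof -
  interpret ternary_code pless_code coord_index pless_gen by (rule pless_ternary_code)
  interpret code_neighbour pless_code coord_index pless_gen L
    by unfold_locales (use assms in \<open>simp add: is_P48p_def\<close>)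
  show "unimodular L" "has_minimum L 6" "dim L = 48" by (rule unimodular_L min_L dim_L)+
  note D = sections_checkD[OF pless_sections_check pless_generator_check]
  let ?bs = "map (\<lambda>v. (1 / sqrt 3) *\<^sub>R coord_vec coord_index ((!) v)) pless_sections :: (real^48) list"
  have "gram ?bs = K10_gram"
    by (intro coord_sections[OF pless_sections_check pless_generator_check bij_coord_index_48]) simp
  moreover have "(1 / sqrt 3) *\<^sub>R coord_vec coord_index ((!) v) \<in> L" if "v \<in> set pless_sections" for v
    using D(2,3)[OF that] that pless_sections_even
    by (intro even_mem) (auto simp: dual_word_def sum_list_lessThan)
  ultimately show "\<exists>bs. length bs = 10 \<and> set bs \<subseteq> L \<and> gram bs = K10_gram"
    using D(1) by (intro exI[of _ ?bs]) auto
qed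

section \<open>The extended quadratic residue code\<close>

lemma F3_ac_of_int_eq_0: "3 dvd a \<Longrightarrow> (of_int a :: F3 alg_closure) = 0"
  using F3_of_int_eq_0[of a] to_ac_of_int[of a, where 'a = F3] by simp

lemma F3_ac_three: "(3 :: F3 alg_closure) = 0"
  using F3_ac_of_int_eq_0[of 3] by simp

text \<open>Polynomials are integer coefficient lists, so that identities modulo 3 can be evaluated
  before a root from the algebraic closure is substituted.\<close>

fun horner :: "int list \<Rightarrow> F3 alg_closure \<Rightarrow> F3 alg_closure" where
  "horner [] b = 0"
| "horner (x # xs) b = of_int x + b * horner xs b"

fun poly_add :: "int list \<Rightarrow> int list \<Rightarrow> int list" where
  "poly_add (x # xs) (y # ys) = (x + y) # poly_add xs ys"
| "poly_add [] ys = ys"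
| "poly_add xs [] = xs"

fun poly_mul :: "int list \<Rightarrow> int list \<Rightarrow> int list" where
  "poly_mul [] ys = []"
| "poly_mul (x # xs) ys = poly_add (map ((*) x) ys) (0 # poly_mul xs ys)"

lemma horner_add: "horner (poly_add xs ys) b = horner xs b + horner ys b"
  by (induction xs ys rule: poly_add.induct) (simp_all add: algebra_simps)

lemma horner_smult: "horner (map ((*) c) xs) b = of_int c * horner xs b"
  by (induction xs) (simp_all add: algebra_simps)

lemma horner_mul: "horner (poly_mul xs ys) b = horner xs b * horner ys b"
  by (induction xs) (simp_all add: horner_add horner_smult algebra_simps)

lemma horner_eq_0: "\<forall>c\<in>set xs. c mod 3 = 0 \<Longrightarrow> horner xs b = 0"
  by (induction xs) (auto simp: F3_ac_of_int_eq_0 mod_eq_0_iff_dvd)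

lemma horner_sum: "horner xs b = (\<Sum>i<length xs. of_int (xs ! i) * b ^ i)"
  by (induction xs) (simp_all add: sum.lessThan_Suc_shift sum_distrib_left mult_ac del: sum.lessThan_Suc)

text \<open>The Frobenius map: in characteristic 3 cubing is additive, and it fixes the integer
  coefficients by Fermat.\<close>

lemma horner_cube: "horner xs (b ^ 3) = horner xs b ^ 3"
proof (induction xs)
  case (Cons x xs)
  have x: "(of_int x :: F3 alg_closure) ^ 3 = of_int x"
  proof -
    have "x mod 3 = 0 \<or> x mod 3 = 1 \<or> x mod 3 = 2" by presburger
    then have "(x mod 3) ^ 3 mod 3 = x mod 3" by auto
    then have "3 dvd x ^ 3 - x" by (simp add: power_mod mod_eq_dvd_iff[symmetric])
    then have "(of_int (x ^ 3 - x) :: F3 alg_closure) = 0" by (rule F3_ac_of_int_eq_0)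
    then show ?thesis by simp
  qed
  have "(u + v) ^ 3 = u ^ 3 + v ^ 3 + 3 * (u\<^sup>2 * v + u * v\<^sup>2)" for u v :: "F3 alg_closure"
    by (simp add: power3_eq_cube power2_eq_square algebra_simps)
  then have add: "(u + v) ^ 3 = u ^ 3 + v ^ 3" for u v :: "F3 alg_closure"
    by (simp add: F3_ac_three)
  show ?case by (simp add: add x power_mult_distrib Cons.IH)
qed simp

lemma horner_conjugate: "horner xs b = 0 \<Longrightarrow> horner xs (b ^ 3 ^ k) = 0"
proof (induction k)
  case (Suc k)
  have "horner xs ((b ^ 3 ^ k) ^ 3) = 0" unfolding horner_cube using Suc by simp
  then show ?case by (simp add: power_mult[symmetric] mult.commute)
qed simp

text \<open>The sum, not the difference, vanishes: modulo 3 the product is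
  \<open>1 - x ^ 47\<close>.\<close>

lemma qr_factorization:
  "\<forall>c\<in>set (poly_add (poly_mul [-1, 1] (poly_mul qr_factor (rev qr_factor))) (-1 # replicate 46 0 @ [1])). c mod 3 = 0"
  by code_simp

lemma qr_rows:
  "\<forall>i\<in>set [0..<24]. \<forall>c\<in>set (poly_add (poly_mul (qr_quotients ! i) qr_factor)
     (map ((*) (-1)) (take 47 (qr_gen ! i)))). c mod 3 = 0"
  by code_simp

lemma qr_row_zero:
  assumes "horner qr_factor b = 0" "i < 24"
  shows "(\<Sum>j<47. of_int (qr_gen ! i ! j) * b ^ j) = 0"
proof -
  have "horner (poly_add (poly_mul (qr_quotients ! i) qr_factor) (map ((*) (-1)) (take 47 (qr_gen ! i)))) b = 0"
    using qr_rows assms(2) by (intro horner_eq_0) auto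
  then have "horner (take 47 (qr_gen ! i)) b = 0"
    unfolding horner_add horner_mul horner_smult assms(1) by simp
  then show ?thesis
    using generator_checkD(2)[OF qr_generator_check assms(2)] by (simp add: horner_sum)
qed

text \<open>Reversing the coefficients gives the reciprocal polynomial, and \<open>b\<close> is the
  inverse of \<open>a\<close>.\<close>

lemma horner_rev:
  assumes "a * b = 1"
  shows "horner (rev xs) a = a ^ (length xs - 1) * horner xs b"
proof (cases "xs = []")
  case False
  define n where "n = length xs - 1"
  have n: "length xs = Suc n" using False by (simp add: n_def)
  have "horner (rev xs) a = (\<Sum>i<Suc n. of_int (xs ! (n - i)) * a ^ i)"
    unfolding horner_sum length_rev n by (intro sum.cong refl) (simp add: rev_nth n)
  also have "\<dots> = (\<Sum>i<Suc n. of_int (xs ! i) * a ^ (n - i))"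
    by (rule sum.reindex_bij_witness[of _ "\<lambda>i. n - i" "\<lambda>i. n - i"]) auto
  also have "\<dots> = (\<Sum>i<Suc n. a ^ n * (of_int (xs ! i) * b ^ i))"
  proof (intro sum.cong refl)
    fix i assume "i \<in> {..<Suc n}"
    then have "a ^ n = a ^ (n - i) * a ^ i" by (simp add: power_add[symmetric])
    moreover have "a ^ i * b ^ i = 1" using assms by (simp add: power_mult_distrib[symmetric])
    ultimately have "a ^ n * b ^ i = a ^ (n - i)" by (simp add: mult.assoc)
    then show "of_int (xs ! i) * a ^ (n - i) = a ^ n * (of_int (xs ! i) * b ^ i)"
      by (metis mult.left_commute)
  qed
  also have "\<dots> = a ^ n * horner xs b"
    unfolding horner_sum n sum_distrib_left ..
  finally show ?thesis unfolding n_def .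
qed simp

text \<open>By the factorization \<open>a\<close> is a zero of \<open>qr_factor\<close> or of its
  reversal; in the second case the inverse \<open>a ^ 46\<close> is a zero of
  \<open>qr_factor\<close>.\<close>

lemma qr_root:
  assumes "a ^ 47 = 1" "a \<noteq> 1"
  shows "horner qr_factor a = 0 \<or> horner qr_factor (a ^ 46) = 0"
proof -
  have "horner (replicate n 0 @ [1]) a = a ^ n" for n
    by (induction n) simp_all
  then have "horner (-1 # replicate 46 0 @ [1]) a = a ^ 47 - 1"
    by simp (simp add: power_Suc[symmetric] del: power_Suc)
  then have "horner (poly_mul [-1, 1] (poly_mul qr_factor (rev qr_factor))) a = 0"
    using horner_eq_0[OF qr_factorization, of a] assms(1) unfolding horner_add by simp
  then have "(a - 1) * (horner qr_factor a * horner (rev qr_factor) a) = 0"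
    unfolding horner_mul by simp
  then have "horner qr_factor a = 0 \<or> horner (rev qr_factor) a = 0" using assms(2) by simp
  moreover have "a * a ^ 46 = 1" using assms(1) by (simp add: power_Suc[symmetric] del: power_Suc)
  then have "horner (rev qr_factor) a = a ^ (length qr_factor - 1) * horner qr_factor (a ^ 46)"
    by (rule horner_rev)
  moreover have "a \<noteq> 0" using assms(1) by auto
  ultimately show ?thesis by auto
qed

text \<open>3 has order 23 modulo 47, so its powers run through all nonzero squares. The prescribed
  zeros thus form one orbit of the Frobenius map, and one zero implies the others.\<close>

lemma Legendre_47:
  assumes "r \<in> {1..<47}" "Legendre (int r) 47 = 1"
  obtains k where "r = 3 ^ k mod 47"
proof -
  have squares: "\<forall>z\<in>set [0..46 :: int]. z * z mod 47 \<in> set (0 # map (\<lambda>k. 3 ^ k mod 47) [0..<23])"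
    by code_simp
  have "QuadRes 47 (int r)" using assms(2) by (simp add: Legendre_def split: if_splits)
  then obtain y where "y\<^sup>2 mod 47 = int r mod 47" by (auto simp: QuadRes_def cong_def)
  moreover have "(y mod 47) * (y mod 47) mod 47 = y\<^sup>2 mod 47"
    by (simp add: power2_eq_square mod_mult_eq)
  moreover have "y mod 47 \<in> set [0..46]" by simp
  moreover have "int r mod 47 = int r" using assms(1) by simp
  ultimately have "int r \<in> set (0 # map (\<lambda>k. 3 ^ k mod 47) [0..<23])" using squares by metis
  then obtain k where "int r = 3 ^ k mod 47" using assms(1) by auto
  then have "int r = int (3 ^ k mod 47)" by (simp add: zmod_int)
  then show ?thesis using that by simp
qed

lemma power_mod_47: "b ^ 47 = 1 \<Longrightarrow> b ^ (n mod 47) = b ^ n" for b :: "F3 alg_closure"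
proof -
  assume "b ^ 47 = 1"
  then have "b ^ (47 * (n div 47) + n mod 47) = b ^ (n mod 47)"
    by (simp only: power_add power_mult) simp
  then show ?thesis by simp
qed

lemma qr_row_zero_residue:
  assumes "b ^ 47 = 1" "horner qr_factor b = 0" "r \<in> {1..<47}" "Legendre (int r) 47 = 1" "i < 24"
  shows "(\<Sum>j<47. of_int (qr_gen ! i ! j) * (b ^ r) ^ j) = 0"
proof -
  obtain k where "r = 3 ^ k mod 47" using Legendre_47[OF assms(3,4)] .
  then have "b ^ r = b ^ 3 ^ k" using power_mod_47[OF assms(1)] by simp
  then show ?thesis using qr_row_zero[OF horner_conjugate[OF assms(2)] assms(5)] by simp
qed

section \<open>Membership of the tabulated rows in the code\<close>

lemma sum_codeword: "bij_betw p UNIV {..<48} \<Longrightarrow> (\<Sum>i<48. codeword p f $ of_nat i) = of_int (\<Sum>k<48. f k)"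
proof -
  assume p: "bij_betw p UNIV {..<48}"
  have "(\<Sum>i<48. codeword p f $ of_nat i) = (\<Sum>i\<in>UNIV. codeword p f $ i)"
    using sum.reindex_bij_betw[OF bij_of_nat_bit0[where 'a = 24], of "\<lambda>i. codeword p f $ i"] by simp
  also have "\<dots> = (\<Sum>k<48. of_int (f k))"
    unfolding codeword_def using sum.reindex_bij_betw[OF p, of "\<lambda>k. of_int (f k) :: F3"] by simp
  finally show ?thesis by simp
qed

lemma subspace_extended_qr_code: "vec.subspace (extended_qr_code \<alpha>)"
  unfolding vec.subspace_def extended_qr_code_def
  by (auto simp: sum.distrib distrib_right mult.assoc sum_distrib_left[symmetric])

text \<open>If the root \<open>\<alpha>\<close> belongs to the other factor of the cyclotomic polynomial, reversing the order of the
  coordinates exchanges the two factors.\<close>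

definition reversed_index :: "48 \<Rightarrow> nat" where
  "reversed_index i = (if coord_index i = 47 then 47 else 46 - coord_index i)"

lemma bij_reversed_index: "bij_betw reversed_index UNIV {..<48}"
proof -
  have "bij_betw (\<lambda>k. if k = 47 then 47 else 46 - k) {..<48 :: nat} {..<48}"
    by (rule bij_betw_byWitness[where f' = "\<lambda>k. if k = 47 then 47 else 46 - k"]) (auto split: if_splits)
  from bij_betw_trans[OF bij_coord_index_48 this] show ?thesis
    by (simp add: reversed_index_def[abs_def] comp_def)
qed

lemma qr_ternary_code:
  assumes "is_extended_qr_code C"
  obtains p where "ternary_code C p qr_gen"
proof -
  obtain a where a: "a ^ 47 = 1" "a \<noteq> 1" "C = extended_qr_code a"
    using assms by (auto simp: is_extended_qr_code_def)
  note D = generator_checkD[OF qr_generator_check]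
  have parity: "(\<Sum>k<48. codeword p ((!) (qr_gen ! i)) $ of_nat k) = 0" if "i < 24" "bij_betw p UNIV {..<48}" for i p
  proof -
    have "sum_list (qr_gen ! i) mod 3 = 0" using qr_gen_sums D(1) that(1) by simp
    then show ?thesis
      unfolding sum_codeword[OF that(2)] sum_list_lessThan[OF D(2)[OF that(1)]]
      by (intro F3_of_int_eq_0) (simp add: mod_eq_0_iff_dvd)
  qed
  consider "horner qr_factor a = 0" | "horner qr_factor (a ^ 46) = 0" using qr_root[OF a(1,2)] by blast
  then show ?thesis
  proof cases
    case 1
    have "codeword coord_index ((!) (qr_gen ! i)) \<in> C" if "i < 24" for i
      unfolding a(3) extended_qr_code_def
      using parity[OF that bij_coord_index_48] qr_row_zero_residue[OF a(1) 1 _ _ that]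
      by (simp add: codeword_of_nat)
    then show ?thesis
      using that[OF ternary_codeI[OF bij_coord_index_48 _ qr_generator_check]] subspace_extended_qr_code a(3) by blast
  next
    case 2
    \<comment> \<open>The inverse of \<open>a\<close>.\<close>
    let ?b = "a ^ 46"
    have ab: "a * ?b = 1" using a(1) by (simp add: power_Suc[symmetric] del: power_Suc)
    have b47: "?b ^ 47 = 1" using a(1) by (metis power_mult mult.commute power_one)
    have "(\<Sum>j<47. to_ac (codeword reversed_index ((!) (qr_gen ! i)) $ of_nat j) * (a ^ r) ^ j) = 0"
      if r: "r \<in> {1..<47}" "Legendre (int r) 47 = 1" and i: "i < 24" for r i
    proof -
      have "(\<Sum>j<47. to_ac (codeword reversed_index ((!) (qr_gen ! i)) $ of_nat j) * (a ^ r) ^ j) =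
          (\<Sum>j<47. of_int (qr_gen ! i ! (46 - j)) * (a ^ r) ^ j)"
      proof (intro sum.cong refl)
        fix j :: nat assume "j \<in> {..<47}"
        then have "reversed_index (of_nat j) = 46 - j"
          using coord_index_of_nat[where 'n = 24, of j] by (simp add: reversed_index_def)
        then show "to_ac (codeword reversed_index ((!) (qr_gen ! i)) $ of_nat j) * (a ^ r) ^ j =
            of_int (qr_gen ! i ! (46 - j)) * (a ^ r) ^ j"
          by (simp add: codeword_def)
      qed
      \<comment> \<open>Reading a word backwards replaces the evaluation point by its inverse, up to
        a power of the point.\<close>
      also have "\<dots> = horner (rev (take 47 (qr_gen ! i))) (a ^ r)"
        using D(2)[OF i] by (simp add: horner_sum rev_nth)
      also have "\<dots> = (a ^ r) ^ 46 * horner (take 47 (qr_gen ! i)) (?b ^ r)"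
        using horner_rev[of "a ^ r" "?b ^ r" "take 47 (qr_gen ! i)"] ab D(2)[OF i]
        by (simp add: power_mult_distrib[symmetric])
      also have "horner (take 47 (qr_gen ! i)) (?b ^ r) = 0"
        using qr_row_zero_residue[OF b47 2 r i] D(2)[OF i] by (simp add: horner_sum)
      finally show ?thesis by simp
    qed
    then have "codeword reversed_index ((!) (qr_gen ! i)) \<in> C" if "i < 24" for i
      unfolding a(3) extended_qr_code_def using parity[OF that bij_reversed_index] that by blast
    then show ?thesis
      using that[OF ternary_codeI[OF bij_reversed_index _ qr_generator_check]] subspace_extended_qr_code a(3) by blast
  qed
qed

lemma P48q_vectors:
  assumes "is_P48q L"
  shows "unimodular L" "has_minimum L 6" "dim L = 48"
    "\<exists>bs. length bs = 10 \<and> set bs \<subseteq> L \<and> gram bs = K10_gram"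
proof -
  obtain C where C: "is_extended_qr_code C" "extremal_neighbour C L"
    using assms by (auto simp: is_P48q_def)
  obtain p where "ternary_code C p qr_gen" using qr_ternary_code[OF C(1)] .
  then interpret ternary_code C p qr_gen .
  interpret code_neighbour C p qr_gen L by unfold_locales (rule C(2))
  show "unimodular L" "has_minimum L 6" "dim L = 48" by (rule unimodular_L min_L dim_L)+
  note D = sections_checkD[OF qr_sections_check qr_generator_check]
  \<comment> \<open>The rows sum to 0 modulo 3. \<open>odd_coords_mem\<close> relies on this word to
    fix the glue class of the rows with odd entries.\<close>
  have ones: "dual_word (\<lambda>_. 1)"
    unfolding dual_word_def
  proof (intro allI impI)
    fix i :: nat assume "i < 24"
    then show "[(\<Sum>k<48. 1 * qr_gen ! i ! k) = 0] (mod 3)"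
      using qr_gen_sums generator_checkD(1,2)[OF qr_generator_check] by (simp add: sum_list_lessThan cong_def)
  qed
  let ?bs = "map (\<lambda>v. (1 / (2 * sqrt 3)) *\<^sub>R coord_vec p ((!) v)) qr_sections"
  have "gram ?bs = K10_gram"
    by (intro coord_sections[OF qr_sections_check qr_generator_check p]) simp
  moreover have "(1 / (2 * sqrt 3)) *\<^sub>R coord_vec p ((!) v) \<in> L" if v: "v \<in> set qr_sections" for v
  proof -
    have dual: "dual_word ((!) v)" using D(3)[OF v] by (simp add: dual_word_def)
    have sum: "(\<Sum>k<48. v ! k) = sum_list v" using D(2)[OF v] by (rule sum_list_lessThan)
    have nth: "v ! k \<in> set v" if "k < 48" for k using D(2)[OF v] that by simp
    consider "\<forall>a\<in>set v. even a" "4 dvd sum_list v" | "\<forall>a\<in>set v. odd a" "sum_list v mod 4 = 2"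
      using qr_sections_glue v by blast
    then show ?thesis
    proof cases
      case 1
      then show ?thesis using nth sum by (intro even_coords_mem dual) auto
    next
      case 2
      then show ?thesis using nth sum by (intro odd_coords_mem ones dual) (auto simp: cong_def)
    qed
  qed
  ultimately show "\<exists>bs. length bs = 10 \<and> set bs \<subseteq> L \<and> gram bs = K10_gram"
    using D(1) by (intro exI[of _ ?bs]) auto
qed

section \<open>Nebe's lattice\<close>

definition P48n_trace_int :: "int list" where
  "P48n_trace_int =
    [6, -1, -2, -1, 1, 1, 0, 0, -1, 1, -1, 1, 0, -1, 0, 0, 1, -1, 0, 0, -1, 0, 1, 1, -1, 0,
     -2, 1, 2, 0, -2, 0, 1]"

definition P48n_row :: "nat \<Rightarrow> int list" where
  "P48n_row a = map (\<lambda>b. let d = (if a \<le> b then b - a else a - b) in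
     P48n_trace_int ! (if d \<le> 32 then d else 65 - d)) [0..<48]"

lemma P48n_gram_row:
  assumes "a < 48" "b < 48"
  shows "P48n_gram $$ (a, b) = of_int (P48n_row a ! b)"
proof -
  define d where "d = (if a \<le> b then b - a else a - b)"
  define e where "e = (if d \<le> 32 then d else 65 - d)"
  have e: "e < length P48n_trace_int" using assms by (auto simp: e_def d_def P48n_trace_int_def)
  have "P48n_trace = map of_int P48n_trace_int" by (simp add: P48n_trace_def P48n_trace_int_def)
  then have "P48n_trace ! e = of_int (P48n_trace_int ! e)" using nth_map[OF e, of real_of_int] by simp
  moreover have "P48n_row a ! b = P48n_trace_int ! e"
    using assms(2) by (simp add: P48n_row_def Let_def e_def d_def)
  moreover have "P48n_gram $$ (a, b) = P48n_trace ! e"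
    using assms by (simp add: P48n_gram_def Let_def e_def d_def)
  ultimately show ?thesis by simp
qed

text \<open>With V the table of sections and G the Gram matrix, V G is tabulated first and then
  multiplied by V, so that two rounds of dot products replace the double sum.\<close>

lemma P48n_products_check:
  "length P48n_sections = 10 \<and> length P48n_products = 10 \<and> (\<forall>v\<in>set P48n_sections. length v = 48)"
  "\<forall>a\<in>set [0..<48]. map (dot (P48n_row a)) P48n_sections = map (\<lambda>w. w ! a) P48n_products"
  "map (\<lambda>v. map (dot v) P48n_products) P48n_sections = K10_rows"
  "\<forall>w\<in>set P48n_products. length w = 48"
  by code_simp+

text \<open>The lattice comes with a basis of known Gram matrix, so the integer combinations
  \<open>b v\<close> are in \<open>L\<close> by construction and only inner products have to be
  checked.\<close>

lemma P48n_vectors: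
  assumes "is_P48n L"
  shows "unimodular L" "has_minimum L 6" "dim L = 48"
    "\<exists>bs. length bs = 10 \<and> set bs \<subseteq> L \<and> gram bs = K10_gram"
proof -
  show "unimodular L" "has_minimum L 6"
    using assms by (auto simp: is_P48n_def even_unimodular_def)
  obtain es where es: "indep_list es" "L = int_span es" "gram es = P48n_gram"
    using assms by (auto simp: is_P48n_def has_gram_matrix_def lattice_basis_alt)
  have len: "length es = 48" using length_of_gram[of es] by (simp add: es(3) P48n_gram_def)
  show "dim L = 48" using dim_int_span[OF es(1)] es(2) len by simp
  let ?S = P48n_sections and ?W = P48n_products
  have len_S: "length ?S = 10" "length ?W = 10" "\<And>v. v \<in> set ?S \<Longrightarrow> length v = 48" "\<And>w. w \<in> set ?W \<Longrightarrow> length w = 48"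
    using P48n_products_check(1,4) by auto
  define b where "b v = rcomb (\<lambda>a. of_int (v ! a)) es" for v
  have es_inner: "inner (es ! a) (es ! c) = of_int (P48n_row a ! c)" if "a < 48" "c < 48" for a c
  proof -
    have "gram es $$ (a, c) = inner (es ! a) (es ! c)" using that len by (simp add: gram_def)
    then show ?thesis using P48n_gram_row[OF that] es(3) by simp
  qed
  have prod: "(\<Sum>c<48. P48n_row a ! c * ?S ! j ! c) = ?W ! j ! a" if "a < 48" "j < 10" for a j
  proof -
    have "map (dot (P48n_row a)) ?S ! j = map (\<lambda>w. w ! a) ?W ! j"
      using P48n_products_check(2) that by simp
    then have "dot (P48n_row a) (?S ! j) = ?W ! j ! a" using that len_S by simp
    then show ?thesis using that len_S by (simp add: dot_eq_sum[of _ 48] P48n_row_def)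
  qed
  have gram: "gram (map b ?S) = K10_gram"
  proof (rule K10_gramI)
    show "length (map b ?S) = 10" using len_S by simp
    fix i j :: nat assume ij: "i < 10" "j < 10"
    have "inner (b (?S ! i)) (b (?S ! j)) = (\<Sum>a<48. \<Sum>c<48. of_int (?S ! i ! a) * of_int (?S ! j ! c) * of_int (P48n_row a ! c))"
      unfolding b_def inner_rcomb_rcomb len by (intro sum.cong refl) (simp add: es_inner)
    also have "\<dots> = of_int (\<Sum>a<48. ?S ! i ! a * (\<Sum>c<48. P48n_row a ! c * ?S ! j ! c))"
      by (simp add: sum_distrib_left mult_ac)
    also have "(\<Sum>a<48. ?S ! i ! a * (\<Sum>c<48. P48n_row a ! c * ?S ! j ! c)) = (\<Sum>a<48. ?S ! i ! a * ?W ! j ! a)"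
      using ij by (intro sum.cong refl) (simp add: prod)
    also have "\<dots> = dot (?S ! i) (?W ! j)" using ij len_S by (simp add: dot_eq_sum[of _ 48])
    also have "\<dots> = K10_rows ! i ! j"
      unfolding P48n_products_check(3)[symmetric] using ij len_S by simp
    finally show "inner (map b ?S ! i) (map b ?S ! j) = of_int (K10_rows ! i ! j)"
      using ij len_S by simp
  qed
  have "b v \<in> L" for v unfolding b_def es(2) mem_int_span by (rule exI, rule refl)
  with gram len_S show "\<exists>bs. length bs = 10 \<and> set bs \<subseteq> L \<and> gram bs = K10_gram"
    by (intro exI[of _ "map b ?S"]) auto
qed

lemma P48_sections:
  assumes "is_P48p L \<or> is_P48q L \<or> is_P48n L"
  shows "unimodular L" "has_minimum L 6" "dim L = DIM(real^48)"
    "\<exists>bs. length bs = 10 \<and> set bs \<subseteq> L \<and> gram bs = K10_gram"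
  using assms P48p_vectors[of L] P48q_vectors[of L] P48n_vectors[of L] by auto

theorem theorem14:
  shows "(\<forall>\<Lambda> K8 :: (real^48) set.
      unimodular \<Lambda> \<and> dim \<Lambda> = 48 \<and> has_minimum \<Lambda> 6 \<and>
      saturated K8 \<Lambda> \<and> lattice_isometric K8 sqrt3_E8 \<longrightarrow>
        (\<forall>K. cross_section 9 \<Lambda> K \<and> K8 \<subseteq> K \<longrightarrow> 21870 \<le> lattice_det K) \<and>
        (\<forall>K9. cross_section 9 \<Lambda> K9 \<and> K8 \<subseteq> K9 \<and> has_gram_matrix K9 K9_gram \<longrightarrow>
          (\<forall>K. cross_section 10 \<Lambda> K \<and> K9 \<subseteq> K \<longrightarrow> 54675 \<le> lattice_det K)) \<and>
        (\<forall>K10. cross_section 10 \<Lambda> K10 \<and> K8 \<subseteq> K10 \<and> has_gram_matrix K10 K10_gram \<longrightarrow>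
          (\<forall>K. cross_section 11 \<Lambda> K \<and> K10 \<subseteq> K \<longrightarrow>
            121500 \<le> lattice_det K \<and>
            is_bare_packing 37 \<Lambda> K \<and>
            bare_center_density \<Lambda> K \<le> (3/2) powr (37/2) / sqrt 121500)))
    \<and> (\<forall>\<Lambda> :: (real^48) set. is_P48p \<Lambda> \<or> is_P48q \<Lambda> \<or> is_P48n \<Lambda> \<longrightarrow>
        (\<exists>K8 K9 K10 bs.
          length bs = 10 \<and> gram bs = K10_gram \<and>
          lattice_basis K8 (take 8 bs) \<and> lattice_basis K9 (take 9 bs) \<and> lattice_basis K10 bs \<and>
          saturated K8 \<Lambda> \<and> lattice_isometric K8 sqrt3_E8 \<and>
          saturated K9 \<Lambda> \<and> cross_section 9 \<Lambda> K9 \<and> K8 \<subseteq> K9 \<and>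
          has_gram_matrix K9 K9_gram \<and> lattice_det K9 = 21870 \<and>
          is_bare_packing 39 \<Lambda> K9 \<and>
          bare_center_density \<Lambda> K9 = 2 powr (-20) * 3 powr 16 * 5 powr (-1/2) \<and>
          saturated K10 \<Lambda> \<and> cross_section 10 \<Lambda> K10 \<and> K9 \<subseteq> K10 \<and>
          has_gram_matrix K10 K10_gram \<and> lattice_det K10 = 54675 \<and>
          is_bare_packing 38 \<Lambda> K10 \<and>
          bare_center_density \<Lambda> K10 = 2 powr (-19) * 3 powr (31/2) * 5 powr (-1)))
    \<and> 2 powr (-20) * 3 powr 16 * 5 powr (-1/2) \<in> {18.35..<18.36 :: real}
    \<and> 2 powr (-19) * 3 powr (31/2) * 5 powr (-1) \<in> {9.48..<9.49 :: real}
    \<and> (3/2) powr (37/2) / sqrt 121500 \<in> {5.19..<5.20 :: real}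
    \<and> (3/2) powr (37/2) / sqrt 121500 < (2 :: real) powr (5/2)
    \<and> 2 powr (5/2) \<in> {5.65..<5.66 :: real}"
  (is "?bounds \<and> (\<forall>\<Lambda>. ?extremal \<Lambda> \<longrightarrow> (\<exists>K8 K9 K10 bs. ?sec \<Lambda> K8 K9 K10 bs)) \<and> _")
proof (intro conjI density_numerics)
  show ?bounds
    by (intro allI impI conjI; elim conjE;
        (rule rank_9_bound rank_10_bound rank_11_bound; (assumption | simp)))
  show "\<forall>\<Lambda>. ?extremal \<Lambda> \<longrightarrow> (\<exists>K8 K9 K10 bs. ?sec \<Lambda> K8 K9 K10 bs)"
  proof (intro allI impI)
    fix \<Lambda> :: "(real^48) set" assume \<Lambda>: "is_P48p \<Lambda> \<or> is_P48q \<Lambda> \<or> is_P48n \<Lambda>"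
    obtain bs where bs: "length bs = 10" "set bs \<subseteq> \<Lambda>" "gram bs = K10_gram"
      using P48_sections(4)[OF \<Lambda>] by blast
    have "DIM(real^48) = 48" by simp
    from K10_sections[OF P48_sections(1-3)[OF \<Lambda>] this bs] show "\<exists>K8 K9 K10 bs. ?sec \<Lambda> K8 K9 K10 bs" .
  qed
qed

end
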